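(* Let $Y$ be a Banach sequence lattice with associated Köthe space $Y^{\times}$, and let $X$ be a Banach lattice. For $s=\{\varphi_n\}_{n=1}^\infty\in\ell^{\tau,Y^{\times}}(X^{*})$ the functional $\varphi_s:\ell_{00}^{\tau,Y}(X)\to\mathbb{R}$, $\varphi_s(\{x_n\}_{n=1}^\infty):=\sum_{n=1}^\infty\varphi_n(x_n)$, is continuous; let $Js\in\ell_0^{\tau,Y}(X)^{*}$ denote its unique continuous extension to $\ell_0^{\tau,Y}(X)$. Then the map $J:\ell^{\tau,Y^{\times}}(X^{*})\to\ell_0^{\tau,Y}(X)^{*}$, $s\mapsto Js$, is an isometric isomorphism (onto $\ell_0^{\tau,Y}(X)^{*}$).
   Context: All vector spaces are real. A Banach sequence lattice is a linear subspace $Y\subset\mathbb{R}^{\mathbb{N}}$ containing all canonical sequences $e_n$, with a complete norm $\|\cdot\|_Y$ such that if $f\in\mathbb{R}^{\mathbb{N}}$, $g\in Y$ and $|f|\le|g|$ pointwise, then $f\in Y$ and $\|f\|_Y\le\|g\|_Y$. A finite tuple $(t_1,\dots,t_n)\in\mathbb{R}^n$ is identified with $(t_1,\dots,t_n,0,0,\dots)\in Y$. Associated Köthe space: $Y^{\times}:=\{(\beta_n)\in\mathbb{R}^{\mathbb{N}}:\sum_n|\alpha_n\beta_n|<\infty\ \forall(\alpha_n)\in Y\}$ with norm $\|(\beta_n)\|_{Y^{\times}}:=\sup\{\sum_n|\alpha_n\beta_n|:\|(\alpha_n)\|_Y\le1\}$; it is again a Banach sequence lattice. Krivine's functional calculus: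 let $\mathcal{H}_n$ be the space of continuous $h:\mathbb{R}^n\to\mathbb{R}$ with $h(\lambda t)=\lambda h(t)$ for $\lambda\ge0$, with the pointwise order. For a Banach lattice $X$ and $x=(x_1,\dots,x_n)\in X^n$ there is a unique linear map $\tau_{n,x}:\mathcal{H}_n\to X$ with $\tau_{n,x}(\pi_{n,j})=x_j$ for each coordinate projection $\pi_{n,j}$ and $\tau_{n,x}(h_1\vee h_2)=\tau_{n,x}(h_1)\vee\tau_{n,x}(h_2)$. Write $\|(x_1,\dots,x_n)\|_Y:=\tau_{n,x}\big(t\mapsto\|(t_1,\dots,t_n)\|_Y\big)\in X$ and $\|(x_1,\dots,x_n)\|_{X^n,Y,\tau}:=\big\|\,\|(x_1,\dots,x_n)\|_Y\big\|_X\in\mathbb{R}$. For a Banach lattice $X$: $\ell^{\tau,Y}(X):=\{\{x_j\}_{j=1}^\infty\in X^{\mathbb{N}}:\sup_{n}\|(x_1,\dots,x_n)\|_{X^n,Y,\tau}<\infty\}$ with norm $\|\{x_j\}\|_{\ell^{\tau,Y}(X)}:=\sup_n\|(x_1,\dots,x_n)\|_{X^n,Y,\tau}$. $\ell_{00}^{\tau,Y}(X)$ is the subspace of eventually zero sequences and $\ell_0^{\tau,Y}(X)$ is its closure in $\ell^{\tau,Y}(X)$. The space $\ell^{\tau,Y^{\times}}(X^{*})$ is defined in the same way with $Y^{\times}$ and the dual Banach lattice $X^{*}$ (order: $\varphi_1\le\varphi_2$ iff $\varphi_1(x)\le\varphi_2(x)$ for all $x\ge0$). *)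

theory Defs
  imports "HOL-Analysis.Analysis" "HOL-Library.Lattice_Algebras"
begin

section \<open>Banach lattices\<close>

class banach_lattice = banach + ordered_real_vector + lattice_ab_group_add_abs +
  assumes norm_mono_abs: "\<bar>x\<bar> \<le> \<bar>y\<bar> \<Longrightarrow> norm x \<le> norm y"

instance real :: banach_lattice
  by standard auto

lemma norm_abs_bl [simp]: "norm \<bar>x :: 'a::banach_lattice\<bar> = norm x"
  by (intro antisym norm_mono_abs) simp_all

lemma norm_mono_nonneg: "0 \<le> x \<Longrightarrow> x \<le> y \<Longrightarrow> norm x \<le> norm y"
  for x y :: "'a::banach_lattice"
  by (rule norm_mono_abs) (simp add: order_trans [of 0 x y])

lemma pprt_diff_decomp: "x = pprt x - pprt (- x)" for x :: "'a::banach_lattice"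
  using prts [of x] by (simp add: pprt_neg)


section \<open>The dual Banach lattice\<close>

text \<open>
  The dual of a Banach lattice \<open>'a\<close> is the type \<open>'a \<Rightarrow>\<^sub>L real\<close>.
  Type class instances cannot be restricted to the codomain \<open>real\<close>, so the order is defined for
  codomains that are Banach lattices and conditionally complete linear orders.
\<close>

lemma bdd_above_if_norm_bounded:
  fixes S :: "'b::{banach_lattice, conditionally_complete_linorder} set"
  assumes "\<And>w. w \<in> S \<Longrightarrow> norm w \<le> M"
  shows "bdd_above S"
proof (cases "\<exists>e::'b. 0 < e")
  case True
  then obtain e :: 'b where e: "0 < e" by blast
  then have ne: "0 < norm e" by auto
  let ?c = "(\<bar>M\<bar> + 1) / norm e"
  show ?thesis
  proof (rule bdd_aboveI)
    fix w assume w: "w \<in> S"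
    show "w \<le> ?c *\<^sub>R e"
    proof (rule ccontr)
      assume "\<not> ?thesis"
      then have "?c *\<^sub>R e \<le> w" by simp
      moreover have "0 \<le> ?c *\<^sub>R e" using e ne by (intro scaleR_nonneg_nonneg) auto
      ultimately have "norm (?c *\<^sub>R e) \<le> norm w" by (intro norm_mono_nonneg)
      moreover have "norm (?c *\<^sub>R e) = \<bar>M\<bar> + 1" using ne by simp
      ultimately show False using assms [OF w] by simp
    qed
  qed
next
  case False
  then show ?thesis by (intro bdd_aboveI [of _ 0]) (meson not_le)
qed

lemma norm_cSup_le:
  fixes S :: "'b::{banach_lattice, conditionally_complete_linorder} set"
  assumes ne: "S \<noteq> {}" and M: "\<And>w. w \<in> S \<Longrightarrow> norm w \<le> M" and pos: "0 \<le> Sup S"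
  shows "norm (Sup S) \<le> M"
proof (rule ccontr)
  assume "\<not> ?thesis"
  then have lt: "M < norm (Sup S)" by simp
  have "0 \<le> M" using ne M norm_ge_zero order_trans by blast
  with lt have nS: "0 < norm (Sup S)" by linarith
  then have "M / norm (Sup S) < 1" using lt by simp
  then obtain c where c: "M / norm (Sup S) < c" "c < 1" using dense by blast
  have c0: "0 \<le> c" using c(1) \<open>0 \<le> M\<close> nS
    by (meson divide_nonneg_pos less_imp_le order_trans)
  have "Sup S \<le> c *\<^sub>R Sup S"
  proof (rule cSup_least [OF ne])
    fix w assume w: "w \<in> S"
    show "w \<le> c *\<^sub>R Sup S"
    proof (rule ccontr)
      assume "\<not> ?thesis"
      then have "c *\<^sub>R Sup S \<le> w" by simp
      then have "norm (c *\<^sub>R Sup S) \<le> norm w"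
        using c0 pos by (intro norm_mono_nonneg scaleR_nonneg_nonneg)
      then have "c * norm (Sup S) \<le> M" using M [OF w] c0 by simp
      moreover have "M < c * norm (Sup S)" using c(1) nS by (simp add: divide_less_eq)
      ultimately show False by simp
    qed
  qed
  then have "norm (Sup S) \<le> norm (c *\<^sub>R Sup S)" using pos by (rule norm_mono_nonneg [rotated])
  then have "1 * norm (Sup S) \<le> c * norm (Sup S)" using c0 by simp
  then show False using nS c(2) by (simp del: mult_1)
qed

definition cone_sup :: "('a::banach_lattice \<Rightarrow>\<^sub>L 'b::{banach_lattice, conditionally_complete_linorder}) \<Rightarrow> 'a \<Rightarrow> 'b" where
  "cone_sup f x = (SUP y\<in>{0..x}. blinfun_apply f y)"

lemma cone_sup_norm_bound:
  fixes x :: "'a::banach_lattice"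
  assumes "y \<in> {0..x}" shows "norm (blinfun_apply f y) \<le> norm f * norm x"
  using norm_blinfun [of f y] norm_mono_nonneg [of y x] assms
  by (meson atLeastAtMost_iff mult_left_mono norm_ge_zero order_trans)

lemma cone_sup_bdd: "bdd_above (blinfun_apply f ` {0..x})"
  for f :: "'a::banach_lattice \<Rightarrow>\<^sub>L 'b::{banach_lattice, conditionally_complete_linorder}"
  by (rule bdd_above_if_norm_bounded [of _ "norm f * norm x"]) (auto intro: cone_sup_norm_bound)

lemma cone_sup_upper: "0 \<le> y \<Longrightarrow> y \<le> x \<Longrightarrow> blinfun_apply f y \<le> cone_sup f x"
  unfolding cone_sup_def by (rule cSUP_upper [OF _ cone_sup_bdd]) simp

lemma cone_sup_least:
  "0 \<le> x \<Longrightarrow> (\<And>y. 0 \<le> y \<Longrightarrow> y \<le> x \<Longrightarrow> blinfun_apply f y \<le> u) \<Longrightarrow> cone_sup f x \<le> u"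
  unfolding cone_sup_def by (rule cSUP_least) auto

lemma cone_sup_nonneg: "0 \<le> x \<Longrightarrow> 0 \<le> cone_sup f x"
  using cone_sup_upper [of 0 x f] by (simp add: blinfun.zero_right)

lemma cone_sup_norm: "0 \<le> x \<Longrightarrow> norm (cone_sup f x) \<le> norm f * norm x"
  unfolding cone_sup_def
  by (rule norm_cSup_le)
     (auto intro: cone_sup_norm_bound simp: cone_sup_nonneg [unfolded cone_sup_def])

lemma cone_sup_add:
  assumes x: "0 \<le> x" and y: "0 \<le> y"
  shows "cone_sup f (x + y) = cone_sup f x + cone_sup f y"
proof (rule antisym)
  show "cone_sup f (x + y) \<le> cone_sup f x + cone_sup f y"
  proof (rule cone_sup_least)
    show "0 \<le> x + y" using x y by simp
    fix z assume z: "0 \<le> z" "z \<le> x + y"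
    have "z - inf z x = sup 0 (z - x)"
      unfolding diff_inf_eq_sup add_sup_distrib_left by simp
    also have "\<dots> \<le> y" using z y by (simp add: algebra_simps)
    finally have "z - inf z x \<le> y" .
    then have "blinfun_apply f (inf z x) + blinfun_apply f (z - inf z x)
        \<le> cone_sup f x + cone_sup f y"
      using z x by (intro add_mono cone_sup_upper)
        (simp_all add: le_diff_eq del: diff_inf_eq_sup)
    then show "blinfun_apply f z \<le> cone_sup f x + cone_sup f y"
      by (simp only: blinfun.diff_right add_diff_eq add_diff_cancel_left')
  qed
next
  have "cone_sup f x \<le> cone_sup f (x + y) - cone_sup f y"
  proof (rule cone_sup_least [OF x])
    fix u assume u: "0 \<le> u" "u \<le> x"
    have "cone_sup f y \<le> cone_sup f (x + y) - blinfun_apply f u"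
    proof (rule cone_sup_least [OF y])
      fix v assume v: "0 \<le> v" "v \<le> y"
      have "blinfun_apply f (u + v) \<le> cone_sup f (x + y)"
        using u v by (intro cone_sup_upper add_mono) auto
      then show "blinfun_apply f v \<le> cone_sup f (x + y) - blinfun_apply f u"
        by (simp add: blinfun.add_right algebra_simps)
    qed
    then show "blinfun_apply f u \<le> cone_sup f (x + y) - cone_sup f y"
      by (simp add: algebra_simps)
  qed
  then show "cone_sup f x + cone_sup f y \<le> cone_sup f (x + y)"
    by (simp add: algebra_simps)
qed

lemma cone_sup_scale_le:
  assumes x: "0 \<le> x" and c: "0 < c"
  shows "cone_sup f (c *\<^sub>R x) \<le> c *\<^sub>R cone_sup f x"
proof (rule cone_sup_least)
  show "0 \<le> c *\<^sub>R x" using x c by (simp add: scaleR_nonneg_nonneg)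
  fix y assume y: "0 \<le> y" "y \<le> c *\<^sub>R x"
  have "inverse c *\<^sub>R y \<le> inverse c *\<^sub>R (c *\<^sub>R x)"
    using y c by (intro scaleR_left_mono) auto
  then have "blinfun_apply f (inverse c *\<^sub>R y) \<le> cone_sup f x"
    using y c by (intro cone_sup_upper scaleR_nonneg_nonneg) auto
  then have "c *\<^sub>R blinfun_apply f (inverse c *\<^sub>R y) \<le> c *\<^sub>R cone_sup f x"
    using c by (intro scaleR_left_mono) auto
  then show "blinfun_apply f y \<le> c *\<^sub>R cone_sup f x"
    using c by (simp add: blinfun.scaleR_right)
qed

lemma cone_sup_scale:
  assumes x: "0 \<le> x" and c: "0 < c"
  shows "cone_sup f (c *\<^sub>R x) = c *\<^sub>R cone_sup f x"
proof (rule antisym [OF cone_sup_scale_le [OF x c]])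
  have "cone_sup f (inverse c *\<^sub>R (c *\<^sub>R x)) \<le> inverse c *\<^sub>R cone_sup f (c *\<^sub>R x)"
    using x c by (intro cone_sup_scale_le scaleR_nonneg_nonneg) auto
  then have "c *\<^sub>R cone_sup f x \<le> c *\<^sub>R (inverse c *\<^sub>R cone_sup f (c *\<^sub>R x))"
    using c by (intro scaleR_left_mono) auto
  then show "c *\<^sub>R cone_sup f x \<le> cone_sup f (c *\<^sub>R x)" using c by simp
qed

lemma cone_sup_0 [simp]: "cone_sup f 0 = 0"
  using cone_sup_add [of 0 0 f] by simp

definition cone_ext :: "('a::banach_lattice \<Rightarrow>\<^sub>L 'b::{banach_lattice, conditionally_complete_linorder}) \<Rightarrow> 'a \<Rightarrow> 'b" where
  "cone_ext f x = cone_sup f (pprt x) - cone_sup f (pprt (- x))"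

lemma cone_ext_diff:
  assumes a: "0 \<le> a" and b: "0 \<le> b"
  shows "cone_ext f (a - b) = cone_sup f a - cone_sup f b"
proof -
  let ?p = "pprt (a - b)" and ?n = "pprt (- (a - b))"
  have "?p + b = a + ?n" using pprt_diff_decomp [of "a - b"] by (simp add: algebra_simps)
  then have "cone_sup f ?p + cone_sup f b = cone_sup f a + cone_sup f ?n"
    using a b by (simp add: cone_sup_add [symmetric])
  then show ?thesis unfolding cone_ext_def by (simp add: algebra_simps)
qed

lemma bounded_linear_cone_ext: "bounded_linear (cone_ext f)"
  for f :: "'a::banach_lattice \<Rightarrow>\<^sub>L 'b::{banach_lattice, conditionally_complete_linorder}"
proof
  fix x y :: 'a
  have "x + y = (pprt x + pprt y) - (pprt (- x) + pprt (- y))"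
    by (simp only: add_diff_add pprt_diff_decomp [symmetric])
  then have "cone_ext f (x + y)
      = cone_sup f (pprt x + pprt y) - cone_sup f (pprt (- x) + pprt (- y))"
    by (simp only:) (rule cone_ext_diff; simp)
  then show "cone_ext f (x + y) = cone_ext f x + cone_ext f y"
    by (simp add: cone_sup_add cone_ext_def algebra_simps)
next
  have pos: "cone_ext f (c *\<^sub>R x) = c *\<^sub>R cone_ext f x" if c: "0 < c" for c :: real and x :: 'a
  proof -
    have "c *\<^sub>R x = c *\<^sub>R pprt x - c *\<^sub>R pprt (- x)"
      using pprt_diff_decomp [of x] by (metis scaleR_right_diff_distrib)
    then have "cone_ext f (c *\<^sub>R x) = cone_sup f (c *\<^sub>R pprt x) - cone_sup f (c *\<^sub>R pprt (- x))"
      using c by (simp only:) (rule cone_ext_diff; simp add: scaleR_nonneg_nonneg)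
    then show ?thesis
      using c by (simp add: cone_sup_scale cone_ext_def scaleR_right_diff_distrib)
  qed
  have neg: "cone_ext f (- x) = - cone_ext f x" for x :: 'a
    by (simp add: cone_ext_def)
  fix c :: real and x :: 'a
  consider "0 < c" | "c = 0" | "0 < - c" by linarith
  then show "cone_ext f (c *\<^sub>R x) = c *\<^sub>R cone_ext f x"
  proof cases
    case 3
    then show ?thesis using pos [of "- c" x] neg [of "c *\<^sub>R x"] by simp
  qed (auto simp: pos, simp add: cone_ext_def)
next
  show "\<exists>K. \<forall>x. norm (cone_ext f x) \<le> norm x * K"
  proof (intro exI allI)
    fix x
    have n: "norm (pprt x) \<le> norm x" for x :: 'a
    proof -
      have "pprt x \<le> \<bar>x\<bar>" by (simp add: pprt_def abs_ge_self)
      then show ?thesis using norm_mono_nonneg [of "pprt x" "\<bar>x\<bar>"] by simp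
    qed
    have "norm (cone_ext f x) \<le> norm (cone_sup f (pprt x)) + norm (cone_sup f (pprt (- x)))"
      unfolding cone_ext_def by (rule norm_triangle_ineq4)
    also have "\<dots> \<le> norm f * norm x + norm f * norm x"
      using n [of x] n [of "- x"]
      by (intro add_mono order_trans [OF cone_sup_norm] mult_left_mono) auto
    finally show "norm (cone_ext f x) \<le> norm x * (2 * norm f)" by (simp add: algebra_simps)
  qed
qed

instantiation blinfun :: (banach_lattice, "{banach_lattice, conditionally_complete_linorder}") order
begin

definition less_eq_blinfun :: "('a \<Rightarrow>\<^sub>L 'b) \<Rightarrow> ('a \<Rightarrow>\<^sub>L 'b) \<Rightarrow> bool" where
  "(f :: 'a \<Rightarrow>\<^sub>L 'b) \<le> g \<longleftrightarrow> (\<forall>x\<ge>0. blinfun_apply f x \<le> blinfun_apply g x)"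

definition less_blinfun :: "('a \<Rightarrow>\<^sub>L 'b) \<Rightarrow> ('a \<Rightarrow>\<^sub>L 'b) \<Rightarrow> bool" where
  "(f :: 'a \<Rightarrow>\<^sub>L 'b) < g \<longleftrightarrow> f \<le> g \<and> \<not> g \<le> f"

instance
proof
  fix f g h :: "'a \<Rightarrow>\<^sub>L 'b"
  show "f < g \<longleftrightarrow> f \<le> g \<and> \<not> g \<le> f" by (rule less_blinfun_def)
  show "f \<le> f" by (simp add: less_eq_blinfun_def)
  show "f \<le> g \<Longrightarrow> g \<le> h \<Longrightarrow> f \<le> h" unfolding less_eq_blinfun_def by (meson order_trans)
  assume "f \<le> g" "g \<le> f"
  then have eq: "blinfun_apply f x = blinfun_apply g x" if "0 \<le> x" for x
    using that unfolding less_eq_blinfun_def by (meson antisym)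
  show "f = g"
  proof (rule blinfun_eqI)
    fix x
    have "blinfun_apply h x = blinfun_apply h (pprt x) - blinfun_apply h (pprt (- x))"
      for h :: "'a \<Rightarrow>\<^sub>L 'b"
      using pprt_diff_decomp [of x] by (metis blinfun.diff_right)
    then show "blinfun_apply f x = blinfun_apply g x" by (metis eq zero_le_pprt)
  qed
qed

end

instance blinfun :: (banach_lattice, "{banach_lattice, conditionally_complete_linorder}") ordered_real_vector
  by standard
     (auto simp: less_eq_blinfun_def blinfun.add_left blinfun.scaleR_left
       intro: scaleR_left_mono scaleR_right_mono)

definition blinfun_pos ::
  "('a::banach_lattice \<Rightarrow>\<^sub>L 'b::{banach_lattice, conditionally_complete_linorder}) \<Rightarrow> ('a \<Rightarrow>\<^sub>L 'b)" where
  "blinfun_pos f = Blinfun (cone_ext f)"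

lemma blinfun_pos_apply: "0 \<le> x \<Longrightarrow> blinfun_apply (blinfun_pos f) x = cone_sup f x"
  unfolding blinfun_pos_def bounded_linear_Blinfun_apply [OF bounded_linear_cone_ext]
  using cone_ext_diff [of x 0 f] by simp

lemma blinfun_pos_ge: "f \<le> blinfun_pos f" "0 \<le> blinfun_pos f"
  by (auto simp: less_eq_blinfun_def blinfun_pos_apply cone_sup_nonneg intro: cone_sup_upper)

lemma blinfun_pos_least:
  assumes "f \<le> g" "0 \<le> g" shows "blinfun_pos f \<le> g"
  unfolding less_eq_blinfun_def
proof (intro allI impI)
  fix x :: 'a assume x: "0 \<le> x"
  have "cone_sup f x \<le> blinfun_apply g x"
  proof (rule cone_sup_least [OF x])
    fix y assume y: "0 \<le> y" "y \<le> x"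
    have "0 \<le> blinfun_apply g (x - y)" using assms(2) y by (simp add: less_eq_blinfun_def)
    then have "blinfun_apply g y \<le> blinfun_apply g x" by (simp add: blinfun.diff_right)
    moreover have "blinfun_apply f y \<le> blinfun_apply g y"
      using assms(1) y by (simp add: less_eq_blinfun_def)
    ultimately show "blinfun_apply f y \<le> blinfun_apply g x" by simp
  qed
  then show "blinfun_apply (blinfun_pos f) x \<le> blinfun_apply g x"
    using x by (simp add: blinfun_pos_apply)
qed

instantiation blinfun :: (banach_lattice, "{banach_lattice, conditionally_complete_linorder}") lattice_ab_group_add_abs
begin

definition sup_blinfun :: "('a \<Rightarrow>\<^sub>L 'b) \<Rightarrow> ('a \<Rightarrow>\<^sub>L 'b) \<Rightarrow> ('a \<Rightarrow>\<^sub>L 'b)" where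
  "sup (f :: 'a \<Rightarrow>\<^sub>L 'b) g = g + blinfun_pos (f - g)"

definition inf_blinfun :: "('a \<Rightarrow>\<^sub>L 'b) \<Rightarrow> ('a \<Rightarrow>\<^sub>L 'b) \<Rightarrow> ('a \<Rightarrow>\<^sub>L 'b)" where
  "inf (f :: 'a \<Rightarrow>\<^sub>L 'b) g = - sup (- f) (- g)"

definition abs_blinfun :: "('a \<Rightarrow>\<^sub>L 'b) \<Rightarrow> ('a \<Rightarrow>\<^sub>L 'b)" where
  "\<bar>f :: 'a \<Rightarrow>\<^sub>L 'b\<bar> = sup f (- f)"

instance
proof
  fix f g h :: "'a \<Rightarrow>\<^sub>L 'b"
  have 1: "f \<le> sup f g" for f g :: "'a \<Rightarrow>\<^sub>L 'b"
    using blinfun_pos_ge(1) [of "f - g"] by (simp add: sup_blinfun_def algebra_simps)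
  have 2: "g \<le> sup f g" for f g :: "'a \<Rightarrow>\<^sub>L 'b"
    using blinfun_pos_ge(2) [of "f - g"] by (simp add: sup_blinfun_def)
  have 3: "f \<le> h \<Longrightarrow> g \<le> h \<Longrightarrow> sup f g \<le> h" for f g h :: "'a \<Rightarrow>\<^sub>L 'b"
    using blinfun_pos_least [of "f - g" "h - g"] by (simp add: sup_blinfun_def algebra_simps)
  show "f \<le> sup f g" "g \<le> sup f g" by (rule 1, rule 2)
  show "g \<le> f \<Longrightarrow> h \<le> f \<Longrightarrow> sup g h \<le> f" by (rule 3)
  show "inf f g \<le> f" using 1 [of "- f" "- g"] unfolding inf_blinfun_def
    by (metis minus_le_iff)
  show "inf f g \<le> g" using 2 [of "- g" "- f"] unfolding inf_blinfun_def
    by (metis minus_le_iff)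
  show "f \<le> g \<Longrightarrow> f \<le> h \<Longrightarrow> f \<le> inf g h" using 3 [of "- g" "- f" "- h"]
    unfolding inf_blinfun_def by (metis le_minus_iff minus_minus neg_le_iff_le)
  show "\<bar>f\<bar> = sup f (- f)" by (rule abs_blinfun_def)
qed

end

lemma abs_blinfun_apply_le: "\<bar>blinfun_apply f x\<bar> \<le> blinfun_apply \<bar>f\<bar> \<bar>x\<bar>"
  for f :: "'a::banach_lattice \<Rightarrow>\<^sub>L 'b::{banach_lattice, conditionally_complete_linorder}"
proof -
  have *: "blinfun_apply g x \<le> blinfun_apply \<bar>g\<bar> \<bar>x\<bar>" for g :: "'a \<Rightarrow>\<^sub>L 'b"
  proof -
    have "blinfun_apply g (pprt x) + blinfun_apply (- g) (pprt (- x))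
        \<le> blinfun_apply \<bar>g\<bar> (pprt x) + blinfun_apply \<bar>g\<bar> (pprt (- x))"
      using abs_ge_self [of g] abs_ge_minus_self [of g]
      by (intro add_mono) (auto simp: less_eq_blinfun_def)
    moreover have "blinfun_apply g x = blinfun_apply g (pprt x) + blinfun_apply (- g) (pprt (- x))"
      using pprt_diff_decomp [of x]
      by (metis blinfun.diff_right blinfun.minus_left diff_conv_add_uminus)
    moreover have "\<bar>x\<bar> = pprt x + pprt (- x)" by (simp add: abs_prts pprt_neg)
    ultimately show ?thesis by (simp add: blinfun.add_right)
  qed
  show ?thesis
    using * [of f] * [of "- f"] by (intro abs_leI) (auto simp: blinfun.minus_left)
qed

lemma norm_abs_blinfun_le: "norm \<bar>f\<bar> \<le> norm f"
  for f :: "'a::banach_lattice \<Rightarrow>\<^sub>L 'b::{banach_lattice, conditionally_complete_linorder}"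
proof (rule norm_blinfun_bound [OF norm_ge_zero])
  fix x :: 'a
  let ?y = "\<bar>x\<bar>" and ?S = "(\<lambda>y. blinfun_apply f (2 *\<^sub>R y - \<bar>x\<bar>)) ` {0..\<bar>x\<bar>}"
  have abs: "\<bar>f\<bar> = blinfun_pos (2 *\<^sub>R f) - f"
    by (simp add: abs_blinfun_def sup_blinfun_def scaleR_2)
  have nn: "0 \<le> blinfun_apply \<bar>f\<bar> ?y"
    using abs_ge_zero [of f] unfolding less_eq_blinfun_def by simp
  have bound: "norm w \<le> norm f * norm x" if w: "w \<in> ?S" for w
  proof -
    from w obtain y where y: "0 \<le> y" "y \<le> ?y" "w = blinfun_apply f (2 *\<^sub>R y - ?y)" by auto
    have "\<bar>2 *\<^sub>R y - ?y\<bar> \<le> ?y"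
      using y add_mono [OF y(2) y(2)] by (intro abs_leI) (auto simp: scaleR_2 algebra_simps)
    then have "norm (2 *\<^sub>R y - ?y) \<le> norm x"
      using norm_mono_abs [of "2 *\<^sub>R y - ?y" "\<bar>x\<bar>"] by simp
    then show ?thesis
      unfolding y(3) using norm_blinfun [of f "2 *\<^sub>R y - ?y"]
      by (meson mult_left_mono norm_ge_zero order_trans)
  qed
  have Sup: "Sup ?S = blinfun_apply \<bar>f\<bar> ?y"
  proof (rule antisym)
    show "Sup ?S \<le> blinfun_apply \<bar>f\<bar> ?y"
    proof (rule cSup_least)
      show "?S \<noteq> {}" by auto
      fix w assume "w \<in> ?S"
      then obtain y where y: "0 \<le> y" "y \<le> ?y" "w = blinfun_apply f (2 *\<^sub>R y - ?y)" by auto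
      have "blinfun_apply (2 *\<^sub>R f) y \<le> cone_sup (2 *\<^sub>R f) ?y"
        by (rule cone_sup_upper [OF y(1,2)])
      then show "w \<le> blinfun_apply \<bar>f\<bar> ?y"
        unfolding abs y(3)
        by (simp add: blinfun.diff_left blinfun.diff_right blinfun.scaleR_left
            blinfun.scaleR_right blinfun_pos_apply)
    qed
    have "cone_sup (2 *\<^sub>R f) ?y \<le> Sup ?S + blinfun_apply f ?y"
    proof (rule cone_sup_least)
      fix y assume y: "0 \<le> y" "y \<le> ?y"
      have "blinfun_apply f (2 *\<^sub>R y - ?y) \<le> Sup ?S"
        using y bound by (intro cSup_upper bdd_above_if_norm_bounded [of ?S]) auto
      then show "blinfun_apply (2 *\<^sub>R f) y \<le> Sup ?S + blinfun_apply f ?y"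
        by (simp add: blinfun.diff_right blinfun.scaleR_left blinfun.scaleR_right algebra_simps)
    qed simp
    then show "blinfun_apply \<bar>f\<bar> ?y \<le> Sup ?S"
      unfolding abs by (simp add: blinfun.diff_left blinfun_pos_apply algebra_simps)
  qed
  have "norm (blinfun_apply \<bar>f\<bar> x) \<le> norm (blinfun_apply \<bar>f\<bar> ?y)"
    using abs_blinfun_apply_le [of "\<bar>f\<bar>" x] nn by (intro norm_mono_abs) simp
  also have "\<dots> \<le> norm f * norm x"
    unfolding Sup [symmetric]
  proof (rule norm_cSup_le)
    show "?S \<noteq> {}" by auto
    show "0 \<le> Sup ?S" unfolding Sup by (rule nn)
  qed (rule bound)
  finally show "norm (blinfun_apply \<bar>f\<bar> x) \<le> norm f * norm x" .
qed

instance blinfun :: (banach_lattice, "{banach_lattice, conditionally_complete_linorder}") banach_lattice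
proof
  fix f g :: "'a \<Rightarrow>\<^sub>L 'b"
  assume le: "\<bar>f\<bar> \<le> \<bar>g\<bar>"
  show "norm f \<le> norm g"
  proof (rule norm_blinfun_bound [OF norm_ge_zero])
    fix x
    have "\<bar>blinfun_apply f x\<bar> \<le> blinfun_apply \<bar>g\<bar> \<bar>x\<bar>"
      using abs_blinfun_apply_le [of f x] le
      by (meson abs_ge_zero less_eq_blinfun_def order_trans)
    then have "norm (blinfun_apply f x) \<le> norm (blinfun_apply \<bar>g\<bar> \<bar>x\<bar>)"
      by (intro norm_mono_abs) (metis abs_ge_self order_trans)
    also have "\<dots> \<le> norm \<bar>g\<bar> * norm x"
      using norm_blinfun [of "\<bar>g\<bar>" "\<bar>x\<bar>"] by simp
    also have "\<dots> \<le> norm g * norm x"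
      by (intro mult_right_mono norm_abs_blinfun_le) auto
    finally show "norm (blinfun_apply f x) \<le> norm g * norm x" .
  qed
qed


section \<open>Normed spaces of functions given by a carrier and a norm\<close>

definition normed_fun_space :: "('i \<Rightarrow> 'v::real_vector) set \<Rightarrow> (('i \<Rightarrow> 'v) \<Rightarrow> real) \<Rightarrow> bool" where
  "normed_fun_space V N \<longleftrightarrow>
     (\<lambda>i. 0) \<in> V \<and>
     (\<forall>f\<in>V. \<forall>g\<in>V. (\<lambda>i. f i + g i) \<in> V) \<and>
     (\<forall>c. \<forall>f\<in>V. (\<lambda>i. c *\<^sub>R f i) \<in> V) \<and>
     (\<forall>f\<in>V. 0 \<le> N f) \<and>
     (\<forall>f\<in>V. N f = 0 \<longleftrightarrow> f = (\<lambda>i. 0)) \<and>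
     (\<forall>f\<in>V. \<forall>g\<in>V. N (\<lambda>i. f i + g i) \<le> N f + N g) \<and>
     (\<forall>c. \<forall>f\<in>V. N (\<lambda>i. c *\<^sub>R f i) = \<bar>c\<bar> * N f)"

text \<open>
  The case distinction is needed because the locale \<open>Metric_space\<close> requires its distance to be
  nonnegative and symmetric also outside the carrier.
\<close>

definition norm_dist ::
  "('i \<Rightarrow> 'v::real_vector) set \<Rightarrow> (('i \<Rightarrow> 'v) \<Rightarrow> real) \<Rightarrow> ('i \<Rightarrow> 'v) \<Rightarrow> ('i \<Rightarrow> 'v) \<Rightarrow> real" where
  "norm_dist V N f g = (if f \<in> V \<and> g \<in> V then N (\<lambda>i. f i - g i) else 0)"

lemma Metric_space_norm_dist:
  assumes "normed_fun_space V N" shows "Metric_space V (norm_dist V N)"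
proof -
  have add: "(\<lambda>i. f i + g i) \<in> V" "N (\<lambda>i. f i + g i) \<le> N f + N g" if "f \<in> V" "g \<in> V" for f g
    using assms that unfolding normed_fun_space_def by blast+
  have scale: "(\<lambda>i. c *\<^sub>R f i) \<in> V" "N (\<lambda>i. c *\<^sub>R f i) = \<bar>c\<bar> * N f" if "f \<in> V" for c f
    using assms that unfolding normed_fun_space_def by blast+
  have pos: "0 \<le> N f" "N f = 0 \<longleftrightarrow> f = (\<lambda>i. 0)" if "f \<in> V" for f
    using assms that unfolding normed_fun_space_def by blast+
  have diff: "(\<lambda>i. f i - g i) \<in> V" if "f \<in> V" "g \<in> V" for f g
    using add(1) [OF that(1) scale(1) [OF that(2), of "- 1"]] by simp
  show ?thesis
  proof
    fix f g h
    show "0 \<le> norm_dist V N f g" by (simp add: norm_dist_def pos(1) diff)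
    show "norm_dist V N f g = norm_dist V N g f"
      using scale(2) [OF diff, of f g "- 1"] by (auto simp: norm_dist_def)
    assume f: "f \<in> V" and g: "g \<in> V"
    show "norm_dist V N f g = 0 \<longleftrightarrow> f = g"
      using f g by (auto simp: norm_dist_def pos(2) diff fun_eq_iff)
    assume h: "h \<in> V"
    show "norm_dist V N f h \<le> norm_dist V N f g + norm_dist V N g h"
      using add(2) [OF diff [OF f g] diff [OF g h]] f g h by (simp add: norm_dist_def)
  qed
qed

definition norm_topology ::
  "('i \<Rightarrow> 'v::real_vector) set \<Rightarrow> (('i \<Rightarrow> 'v) \<Rightarrow> real) \<Rightarrow> ('i \<Rightarrow> 'v) topology" where
  "norm_topology V N = Metric_space.mtopology V (norm_dist V N)"

text \<open>
  A functional on \<open>V\<close> is encoded as a function on the whole type that vanishes outside \<open>V\<close>, so that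
  distinct functionals are distinct functions and the linear operations are pointwise.
\<close>

definition dual_space ::
  "('i \<Rightarrow> 'v::real_vector) set \<Rightarrow> (('i \<Rightarrow> 'v) \<Rightarrow> real) \<Rightarrow> (('i \<Rightarrow> 'v) \<Rightarrow> real) set" where
  "dual_space V N = {F.
     (\<forall>f\<in>V. \<forall>g\<in>V. F (\<lambda>i. f i + g i) = F f + F g) \<and>
     (\<forall>c. \<forall>f\<in>V. F (\<lambda>i. c *\<^sub>R f i) = c * F f) \<and>
     continuous_map (norm_topology V N) euclideanreal F \<and>
     (\<forall>f. f \<notin> V \<longrightarrow> F f = 0)}"

definition dual_norm ::
  "('i \<Rightarrow> 'v::real_vector) set \<Rightarrow> (('i \<Rightarrow> 'v) \<Rightarrow> real) \<Rightarrow> (('i \<Rightarrow> 'v) \<Rightarrow> real) \<Rightarrow> real" where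
  "dual_norm V N F = (SUP f\<in>{f \<in> V. N f \<le> 1}. \<bar>F f\<bar>)"

definition isometric_isomorphism ::
  "('i \<Rightarrow> 'v::real_vector) set \<Rightarrow> (('i \<Rightarrow> 'v) \<Rightarrow> real) \<Rightarrow>
   ('j \<Rightarrow> 'w::real_vector) set \<Rightarrow> (('j \<Rightarrow> 'w) \<Rightarrow> real) \<Rightarrow> (('i \<Rightarrow> 'v) \<Rightarrow> ('j \<Rightarrow> 'w)) \<Rightarrow> bool" where
  "isometric_isomorphism V N W M T \<longleftrightarrow>
     bij_betw T V W \<and>
     (\<forall>f\<in>V. \<forall>g\<in>V. T (\<lambda>i. f i + g i) = (\<lambda>j. T f j + T g j)) \<and>
     (\<forall>c. \<forall>f\<in>V. T (\<lambda>i. c *\<^sub>R f i) = (\<lambda>j. c *\<^sub>R T f j)) \<and>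
     (\<forall>f\<in>V. M (T f) = N f)"


section \<open>Banach sequence lattices and Koethe duals\<close>

definition banach_sequence_lattice :: "(nat \<Rightarrow> real) set \<Rightarrow> ((nat \<Rightarrow> real) \<Rightarrow> real) \<Rightarrow> bool" where
  "banach_sequence_lattice Y N \<longleftrightarrow>
     normed_fun_space Y N \<and>
     Metric_space.mcomplete Y (norm_dist Y N) \<and>
     (\<forall>n. (\<lambda>i. if i = n then 1 else 0) \<in> Y) \<and>
     (\<forall>f. \<forall>g\<in>Y. (\<forall>i. \<bar>f i\<bar> \<le> \<bar>g i\<bar>) \<longrightarrow> f \<in> Y \<and> N f \<le> N g)"

definition kothe_dual :: "(nat \<Rightarrow> real) set \<Rightarrow> (nat \<Rightarrow> real) set" where
  "kothe_dual Y = {\<beta>. \<forall>\<alpha>\<in>Y. summable (\<lambda>n. \<bar>\<alpha> n * \<beta> n\<bar>)}"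

definition kothe_norm ::
  "(nat \<Rightarrow> real) set \<Rightarrow> ((nat \<Rightarrow> real) \<Rightarrow> real) \<Rightarrow> (nat \<Rightarrow> real) \<Rightarrow> real" where
  "kothe_norm Y N \<beta> = (SUP \<alpha>\<in>{\<alpha> \<in> Y. N \<alpha> \<le> 1}. \<Sum>n. \<bar>\<alpha> n * \<beta> n\<bar>)"


section \<open>Krivine's functional calculus\<close>

text \<open>
  The space of real \<open>n\<close>-tuples is the topological space \<open>Euclidean_space n\<close>, whose points are the
  sequences vanishing from index \<open>n\<close> on; in particular tuples already are sequences.
  Functions of \<open>n\<close> variables are extended by \<open>0\<close> to all sequences.
\<close>

definition on_tuples :: "nat \<Rightarrow> ((nat \<Rightarrow> real) \<Rightarrow> real) \<Rightarrow> (nat \<Rightarrow> real) \<Rightarrow> real" where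
  "on_tuples n h t = (if t \<in> topspace (Euclidean_space n) then h t else 0)"

definition hom_funs :: "nat \<Rightarrow> ((nat \<Rightarrow> real) \<Rightarrow> real) set" where
  "hom_funs n = {h.
     continuous_map (Euclidean_space n) euclideanreal h \<and>
     (\<forall>t\<in>topspace (Euclidean_space n). \<forall>c\<ge>0. h (\<lambda>i. c * t i) = c * h t) \<and>
     (\<forall>t. t \<notin> topspace (Euclidean_space n) \<longrightarrow> h t = 0)}"

text \<open>
  The last condition only normalizes \<open>\<tau>\<close> outside \<open>hom_funs n\<close>, so that \<open>\<tau>\<close> can be unique.
  Only the entries \<open>x 0, \<dots>, x (n - 1)\<close> matter.
\<close>

definition is_krivine_calculus ::
  "nat \<Rightarrow> (nat \<Rightarrow> 'a::banach_lattice) \<Rightarrow> (((nat \<Rightarrow> real) \<Rightarrow> real) \<Rightarrow> 'a) \<Rightarrow> bool" where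
  "is_krivine_calculus n x \<tau> \<longleftrightarrow>
     (\<forall>h\<in>hom_funs n. \<forall>k\<in>hom_funs n. \<tau> (\<lambda>t. h t + k t) = \<tau> h + \<tau> k) \<and>
     (\<forall>c. \<forall>h\<in>hom_funs n. \<tau> (\<lambda>t. c * h t) = c *\<^sub>R \<tau> h) \<and>
     (\<forall>j<n. \<tau> (on_tuples n (\<lambda>t. t j)) = x j) \<and>
     (\<forall>h\<in>hom_funs n. \<forall>k\<in>hom_funs n. \<tau> (\<lambda>t. max (h t) (k t)) = sup (\<tau> h) (\<tau> k)) \<and>
     (\<forall>h. h \<notin> hom_funs n \<longrightarrow> \<tau> h = 0)"

definition krivine_calculus ::
  "nat \<Rightarrow> (nat \<Rightarrow> 'a::banach_lattice) \<Rightarrow> ((nat \<Rightarrow> real) \<Rightarrow> real) \<Rightarrow> 'a" where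
  "krivine_calculus n x = (THE \<tau>. is_krivine_calculus n x \<tau>)"


section \<open>The vector-valued sequence spaces\<close>

text \<open>
  These depend on a Banach sequence lattice only through the values of its norm \<open>N\<close> on finite tuples.
  Accordingly the carriers \<open>Y\<close> and \<open>kothe_dual Y\<close>, both of which contain all finite tuples, are not arguments.
\<close>

definition tuple_norm :: "((nat \<Rightarrow> real) \<Rightarrow> real) \<Rightarrow> nat \<Rightarrow> (nat \<Rightarrow> 'a::banach_lattice) \<Rightarrow> real" where
  "tuple_norm N n x = norm (krivine_calculus n x (on_tuples n N))"

definition ell_tau :: "((nat \<Rightarrow> real) \<Rightarrow> real) \<Rightarrow> (nat \<Rightarrow> 'a::banach_lattice) set" where
  "ell_tau N = {x. bdd_above ((\<lambda>n. tuple_norm N n x) ` {1..})}"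

definition ell_tau_norm :: "((nat \<Rightarrow> real) \<Rightarrow> real) \<Rightarrow> (nat \<Rightarrow> 'a::banach_lattice) \<Rightarrow> real" where
  "ell_tau_norm N x = (SUP n\<in>{1..}. tuple_norm N n x)"

definition ell_tau_00 :: "((nat \<Rightarrow> real) \<Rightarrow> real) \<Rightarrow> (nat \<Rightarrow> 'a::banach_lattice) set" where
  "ell_tau_00 N = {x \<in> ell_tau N. \<exists>m. \<forall>n\<ge>m. x n = 0}"

definition ell_tau_0 :: "((nat \<Rightarrow> real) \<Rightarrow> real) \<Rightarrow> (nat \<Rightarrow> 'a::banach_lattice) set" where
  "ell_tau_0 N = norm_topology (ell_tau N) (ell_tau_norm N) closure_of ell_tau_00 N"


section \<open>The duality map\<close>

definition seq_pairing :: "(nat \<Rightarrow> 'a::banach_lattice \<Rightarrow>\<^sub>L real) \<Rightarrow> (nat \<Rightarrow> 'a) \<Rightarrow> real" where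
  "seq_pairing s x = (\<Sum>n. blinfun_apply (s n) (x n))"

definition is_continuous_extension ::
  "((nat \<Rightarrow> real) \<Rightarrow> real) \<Rightarrow> (nat \<Rightarrow> 'a::banach_lattice \<Rightarrow>\<^sub>L real) \<Rightarrow> ((nat \<Rightarrow> 'a) \<Rightarrow> real) \<Rightarrow> bool" where
  "is_continuous_extension N s F \<longleftrightarrow>
     continuous_map (norm_topology (ell_tau_0 N) (ell_tau_norm N)) euclideanreal F \<and>
     (\<forall>x\<in>ell_tau_00 N. F x = seq_pairing s x) \<and>
     (\<forall>x. x \<notin> ell_tau_0 N \<longrightarrow> F x = 0)"

definition duality_map ::
  "((nat \<Rightarrow> real) \<Rightarrow> real) \<Rightarrow> (nat \<Rightarrow> 'a::banach_lattice \<Rightarrow>\<^sub>L real) \<Rightarrow> (nat \<Rightarrow> 'a) \<Rightarrow> real" where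
  "duality_map N s = (THE F. is_continuous_extension N s F)"

end

theory Submission
  imports Defs
begin

text \<open>
  Evaluating a lattice-linear expression at \<open>x\<close> is positive in the function it defines on tuples: by
  Gordan's theorem an infimum of linear forms is nowhere positive only if some convex combination of
  the forms vanishes. Lattice-linear functions approximate every positively homogeneous function
  uniformly, so evaluation extends uniquely to Krivine's functional calculus.

  In the calculus \<open>\<parallel>x\<parallel>\<^sub>Y\<close> is the least upper bound of the linear combinations \<open>\<Sum>i. b i \<cdot> x i\<close> over the unit
  ball of the Koethe dual of \<open>Y\<close>, which yields all norm properties. A partition of unity \<open>h\<^sub>k\<close> on the
  sphere at points \<open>s\<^sub>k\<close> gives \<open>x i \<approx> \<Sum>k. s\<^sub>k i \<cdot> h\<^sub>k(x)\<close> and with it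
  \<open>\<Sum>i. \<phi> i (x i) \<le> \<parallel>\<phi>\<parallel> (\<parallel>x\<parallel>)\<close>, hence \<open>\<parallel>Js\<parallel> \<le> \<parallel>s\<parallel>\<close>. Conversely, by Riesz--Kantorovich
  \<open>\<parallel>\<phi>\<parallel>(u)\<close> is approximated by sums \<open>\<Sum>t. \<Sum>i. t i \<cdot> \<phi> i (v t)\<close> with \<open>v t \<ge> 0\<close> and \<open>\<Sum>t. v t = u\<close>, that is by
  \<open>\<Sum>i. \<phi> i (x i)\<close> for \<open>x i = \<Sum>t. t i \<cdot> v t\<close>, and \<open>\<parallel>x\<parallel> \<le> u\<close> because each \<open>t\<close> lies in the unit ball.
\<close>

section \<open>Banach lattices\<close>

text \<open>A supremum over a ball of tuples runs over infinitely many vectors, and a Banach lattice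
  need not have such suprema. Homogeneous functions are therefore compared on a compact sphere,
  where finitely many linear forms suffice up to \<epsilon>. All errors are measured against
  \<open>l1_fun n\<close>, which is itself lattice-linear with value
  \<open>\<Sum>i<n. \<bar>x i\<bar>\<close> at \<open>x\<close>: a pointwise error of \<epsilon>
  times it becomes an order error of \<epsilon> times a fixed vector, and such errors disappear
  because a Banach lattice is Archimedean. For infinite sequences the norm of \<open>Y\<close> need
  not be recovered from its Koethe dual, but on finite tuples it is. This is why all estimates are
  made for each length \<open>n\<close> separately and only then passed to the sequence spaces, with
  constants independent of \<open>n\<close>.\<close>

text \<open>Since \<open>inf x v + sup x v = x + v\<close> in a lattice-ordered group, bounds on the
  infimum and on the supremum together bound \<open>v\<close>. Used for \<open>y\<close> and
  \<open>z\<close> this bounds \<open>sup y z\<close>; the identity for \<open>sup y z\<close> then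
  turns the result into a bound on \<open>inf x (sup y z)\<close>.\<close>

lemma inf_sup_distrib_group:
  fixes x y z :: "'a::lattice_ab_group_add"
  shows "inf x (sup y z) = sup (inf x y) (inf x z)"
proof (rule antisym)
  let ?u = "sup y z" and ?w = "sup (inf x y) (inf x z)"
  have *: "v \<le> ?w + sup x ?u - x" if "v = y \<or> v = z" for v
  proof -
    have "v = inf x v + sup x v - x"
      using add_eq_inf_sup [of x v] by (simp add: algebra_simps)
    also have "\<dots> \<le> ?w + sup x ?u - x"
      using that by (intro diff_right_mono add_mono sup_mono) (auto intro: le_supI1 le_supI2)
    finally show ?thesis .
  qed
  have "?u \<le> ?w + sup x ?u - x" using * by (intro sup_least) auto
  then show "inf x ?u \<le> ?w"
    using add_eq_inf_sup [of x ?u] by (simp add: algebra_simps)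
qed (auto intro: le_infI1 le_infI2)

lemma abs_sup_diff_le:
  fixes a b c d :: "'a::lattice_ab_group_add_abs"
  shows "\<bar>sup a b - sup c d\<bar> \<le> \<bar>a - c\<bar> + \<bar>b - d\<bar>"
proof -
  have *: "sup a b \<le> sup c d + (\<bar>a - c\<bar> + \<bar>b - d\<bar>)" for a b c d :: 'a
  proof (rule sup_least)
    have "a - c \<le> \<bar>a - c\<bar> + \<bar>b - d\<bar>" by (rule order_trans [OF abs_ge_self]) simp
    then have "c + (a - c) \<le> sup c d + (\<bar>a - c\<bar> + \<bar>b - d\<bar>)" by (rule add_mono [OF sup_ge1])
    then show "a \<le> sup c d + (\<bar>a - c\<bar> + \<bar>b - d\<bar>)" by simp
    have "b - d \<le> \<bar>a - c\<bar> + \<bar>b - d\<bar>" by (rule order_trans [OF abs_ge_self]) simp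
    then have "d + (b - d) \<le> sup c d + (\<bar>a - c\<bar> + \<bar>b - d\<bar>)" by (rule add_mono [OF sup_ge2])
    then show "b \<le> sup c d + (\<bar>a - c\<bar> + \<bar>b - d\<bar>)" by simp
  qed
  show ?thesis
    using * [of a b c d] * [of c d a b]
    by (intro abs_leI)
      (simp_all only: minus_diff_eq diff_le_eq abs_minus_commute [of c] abs_minus_commute [of d] add.commute)
qed

text \<open>Joint Lipschitz continuity of \<open>sup\<close>, by which approximants of two values of
  the calculus can be combined under \<open>max\<close>.\<close>

lemma norm_sup_diff_le:
  fixes a b c d :: "'a::banach_lattice"
  shows "norm (sup a b - sup c d) \<le> norm (a - c) + norm (b - d)"
proof -
  have "norm (sup a b - sup c d) \<le> norm (\<bar>a - c\<bar> + \<bar>b - d\<bar>)"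
    using abs_sup_diff_le [of a b c d] by (intro norm_mono_abs) (simp add: abs_of_nonneg)
  also have "\<dots> \<le> norm (a - c) + norm (b - d)"
    using norm_triangle_ineq [of "\<bar>a - c\<bar>" "\<bar>b - d\<bar>"] by simp
  finally show ?thesis .
qed

text \<open>One inequality for all scalars is enough: used for \<open>inverse c\<close> and the
  scaled vector it gives the reverse one for \<open>c\<close>.\<close>

lemma abs_scaleR_lattice: "\<bar>c *\<^sub>R x\<bar> = \<bar>c\<bar> *\<^sub>R \<bar>x\<bar>" for x :: "'a::banach_lattice"
proof -
  have le: "\<bar>c *\<^sub>R x\<bar> \<le> \<bar>c\<bar> *\<^sub>R \<bar>x\<bar>" for c and x :: 'a
  proof (cases "0 \<le> c")
    case True
    then have "c *\<^sub>R x \<le> c *\<^sub>R \<bar>x\<bar>" "c *\<^sub>R (- x) \<le> c *\<^sub>R \<bar>x\<bar>"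
      by (intro scaleR_left_mono abs_ge_self abs_ge_minus_self; simp)+
    with True show ?thesis by (intro abs_leI) auto
  next
    case False
    then have "(- c) *\<^sub>R x \<le> (- c) *\<^sub>R \<bar>x\<bar>" "(- c) *\<^sub>R (- x) \<le> (- c) *\<^sub>R \<bar>x\<bar>"
      by (intro scaleR_left_mono abs_ge_self abs_ge_minus_self; simp)+
    with False show ?thesis by (intro abs_leI) auto
  qed
  show ?thesis
  proof (cases "c = 0")
    case False
    have "\<bar>inverse c *\<^sub>R (c *\<^sub>R x)\<bar> \<le> \<bar>inverse c\<bar> *\<^sub>R \<bar>c *\<^sub>R x\<bar>" by (rule le)
    then have "\<bar>c\<bar> *\<^sub>R \<bar>x\<bar> \<le> \<bar>c\<bar> *\<^sub>R (\<bar>inverse c\<bar> *\<^sub>R \<bar>c *\<^sub>R x\<bar>)"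
      using False by (intro scaleR_left_mono) auto
    also have "\<dots> = \<bar>c *\<^sub>R x\<bar>" using False by simp
    finally show ?thesis using le by (intro antisym)
  qed auto
qed

lemma scaleR_sup_distrib:
  fixes x y :: "'a::banach_lattice"
  assumes "0 \<le> c"
  shows "c *\<^sub>R sup x y = sup (c *\<^sub>R x) (c *\<^sub>R y)"
proof (cases "c = 0")
  case False
  with assms have c: "0 < c" by simp
  show ?thesis
  proof (rule antisym)
    have "inverse c *\<^sub>R (c *\<^sub>R v) \<le> inverse c *\<^sub>R sup (c *\<^sub>R x) (c *\<^sub>R y)" if "v = x \<or> v = y" for v
      using c that by (intro scaleR_left_mono) auto
    then have "sup x y \<le> inverse c *\<^sub>R sup (c *\<^sub>R x) (c *\<^sub>R y)"
      using c by (intro sup_least) auto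
    then have "c *\<^sub>R sup x y \<le> c *\<^sub>R (inverse c *\<^sub>R sup (c *\<^sub>R x) (c *\<^sub>R y))"
      using c by (intro scaleR_left_mono) auto
    then show "c *\<^sub>R sup x y \<le> sup (c *\<^sub>R x) (c *\<^sub>R y)" using c by simp
    show "sup (c *\<^sub>R x) (c *\<^sub>R y) \<le> c *\<^sub>R sup x y"
      using c by (intro sup_least scaleR_left_mono) auto
  qed
qed auto

lemma scaleR_inf_distrib:
  fixes x y :: "'a::banach_lattice"
  assumes "0 \<le> c"
  shows "c *\<^sub>R inf x y = inf (c *\<^sub>R x) (c *\<^sub>R y)"
  using scaleR_sup_distrib [OF assms, of "- x" "- y"]
  by (simp add: inf_eq_neg_sup del: neg_sup_eq_inf)

text \<open>The Archimedean property: the positive part of \<open>y - u\<close> lies below every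
  positive multiple of \<bar>e\<bar>, so its norm is 0.\<close>

lemma le_if_le_add_eps:
  fixes y u e :: "'a::banach_lattice"
  assumes "\<And>\<epsilon>. 0 < \<epsilon> \<Longrightarrow> y \<le> u + \<epsilon> *\<^sub>R e"
  shows "y \<le> u"
proof -
  have "norm (pprt (y - u)) \<le> 0"
  proof (rule field_le_epsilon)
    fix d :: real assume d: "0 < d"
    \<comment> \<open>Adding 1 keeps the denominator positive when \<open>e = 0\<close>.\<close>
    define c where "c = d / (norm e + 1)"
    have c: "0 < c" using d by (auto simp: c_def intro!: divide_pos_pos add_nonneg_pos)
    have "y - u \<le> c *\<^sub>R e" using assms [OF c] by (simp add: algebra_simps)
    also have "\<dots> \<le> c *\<^sub>R \<bar>e\<bar>" using c by (intro scaleR_left_mono abs_ge_self) simp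
    finally have "pprt (y - u) \<le> c *\<^sub>R \<bar>e\<bar>"
      using c by (simp add: pprt_def scaleR_nonneg_nonneg)
    then have "norm (pprt (y - u)) \<le> norm (c *\<^sub>R \<bar>e\<bar>)" by (intro norm_mono_nonneg) auto
    also have "\<dots> = c * norm e" using c by simp
    also have "\<dots> \<le> c * (norm e + 1)" using c by simp
    also have "\<dots> = d"
    proof -
      have "norm e + 1 \<noteq> 0" using norm_ge_zero [of e] by linarith
      then show ?thesis by (simp add: c_def)
    qed
    finally show "norm (pprt (y - u)) \<le> 0 + d" by simp
  qed
  then have "pprt (y - u) = 0" by simp
  then have "y - u \<le> 0" unfolding le_zero_iff_zero_pprt .
  then show ?thesis by simp
qed

section \<open>Lattice-linear expressions\<close>

abbreviation tuples :: "nat \<Rightarrow> (nat \<Rightarrow> real) set" where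
  "tuples n \<equiv> topspace (Euclidean_space n)"

lemma tuples_iff: "t \<in> tuples n \<longleftrightarrow> (\<forall>i\<ge>n. t i = 0)"
  by (simp add: topspace_Euclidean_space)

definition lin_form :: "nat \<Rightarrow> (nat \<Rightarrow> real) \<Rightarrow> (nat \<Rightarrow> real) \<Rightarrow> real" where
  "lin_form n a = on_tuples n (\<lambda>t. \<Sum>i<n. a i * t i)"

lemma lin_form_apply: "t \<in> tuples n \<Longrightarrow> lin_form n a t = (\<Sum>i<n. a i * t i)"
  by (simp add: lin_form_def on_tuples_def)

lemma lin_form_outside: "t \<notin> tuples n \<Longrightarrow> lin_form n a t = 0"
  by (simp add: lin_form_def on_tuples_def)

lemma lin_form_add: "lin_form n (\<lambda>i. a i + b i) t = lin_form n a t + lin_form n b t"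
  by (simp add: lin_form_def on_tuples_def sum.distrib algebra_simps)

lemma lin_form_scale: "lin_form n (\<lambda>i. c * a i) t = c * lin_form n a t"
  by (simp add: lin_form_def on_tuples_def sum_distrib_left algebra_simps)

text \<open>
  In both predicates \<open>h\<close> is the function on tuples and \<open>y\<close> the value at \<open>x\<close> of one and the same
  lattice-linear expression.
\<close>

inductive inf_lin ::
  "nat \<Rightarrow> (nat \<Rightarrow> 'a::banach_lattice) \<Rightarrow> ((nat \<Rightarrow> real) \<Rightarrow> real) \<Rightarrow> 'a \<Rightarrow> bool" for n x where
  lin: "inf_lin n x (lin_form n a) (\<Sum>i<n. a i *\<^sub>R x i)"
| min: "inf_lin n x h y \<Longrightarrow> inf_lin n x k z \<Longrightarrow> inf_lin n x (\<lambda>t. min (h t) (k t)) (inf y z)"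

inductive lat_lin ::
  "nat \<Rightarrow> (nat \<Rightarrow> 'a::banach_lattice) \<Rightarrow> ((nat \<Rightarrow> real) \<Rightarrow> real) \<Rightarrow> 'a \<Rightarrow> bool" for n x where
  inf_lin: "inf_lin n x h y \<Longrightarrow> lat_lin n x h y"
| max: "lat_lin n x h y \<Longrightarrow> lat_lin n x k z \<Longrightarrow> lat_lin n x (\<lambda>t. max (h t) (k t)) (sup y z)"

lemma lat_lin_lin: "lat_lin n x (lin_form n a) (\<Sum>i<n. a i *\<^sub>R x i)"
  by (intro lat_lin.inf_lin inf_lin.lin)

lemma lat_lin_zero: "lat_lin n x (\<lambda>t. 0) 0"
proof -
  have "lin_form n (\<lambda>i. 0) = (\<lambda>t. 0)" by (simp add: lin_form_def on_tuples_def fun_eq_iff)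
  then show ?thesis using lat_lin_lin [of n x "\<lambda>i. 0"] by simp
qed

text \<open>Maxima of minima of linear forms are closed under minima by distributivity, which holds
  for the reals and in the lattice alike. Insisting on this normal form is what later reduces
  positivity to a single infimum of linear forms.\<close>

lemma lat_lin_min:
  assumes "lat_lin n x h y" "lat_lin n x k z"
  shows "lat_lin n x (\<lambda>t. min (h t) (k t)) (inf y z)"
  using assms
proof (induction arbitrary: k z rule: lat_lin.induct)
  case (inf_lin h y)
  from \<open>lat_lin n x k z\<close> show ?case
  proof (induction rule: lat_lin.induct)
    case (inf_lin k z)
    then show ?case using \<open>inf_lin n x h y\<close> by (intro lat_lin.inf_lin inf_lin.min)
  next
    case (max k z k' z')
    have "(\<lambda>t. min (h t) (max (k t) (k' t))) = (\<lambda>t. max (min (h t) (k t)) (min (h t) (k' t)))"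
      by (simp add: fun_eq_iff min_max_distrib2)
    then show ?case
      using lat_lin.max [OF max.IH] by (simp add: inf_sup_distrib_group)
  qed
next
  case (max h y h' y')
  have "(\<lambda>t. min (max (h t) (h' t)) (k t)) = (\<lambda>t. max (min (h t) (k t)) (min (h' t) (k t)))"
    by (simp add: fun_eq_iff min_max_distrib1)
  moreover have "inf (sup y y') z = sup (inf y z) (inf y' z)"
    using inf_sup_distrib_group [of z y y'] by (simp add: inf_commute)
  ultimately show ?case
    using lat_lin.max [OF max.IH [OF max.prems]] by simp
qed

text \<open>Translations commute with infima, so a sum of two infima of forms is the infimum of all
  pairwise sums.\<close>

lemma inf_lin_add:
  assumes "inf_lin n x h y" "inf_lin n x k z"
  shows "inf_lin n x (\<lambda>t. h t + k t) (y + z)"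
  using assms
proof (induction arbitrary: k z rule: inf_lin.induct)
  case (lin a)
  from \<open>inf_lin n x k z\<close> show ?case
  proof (induction rule: inf_lin.induct)
    case (lin b)
    show ?case
      using inf_lin.lin [of n x "\<lambda>i. a i + b i"]
      by (simp add: lin_form_add [abs_def] sum.distrib scaleR_add_left)
  next
    case (min k z k' z')
    then show ?case
      using inf_lin.min [OF min.IH]
      by (simp add: min_add_distrib_right add_inf_distrib_left)
  qed
next
  case (min h y h' y')
  then show ?case
    using inf_lin.min [OF min.IH [OF min.prems]]
    by (simp add: min_add_distrib_left add_inf_distrib_right)
qed

lemma lat_lin_add:
  assumes "lat_lin n x h y" "lat_lin n x k z"
  shows "lat_lin n x (\<lambda>t. h t + k t) (y + z)"
  using assms
proof (induction arbitrary: k z rule: lat_lin.induct)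
  case (inf_lin h y)
  from \<open>lat_lin n x k z\<close> show ?case
  proof (induction rule: lat_lin.induct)
    case (inf_lin k z)
    then show ?case using \<open>inf_lin n x h y\<close> by (intro lat_lin.inf_lin inf_lin_add)
  next
    case (max k z k' z')
    then show ?case
      using lat_lin.max [OF max.IH]
      by (simp add: max_add_distrib_right add_sup_distrib_left)
  qed
next
  case (max h y h' y')
  then show ?case
    using lat_lin.max [OF max.IH [OF max.prems]]
    by (simp add: max_add_distrib_left add_sup_distrib_right)
qed

lemma lat_lin_uminus_inf_lin:
  assumes "inf_lin n x h y"
  shows "lat_lin n x (\<lambda>t. - h t) (- y)"
  using assms
proof (induction rule: inf_lin.induct)
  case (lin a)
  show ?case
    using lat_lin_lin [of n x "\<lambda>i. (-1) * a i"]
    unfolding lin_form_scale [abs_def] by (simp add: sum_negf)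
next
  case (min h y h' y')
  then show ?case
    using lat_lin.max [OF min.IH] by (simp add: minus_min_eq_max)
qed

text \<open>Negation exchanges maxima and minima and thus leaves the normal form;
  \<open>lat_lin_min\<close> restores it.\<close>

lemma lat_lin_uminus:
  assumes "lat_lin n x h y"
  shows "lat_lin n x (\<lambda>t. - h t) (- y)"
  using assms
proof (induction rule: lat_lin.induct)
  case (max h y h' y')
  then show ?case
    using lat_lin_min [OF max.IH] by (simp add: minus_max_eq_min)
qed (rule lat_lin_uminus_inf_lin)

lemma lat_lin_diff:
  assumes "lat_lin n x h y" "lat_lin n x k z"
  shows "lat_lin n x (\<lambda>t. h t - k t) (y - z)"
  using lat_lin_add [OF assms(1) lat_lin_uminus [OF assms(2)]] by simp

lemma inf_lin_scale_nonneg: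
  assumes "inf_lin n x h y" "0 \<le> c"
  shows "inf_lin n x (\<lambda>t. c * h t) (c *\<^sub>R y)"
  using assms
proof (induction rule: inf_lin.induct)
  case (lin a)
  show ?case
    using inf_lin.lin [of n x "\<lambda>i. c * a i"]
    unfolding lin_form_scale [abs_def] by (simp add: scaleR_sum_right)
next
  case (min h y h' y')
  then show ?case
    using inf_lin.min [OF min.IH] by (simp add: min_mult_distrib_left scaleR_inf_distrib)
qed

lemma lat_lin_scale_nonneg:
  assumes "lat_lin n x h y" "0 \<le> c"
  shows "lat_lin n x (\<lambda>t. c * h t) (c *\<^sub>R y)"
  using assms
proof (induction rule: lat_lin.induct)
  case (max h y h' y')
  then show ?case
    using lat_lin.max [OF max.IH] by (simp add: max_mult_distrib_left scaleR_sup_distrib)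
qed (intro lat_lin.inf_lin inf_lin_scale_nonneg)

lemma lat_lin_scale:
  assumes "lat_lin n x h y"
  shows "lat_lin n x (\<lambda>t. c * h t) (c *\<^sub>R y)"
proof (cases "0 \<le> c")
  case False
  then show ?thesis
    using lat_lin_uminus [OF lat_lin_scale_nonneg [OF assms, of "- c"]] by simp
qed (rule lat_lin_scale_nonneg [OF assms])

lemma lat_lin_abs:
  assumes "lat_lin n x h y"
  shows "lat_lin n x (\<lambda>t. \<bar>h t\<bar>) \<bar>y\<bar>"
proof -
  have "(\<lambda>t. \<bar>h t\<bar>) = (\<lambda>t. max (h t) (- h t))" by (auto simp: fun_eq_iff)
  then show ?thesis
    using lat_lin.max [OF assms lat_lin_uminus [OF assms]] by (simp only: abs_lattice)
qed

lemma lat_lin_sum: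
  assumes "\<And>k. k \<in> A \<Longrightarrow> lat_lin n x (h k) (y k)"
  shows "lat_lin n x (\<lambda>t. \<Sum>k\<in>A. h k t) (\<Sum>k\<in>A. y k)"
  using assms
proof (induction A rule: infinite_finite_induct)
  case (insert k A)
  then show ?case using lat_lin_add [of n x "h k" "y k"] by simp
qed (simp_all add: lat_lin_zero)

section \<open>Nearest points of compact convex sets and Gordan's theorem\<close>

text \<open>Tychonoff's theorem: the topology of the function type is the product topology.\<close>

lemma compact_componentwise:
  fixes S :: "'i \<Rightarrow> 'b::topological_space set"
  assumes "\<And>i. compact (S i)"
  shows "compact {f. \<forall>i. f i \<in> S i}"
proof -
  have "compactin (product_topology (\<lambda>i. euclidean) UNIV) (PiE UNIV S)"
    using assms by (simp add: compactin_PiE)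
  then show ?thesis
    by (simp add: euclidean_product_topology PiE_UNIV_domain Pi_def)
qed

text \<open>The weights are functions on the whole type; forcing them to vanish outside
  \<open>A\<close> keeps the remaining coordinates from destroying compactness.\<close>

lemma compact_simplex:
  assumes "finite A"
  shows "compact {w :: 'i \<Rightarrow> real. (\<forall>a. 0 \<le> w a) \<and> (\<forall>a. a \<notin> A \<longrightarrow> w a = 0) \<and> sum w A = 1}"
    (is "compact ?W")
proof -
  let ?S = "\<lambda>a. if a \<in> A then {0..1::real} else {0}"
  let ?B = "{w. \<forall>a. w a \<in> ?S a}"
  have "?W = ?B \<inter> (\<lambda>w. sum w A) -` {1}"
  proof (intro equalityI subsetI)
    fix w assume w: "w \<in> ?W"
    have "w a \<le> 1" if "a \<in> A" for a
      using member_le_sum [of a A w] w that assms by auto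
    then show "w \<in> ?B \<inter> (\<lambda>w. sum w A) -` {1}" using w by auto
  next
    fix w assume w: "w \<in> ?B \<inter> (\<lambda>w. sum w A) -` {1}"
    then have *: "w a \<in> ?S a" for a by blast
    have "0 \<le> w a" "a \<notin> A \<Longrightarrow> w a = 0" for a
      using * [of a] by (auto split: if_splits)
    with w show "w \<in> ?W" by auto
  qed
  moreover have "compact ?B" by (rule compact_componentwise) simp
  moreover have "closed ((\<lambda>w :: 'i \<Rightarrow> real. sum w A) -` {1})"
    by (intro closed_vimage closed_singleton continuous_on_sum continuous_on_product_coordinates)
  ultimately show ?thesis by (simp add: compact_Int_closed)
qed

lemma nonneg_if_quadratic_nonneg:
  fixes D E :: real
  assumes "\<And>s. 0 < s \<Longrightarrow> s \<le> 1 \<Longrightarrow> 0 \<le> 2 * s * D + s\<^sup>2 * E"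
  shows "0 \<le> D"
proof (rule ccontr)
  assume "\<not> 0 \<le> D"
  then have D: "D < 0" by simp
  \<comment> \<open>With this choice \<open>s * E\<close> is at most \<open>- D\<close>, so the
    linear term \<open>2 * D\<close> outweighs it.\<close>
  define s where "s = min 1 (- D / (\<bar>E\<bar> + 1))"
  have s: "0 < s" "s \<le> 1" using D by (auto simp: s_def divide_neg_pos)
  have "s * (\<bar>E\<bar> + 1) \<le> - D"
    using mult_right_mono [of s "- D / (\<bar>E\<bar> + 1)" "\<bar>E\<bar> + 1"] by (simp add: s_def)
  moreover have "s * E \<le> s * (\<bar>E\<bar> + 1)" using s by (intro mult_left_mono) auto
  ultimately have "2 * D + s * E < 0" using D by linarith
  then have "s * (2 * D + s * E) < 0" using s by (simp add: mult_pos_neg)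
  then show False using assms [OF s] by (simp add: algebra_simps power2_eq_square)
qed

text \<open>The variational inequality of the point \<open>a\<close> nearest to the origin: on the
  segment from \<open>a\<close> to \<open>b\<close> the squared norm cannot drop, so the coefficient
  of its linear term is nonnegative. Only the first \<open>n\<close> coordinates enter the
  norm.\<close>

lemma ex_min_norm_point:
  fixes C :: "(nat \<Rightarrow> real) set"
  assumes "compact C" "C \<noteq> {}"
    and convex: "\<And>a b s. a \<in> C \<Longrightarrow> b \<in> C \<Longrightarrow> 0 \<le> s \<Longrightarrow> s \<le> 1 \<Longrightarrow> (\<lambda>i. (1 - s) * a i + s * b i) \<in> C"
  shows "\<exists>a\<in>C. \<forall>b\<in>C. (\<Sum>i<n. a i * a i) \<le> (\<Sum>i<n. a i * b i)"
proof -
  have "continuous_on C (\<lambda>a. \<Sum>i<n. a i * a i)"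
    by (intro continuous_intros continuous_on_subset [OF continuous_on_product_coordinates]) auto
  then obtain a where a: "a \<in> C" "\<And>b. b \<in> C \<Longrightarrow> (\<Sum>i<n. a i * a i) \<le> (\<Sum>i<n. b i * b i)"
    using continuous_attains_inf [OF assms(1,2)] by blast
  have "(\<Sum>i<n. a i * a i) \<le> (\<Sum>i<n. a i * b i)" if b: "b \<in> C" for b
  proof -
    have "0 \<le> 2 * s * (\<Sum>i<n. a i * (b i - a i)) + s\<^sup>2 * (\<Sum>i<n. (b i - a i)\<^sup>2)"
      if s: "0 < s" "s \<le> 1" for s
    proof -
      have "(\<Sum>i<n. a i * a i)
          \<le> (\<Sum>i<n. ((1 - s) * a i + s * b i) * ((1 - s) * a i + s * b i))"
        using s by (intro a(2) convex a(1) b) auto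
      also have "\<dots> = (\<Sum>i<n. a i * a i + (2 * s * (a i * (b i - a i)) + s\<^sup>2 * (b i - a i)\<^sup>2))"
        by (intro sum.cong) (auto simp: algebra_simps power2_eq_square)
      finally show ?thesis by (simp add: sum.distrib sum_distrib_left)
    qed
    then have "0 \<le> (\<Sum>i<n. a i * (b i - a i))" by (rule nonneg_if_quadratic_nonneg)
    then show ?thesis by (simp add: sum_subtractf right_diff_distrib)
  qed
  with a(1) show ?thesis by blast
qed

lemma ex_convex_combination_zero:
  fixes A :: "(nat \<Rightarrow> real) set"
  assumes A: "finite A" "A \<noteq> {}"
    and le: "\<And>t. t \<in> tuples n \<Longrightarrow> \<exists>a\<in>A. (\<Sum>i<n. a i * t i) \<le> 0"
  obtains w where "\<And>a. a \<in> A \<Longrightarrow> 0 \<le> w a" "sum w A = 1" "\<And>i. i < n \<Longrightarrow> (\<Sum>a\<in>A. w a * a i) = 0"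
proof -
  define W where "W = {w. (\<forall>a. 0 \<le> w a) \<and> (\<forall>a. a \<notin> A \<longrightarrow> w a = 0) \<and> sum w A = (1::real)}"
  define c where "c w = (\<lambda>i. if i < n then \<Sum>a\<in>A. w a * a i else 0)" for w
  have comp: "compact (c ` W)"
  proof (rule compact_continuous_image)
    show "continuous_on W c"
    proof (rule continuous_on_coordinatewise_then_product)
      fix i
      show "continuous_on W (\<lambda>w. c w i)"
        unfolding c_def
        by (cases "i < n")
          (auto intro!: continuous_intros continuous_on_subset [OF continuous_on_product_coordinates])
    qed
    show "compact W" unfolding W_def by (rule compact_simplex [OF A(1)])
  qed
  \<comment> \<open>The hull is parametrized by weights; the vertices of the simplex give back the
    elements of \<open>A\<close>, cut off at \<open>n\<close>.\<close>
  have vertex: "(\<lambda>b. if b = a then 1 else 0) \<in> W" "c (\<lambda>b. if b = a then 1 else 0) = (\<lambda>i. if i < n then a i else 0)"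
    if "a \<in> A" for a
    using that A unfolding c_def W_def
    by (auto intro!: ext simp: if_distrib [of "\<lambda>x. x * _"] cong: if_cong)
  have ne: "c ` W \<noteq> {}"
    using A(2) vertex(1) by blast
  have convex: "(\<lambda>i. (1 - s) * f i + s * g i) \<in> c ` W"
    if f: "f \<in> c ` W" and g: "g \<in> c ` W" and s: "0 \<le> s" "s \<le> 1" for f g s
  proof -
    from f g obtain w w' where w: "w \<in> W" "w' \<in> W" "f = c w" "g = c w'" by blast
    show ?thesis
    proof (rule image_eqI)
      show "(\<lambda>i. (1 - s) * f i + s * g i) = c (\<lambda>a. (1 - s) * w a + s * w' a)"
        by (auto simp: w c_def fun_eq_iff sum_distrib_left distrib_right mult.assoc
            simp flip: sum.distrib)
      have "(\<Sum>a\<in>A. (1 - s) * w a + s * w' a) = (1 - s) * sum w A + s * sum w' A"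
        by (simp add: sum.distrib sum_distrib_left)
      with w s show "(\<lambda>a. (1 - s) * w a + s * w' a) \<in> W" by (auto simp: W_def)
    qed
  qed
  obtain f where f: "f \<in> c ` W"
    and min: "\<And>g. g \<in> c ` W \<Longrightarrow> (\<Sum>i<n. f i * f i) \<le> (\<Sum>i<n. f i * g i)"
    using ex_min_norm_point [OF comp ne convex, where n = n] by blast
  from f obtain w where w: "w \<in> W" "f = c w" by blast
  have "f \<in> tuples n" by (simp add: tuples_iff w c_def)
  from le [OF this] obtain a where a: "a \<in> A" "(\<Sum>i<n. a i * f i) \<le> 0" by (rule bexE)
  have "(\<lambda>i. if i < n then a i else 0) \<in> c ` W"
    using imageI [OF vertex(1) [OF a(1)], of c] unfolding vertex(2) [OF a(1)] .
  from min [OF this] a(2) have "(\<Sum>i<n. f i * f i) \<le> 0" by (simp add: mult.commute)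
  then have "(\<Sum>i<n. f i * f i) = 0" by (intro antisym sum_nonneg) auto
  then have "\<forall>i\<in>{..<n}. f i * f i = 0" by (subst (asm) sum_nonneg_eq_0_iff) auto
  then have "\<And>i. i < n \<Longrightarrow> (\<Sum>a\<in>A. w a * a i) = 0" by (auto simp: w c_def)
  moreover have "\<And>a. a \<in> A \<Longrightarrow> 0 \<le> w a" "sum w A = 1" using w(1) by (auto simp: W_def)
  ultimately show ?thesis using that by blast
qed

section \<open>Positivity of evaluation\<close>

lemma inf_lin_coeffs:
  assumes "inf_lin n x h y"
  shows "\<exists>A. finite A \<and> A \<noteq> {} \<and> (\<forall>t\<in>tuples n. \<exists>a\<in>A. (\<Sum>i<n. a i * t i) \<le> h t) \<and>
    (\<forall>a\<in>A. y \<le> (\<Sum>i<n. a i *\<^sub>R x i))"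
  using assms
proof (induction rule: inf_lin.induct)
  case (lin a)
  show ?case by (intro exI [of _ "{a}"]) (simp add: lin_form_apply)
next
  case (min h y k z)
  then obtain A B where
    "finite A" "A \<noteq> {}" "\<forall>t\<in>tuples n. \<exists>a\<in>A. (\<Sum>i<n. a i * t i) \<le> h t" "\<forall>a\<in>A. y \<le> (\<Sum>i<n. a i *\<^sub>R x i)"
    "finite B" "B \<noteq> {}" "\<forall>t\<in>tuples n. \<exists>a\<in>B. (\<Sum>i<n. a i * t i) \<le> k t" "\<forall>a\<in>B. z \<le> (\<Sum>i<n. a i *\<^sub>R x i)"
    by blast
  then show ?case
    by (intro exI [of _ "A \<union> B"]) (auto simp: min_def intro: le_infI1 le_infI2)
qed

text \<open>\<open>y\<close> lies below the value at \<open>x\<close> of each form, hence below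
  every convex combination of these values, and the combination from Gordan's theorem has value
  0.\<close>

lemma inf_lin_nonpos:
  assumes "inf_lin n x h y" and h: "\<And>t. t \<in> tuples n \<Longrightarrow> h t \<le> 0"
  shows "y \<le> 0"
proof -
  obtain A where A: "finite A" "A \<noteq> {}"
    and le: "\<And>t. t \<in> tuples n \<Longrightarrow> \<exists>a\<in>A. (\<Sum>i<n. a i * t i) \<le> h t"
    and y: "\<And>a. a \<in> A \<Longrightarrow> y \<le> (\<Sum>i<n. a i *\<^sub>R x i)"
    using inf_lin_coeffs [OF assms(1)] by blast
  have "\<exists>a\<in>A. (\<Sum>i<n. a i * t i) \<le> 0" if "t \<in> tuples n" for t
    using le [OF that] h [OF that] by (meson order_trans)
  from ex_convex_combination_zero [OF A this]
  obtain w where w: "\<And>a. a \<in> A \<Longrightarrow> 0 \<le> w a" "sum w A = 1"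
    and zero: "\<And>i. i < n \<Longrightarrow> (\<Sum>a\<in>A. w a * a i) = 0"
    by blast
  have "y = (\<Sum>a\<in>A. w a *\<^sub>R y)" by (simp add: w(2) flip: scaleR_sum_left)
  also have "\<dots> \<le> (\<Sum>a\<in>A. w a *\<^sub>R (\<Sum>i<n. a i *\<^sub>R x i))"
    by (intro sum_mono scaleR_left_mono y w)
  also have "\<dots> = (\<Sum>i<n. (\<Sum>a\<in>A. w a * a i) *\<^sub>R x i)"
    by (simp add: scaleR_sum_right scaleR_sum_left) (rule sum.swap)
  also have "\<dots> = 0" by (simp add: zero)
  finally show ?thesis .
qed

text \<open>A maximum is nonpositive exactly if all its members are, which reduces the claim to
  infima of forms.\<close>

lemma lat_lin_nonpos:
  assumes "lat_lin n x h y" "\<And>t. t \<in> tuples n \<Longrightarrow> h t \<le> 0"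
  shows "y \<le> 0"
  using assms by (induction rule: lat_lin.induct) (auto dest: inf_lin_nonpos)

text \<open>Differences of expressions are expressions, so positivity suffices. In particular the
  value at \<open>x\<close> depends only on the function that the expression defines on
  tuples.\<close>

lemma lat_lin_mono:
  assumes "lat_lin n x h y" "lat_lin n x k z" "\<And>t. t \<in> tuples n \<Longrightarrow> h t \<le> k t"
  shows "y \<le> z"
  using lat_lin_nonpos [OF lat_lin_diff [OF assms(1,2)]] assms(3) by simp

lemma lat_lin_nonneg:
  assumes "lat_lin n x h y" "\<And>t. t \<in> tuples n \<Longrightarrow> 0 \<le> h t"
  shows "0 \<le> y"
  using lat_lin_mono [OF lat_lin_zero assms] .

section \<open>Krivine's functional calculus\<close>

lemma continuous_map_Euclidean_space_iff:
  "continuous_map (Euclidean_space n) euclideanreal h \<longleftrightarrow> continuous_on (tuples n) h"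
  by (simp add: Euclidean_space_def euclidean_product_topology)

lemma tuples_zero [simp]: "(\<lambda>i. 0) \<in> tuples n" by (simp add: tuples_iff)

lemma tuples_scale: "t \<in> tuples n \<Longrightarrow> (\<lambda>i. c * t i) \<in> tuples n"
  by (simp add: tuples_iff)

lemma hom_funs_iff:
  "h \<in> hom_funs n \<longleftrightarrow> continuous_on (tuples n) h \<and>
    (\<forall>t\<in>tuples n. \<forall>c\<ge>0. h (\<lambda>i. c * t i) = c * h t) \<and> (\<forall>t. t \<notin> tuples n \<longrightarrow> h t = 0)"
  by (simp add: hom_funs_def continuous_map_Euclidean_space_iff)

lemma hom_funs_continuous: "h \<in> hom_funs n \<Longrightarrow> continuous_on (tuples n) h"
  by (simp add: hom_funs_iff)

lemma hom_funs_scale: "h \<in> hom_funs n \<Longrightarrow> t \<in> tuples n \<Longrightarrow> 0 \<le> c \<Longrightarrow> h (\<lambda>i. c * t i) = c * h t"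
  by (simp add: hom_funs_iff)

lemma hom_funs_outside: "h \<in> hom_funs n \<Longrightarrow> t \<notin> tuples n \<Longrightarrow> h t = 0"
  by (simp add: hom_funs_iff)

lemma hom_funs_zero: "h \<in> hom_funs n \<Longrightarrow> h (\<lambda>i. 0) = 0"
  using hom_funs_scale [of h n "\<lambda>i. 0" 0] by simp

lemma hom_funs_const_zero: "(\<lambda>t. 0) \<in> hom_funs n"
  by (simp add: hom_funs_iff)

lemma hom_funs_add: "h \<in> hom_funs n \<Longrightarrow> k \<in> hom_funs n \<Longrightarrow> (\<lambda>t. h t + k t) \<in> hom_funs n"
  by (auto simp: hom_funs_iff continuous_on_add distrib_left)

lemma hom_funs_cmult: "h \<in> hom_funs n \<Longrightarrow> (\<lambda>t. c * h t) \<in> hom_funs n"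
  by (auto simp: hom_funs_iff continuous_on_mult_left)

lemma hom_funs_max: "h \<in> hom_funs n \<Longrightarrow> k \<in> hom_funs n \<Longrightarrow> (\<lambda>t. max (h t) (k t)) \<in> hom_funs n"
  by (auto simp: hom_funs_iff max_mult_distrib_left intro!: continuous_on_max)

lemma hom_funs_min: "h \<in> hom_funs n \<Longrightarrow> k \<in> hom_funs n \<Longrightarrow> (\<lambda>t. min (h t) (k t)) \<in> hom_funs n"
  by (auto simp: hom_funs_iff min_mult_distrib_left intro!: continuous_on_min)

lemma hom_funs_lin_form: "lin_form n a \<in> hom_funs n"
proof -
  have "continuous_on (tuples n) (\<lambda>t. \<Sum>i<n. a i * t i)"
    by (intro continuous_intros continuous_on_subset [OF continuous_on_product_coordinates]) auto
  then have "continuous_on (tuples n) (lin_form n a)"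
    by (rule continuous_on_eq) (simp add: lin_form_apply)
  then show ?thesis
    by (auto simp: hom_funs_iff lin_form_apply tuples_scale lin_form_outside sum_distrib_left mult.left_commute)
qed

lemma hom_funs_inf_lin: "inf_lin n x h y \<Longrightarrow> h \<in> hom_funs n"
  by (induction rule: inf_lin.induct) (simp_all add: hom_funs_lin_form hom_funs_min)

lemma hom_funs_lat_lin: "lat_lin n x h y \<Longrightarrow> h \<in> hom_funs n"
  by (induction rule: lat_lin.induct) (simp_all add: hom_funs_inf_lin hom_funs_max)

section \<open>The gauge function and its compact unit sphere\<close>

definition l1_fun :: "nat \<Rightarrow> (nat \<Rightarrow> real) \<Rightarrow> real" where
  "l1_fun n = on_tuples n (\<lambda>t. \<Sum>i<n. \<bar>t i\<bar>)"

lemma l1_fun_apply: "t \<in> tuples n \<Longrightarrow> l1_fun n t = (\<Sum>i<n. \<bar>t i\<bar>)"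
  by (simp add: l1_fun_def on_tuples_def)

lemma l1_fun_nonneg [simp]: "0 \<le> l1_fun n t"
  by (simp add: l1_fun_def on_tuples_def sum_nonneg)

lemma l1_fun_eq_0: "t \<in> tuples n \<Longrightarrow> l1_fun n t = 0 \<Longrightarrow> t = (\<lambda>i. 0)"
  by (auto simp: l1_fun_apply sum_nonneg_eq_0_iff tuples_iff fun_eq_iff not_less [symmetric])

lemma coordinate_conv_lin_form:
  "j < n \<Longrightarrow> on_tuples n (\<lambda>t. t j) = lin_form n (\<lambda>i. if i = j then 1 else 0)"
  by (simp add: lin_form_def if_distrib [of "\<lambda>x. x * _"] cong: if_cong)

lemma lat_lin_coordinate: "j < n \<Longrightarrow> lat_lin n x (on_tuples n (\<lambda>t. t j)) (x j)"
  using lat_lin_lin [of n x "\<lambda>i. if i = j then 1 else 0"]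
  by (simp add: coordinate_conv_lin_form if_distrib [of "\<lambda>c. c *\<^sub>R _"] cong: if_cong)

lemma lat_lin_l1_fun: "lat_lin n x (l1_fun n) (\<Sum>i<n. \<bar>x i\<bar>)"
proof -
  have "lat_lin n x (\<lambda>t. \<Sum>i<n. \<bar>on_tuples n (\<lambda>t. t i) t\<bar>) (\<Sum>i<n. \<bar>x i\<bar>)"
    by (intro lat_lin_sum lat_lin_abs lat_lin_coordinate) simp
  moreover have "(\<lambda>t. \<Sum>i<n. \<bar>on_tuples n (\<lambda>t. t i) t\<bar>) = l1_fun n"
    by (auto simp: fun_eq_iff l1_fun_def on_tuples_def)
  ultimately show ?thesis by simp
qed

lemma hom_funs_l1_fun: "l1_fun n \<in> hom_funs n"
  by (rule hom_funs_lat_lin [OF lat_lin_l1_fun [of n "\<lambda>i. 0 :: real"]])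

text \<open>Homogeneous functions are determined by their values here. The sphere of this norm is
  chosen because its gauge is a lattice-linear function, unlike that of the Euclidean sphere. It is
  empty for \<open>n = 0\<close>.\<close>

definition l1_sphere :: "nat \<Rightarrow> (nat \<Rightarrow> real) set" where
  "l1_sphere n = {t \<in> tuples n. l1_fun n t = 1}"

lemma compact_l1_sphere: "compact (l1_sphere n)"
proof -
  let ?S = "\<lambda>i. if i < n then {-1..1::real} else {0}"
  let ?B = "{t. \<forall>i. t i \<in> ?S i}"
  have "l1_sphere n = ?B \<inter> (\<lambda>t. \<Sum>i<n. \<bar>t i\<bar>) -` {1}"
  proof (intro equalityI subsetI)
    fix t assume t: "t \<in> l1_sphere n"
    have "\<bar>t i\<bar> \<le> 1" if "i < n" for i
      using member_le_sum [of i "{..<n}" "\<lambda>i. \<bar>t i\<bar>"] t that by (auto simp: l1_sphere_def l1_fun_apply)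
    then have "t i \<in> ?S i" for i
      using t by (auto simp: l1_sphere_def tuples_iff abs_le_iff)
    then show "t \<in> ?B \<inter> (\<lambda>t. \<Sum>i<n. \<bar>t i\<bar>) -` {1}"
      using t by (auto simp: l1_sphere_def l1_fun_apply)
  next
    fix t assume t: "t \<in> ?B \<inter> (\<lambda>t. \<Sum>i<n. \<bar>t i\<bar>) -` {1}"
    then have *: "t i \<in> ?S i" for i by blast
    have "t i = 0" if "i \<ge> n" for i using * [of i] that by simp
    with t show "t \<in> l1_sphere n" by (auto simp: l1_sphere_def tuples_iff l1_fun_apply)
  qed
  moreover have "compact ?B" by (rule compact_componentwise) simp
  moreover have "closed ((\<lambda>t :: nat \<Rightarrow> real. \<Sum>i<n. \<bar>t i\<bar>) -` {1})"
    by (intro closed_vimage closed_singleton continuous_intros continuous_on_product_coordinates)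
  ultimately show ?thesis by (simp add: compact_Int_closed)
qed

lemma hom_funs_continuous_l1_sphere: "h \<in> hom_funs n \<Longrightarrow> continuous_on (l1_sphere n) h"
  by (rule continuous_on_subset [OF hom_funs_continuous]) (auto simp: l1_sphere_def)

lemma l1_sphere_cases:
  assumes t: "t \<in> tuples n"
  obtains "t = (\<lambda>i. 0)"
  | u c where "u \<in> l1_sphere n" "0 < c" "t = (\<lambda>i. c * u i)" "c = l1_fun n t"
proof (cases "l1_fun n t = 0")
  case True
  then show ?thesis using l1_fun_eq_0 [OF t] that by blast
next
  case False
  then have c: "0 < l1_fun n t" using l1_fun_nonneg [of n t] by linarith
  let ?u = "\<lambda>i. inverse (l1_fun n t) * t i"
  have "?u \<in> l1_sphere n"
    using t c hom_funs_scale [OF hom_funs_l1_fun t, of "inverse (l1_fun n t)"]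
    by (simp add: l1_sphere_def tuples_scale)
  moreover have "t = (\<lambda>i. l1_fun n t * ?u i)" using c by (simp add: fun_eq_iff)
  ultimately show ?thesis using that(2) c by blast
qed

lemma hom_funs_le_by_sphere:
  assumes h: "h \<in> hom_funs n" and k: "k \<in> hom_funs n"
    and le: "\<And>u. u \<in> l1_sphere n \<Longrightarrow> h u \<le> k u" and t: "t \<in> tuples n"
  shows "h t \<le> k t"
  using l1_sphere_cases [OF t]
proof cases
  case 1
  then show ?thesis using hom_funs_zero [OF h] hom_funs_zero [OF k] by simp
next
  case (2 u c)
  from 2(1) have "u \<in> tuples n" by (simp add: l1_sphere_def)
  then show ?thesis
    using 2(2) le [OF 2(1)] hom_funs_scale [OF h, of u c] hom_funs_scale [OF k, of u c]
    unfolding 2(3) by (simp add: mult_left_mono)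
qed

text \<open>The part of the sphere where \<open>f\<close> is not positive is compact and misses
  \<open>s\<close>, so its distance from \<open>s\<close> is positive. This converts continuity in
  the product topology into an explicit radius.\<close>

lemma ex_l1_radius:
  fixes f :: "(nat \<Rightarrow> real) \<Rightarrow> real"
  assumes f: "continuous_on (l1_sphere n) f" and s: "s \<in> l1_sphere n" and "0 < f s"
  shows "\<exists>r>0. \<forall>u\<in>l1_sphere n. (\<Sum>i<n. \<bar>u i - s i\<bar>) < r \<longrightarrow> 0 < f u"
proof -
  let ?K = "{u \<in> l1_sphere n. f u \<le> 0}" and ?d = "\<lambda>u. \<Sum>i<n. \<bar>u i - s i\<bar>"
  have K: "compact ?K"
  proof -
    have "closedin (top_of_set (l1_sphere n)) (l1_sphere n \<inter> f -` {..0})"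
      by (rule continuous_closedin_preimage [OF f]) simp
    moreover have "l1_sphere n \<inter> f -` {..0} = ?K" by auto
    ultimately show ?thesis using closedin_compact [OF compact_l1_sphere] by metis
  qed
  have d: "continuous_on ?K ?d"
    by (intro continuous_intros continuous_on_subset [OF continuous_on_product_coordinates]) auto
  show ?thesis
  proof (cases "?K = {}")
    case True
    then show ?thesis by (intro exI [of _ 1]) (auto simp: not_le)
  next
    case False
    from continuous_attains_inf [OF K False d]
    obtain v where v: "v \<in> ?K" and le: "\<And>u. u \<in> ?K \<Longrightarrow> ?d v \<le> ?d u" by blast
    have "?d v \<noteq> 0"
    proof
      assume "?d v = 0"
      then have "\<forall>i<n. v i = s i" by (simp add: sum_nonneg_eq_0_iff)
      moreover have "v i = 0" "s i = 0" if "\<not> i < n" for i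
        using v s that by (auto simp: l1_sphere_def tuples_iff)
      ultimately have "v = s" by (metis ext)
      with v \<open>0 < f s\<close> show False by simp
    qed
    moreover have "0 \<le> ?d v" by (simp add: sum_nonneg)
    ultimately have "0 < ?d v" by linarith
    moreover have "0 < f u" if "u \<in> l1_sphere n" "?d u < ?d v" for u
      using le [of u] that by (force simp: not_le)
    ultimately show ?thesis by blast
  qed
qed

section \<open>Lattice-linear partitions and density\<close>

text \<open>Dividing by the sum of the \<open>G s\<close> would not give lattice-linear functions.
  Instead \<open>g s\<close> is the increment of the partial sums truncated at
  \<open>l1_fun n\<close>; since the \<open>G s\<close> are nonnegative, such an increment lies
  between 0 and the summand just added.\<close>

lemma lat_lin_telescope:
  assumes "finite A"
    and "\<And>s. s \<in> A \<Longrightarrow> lat_lin n x (G s) (v s)" "\<And>s t. s \<in> A \<Longrightarrow> 0 \<le> G s t"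
  shows "\<exists>g w. (\<forall>s\<in>A. lat_lin n x (g s) (w s) \<and> (\<forall>t. 0 \<le> g s t \<and> g s t \<le> G s t)) \<and>
    (\<forall>t. (\<Sum>s\<in>A. g s t) = min (l1_fun n t) (\<Sum>s\<in>A. G s t))"
  using assms
proof (induction A rule: finite_induct)
  case empty
  then show ?case by simp
next
  case (insert a A)
  have "\<exists>g w. (\<forall>s\<in>A. lat_lin n x (g s) (w s) \<and> (\<forall>t. 0 \<le> g s t \<and> g s t \<le> G s t)) \<and>
    (\<forall>t. (\<Sum>s\<in>A. g s t) = min (l1_fun n t) (\<Sum>s\<in>A. G s t))"
    by (rule insert.IH) (use insert.prems in auto)
  then obtain g w where gw: "\<forall>s\<in>A. lat_lin n x (g s) (w s) \<and> (\<forall>t. 0 \<le> g s t \<and> g s t \<le> G s t)"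
    and sum: "\<forall>t. (\<Sum>s\<in>A. g s t) = min (l1_fun n t) (\<Sum>s\<in>A. G s t)"
    by (elim exE conjE)
  let ?P = "\<lambda>t. \<Sum>s\<in>A. G s t"
  let ?g = "\<lambda>t. min (l1_fun n t) (G a t + ?P t) - min (l1_fun n t) (?P t)"
  let ?e = "\<Sum>i<n. \<bar>x i\<bar>" and ?z = "\<Sum>s\<in>A. v s"
  let ?w = "inf ?e (v a + ?z) - inf ?e ?z"
  have P: "lat_lin n x ?P ?z" by (rule lat_lin_sum) (use insert.prems in auto)
  have "lat_lin n x ?g ?w"
    by (intro lat_lin_diff lat_lin_min lat_lin_l1_fun lat_lin_add P) (use insert.prems in auto)
  moreover have "0 \<le> ?g t \<and> ?g t \<le> G a t" for t
    using insert.prems(2) [of a t] by (simp add: min_def)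
  moreover have "(\<Sum>s\<in>insert a A. (g(a := ?g)) s t) = min (l1_fun n t) (\<Sum>s\<in>insert a A. G s t)" for t
  proof -
    have "(\<Sum>s\<in>A. (g(a := ?g)) s t) = (\<Sum>s\<in>A. g s t)"
      using insert.hyps(2) by (intro sum.cong) auto
    then show ?thesis using insert.hyps sum [rule_format, of t] by simp
  qed
  ultimately show ?case
    using gw by (intro exI [of _ "g(a := ?g)"] exI [of _ "w(a := ?w)"]) auto
qed

text \<open>
  The tent at \<open>s\<close> is supported where \<open>\<bar>t - l1_fun n t \<cdot> s\<bar>\<close> is small; telescoping the truncated
  sums of the tents makes them add up to \<open>l1_fun n\<close> without leaving the lattice-linear functions.
\<close>

lemma partition_of_l1_fun:
  fixes x :: "nat \<Rightarrow> 'a::banach_lattice"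
  assumes "finite F" and F: "F \<subseteq> hom_funs n" and \<epsilon>: "0 < \<epsilon>"
  obtains A g w where "finite A" "A \<subseteq> l1_sphere n"
    "\<And>s. s \<in> A \<Longrightarrow> lat_lin n x (g s) (w s)" "\<And>s t. s \<in> A \<Longrightarrow> 0 \<le> g s t"
    "\<And>t. t \<in> tuples n \<Longrightarrow> (\<Sum>s\<in>A. g s t) = l1_fun n t"
    "\<And>f t. f \<in> F \<Longrightarrow> t \<in> tuples n \<Longrightarrow> \<bar>f t - (\<Sum>s\<in>A. f s * g s t)\<bar> \<le> \<epsilon> * l1_fun n t"
proof -
  define d where "d u s = (\<Sum>i<n. \<bar>u i - s i\<bar>)" for u s :: "nat \<Rightarrow> real"
  \<comment> \<open>Summing over \<open>F\<close> provides one radius for all functions. The factor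
    2 is the width of the tent, which is at least 1 up to distance \<open>r\<close> and vanishes
    from distance \<open>2 * r\<close> on.\<close>
  have "\<exists>r>0. \<forall>u\<in>l1_sphere n. d u s < 2 * r \<longrightarrow> (\<Sum>f\<in>F. \<bar>f u - f s\<bar>) < \<epsilon>" if s: "s \<in> l1_sphere n" for s
  proof -
    have "continuous_on (l1_sphere n) (\<lambda>u. \<epsilon> - (\<Sum>f\<in>F. \<bar>f u - f s\<bar>))"
      using F by (intro continuous_intros hom_funs_continuous_l1_sphere) auto
    from ex_l1_radius [OF this s] \<epsilon> obtain r where "0 < r"
      "\<And>u. u \<in> l1_sphere n \<Longrightarrow> d u s < r \<Longrightarrow> (\<Sum>f\<in>F. \<bar>f u - f s\<bar>) < \<epsilon>"
      by (auto simp: d_def)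
    then show ?thesis by (intro exI [of _ "r / 2"]) auto
  qed
  then have "\<forall>s\<in>l1_sphere n. \<exists>r. 0 < r \<and>
      (\<forall>u\<in>l1_sphere n. d u s < 2 * r \<longrightarrow> (\<Sum>f\<in>F. \<bar>f u - f s\<bar>) < \<epsilon>)"
    by (intro ballI)
  from bchoice [OF this] obtain r where r_osc: "\<forall>s\<in>l1_sphere n. 0 < r s \<and>
      (\<forall>u\<in>l1_sphere n. d u s < 2 * r s \<longrightarrow> (\<Sum>f\<in>F. \<bar>f u - f s\<bar>) < \<epsilon>)"
    by (elim exE)
  have r: "0 < r s" if "s \<in> l1_sphere n" for s
    using r_osc that by simp
  have osc: "(\<Sum>f\<in>F. \<bar>f u - f s\<bar>) < \<epsilon>"
    if "s \<in> l1_sphere n" "u \<in> l1_sphere n" "d u s < 2 * r s" for s u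
    using r_osc that by simp
  have op: "open {u. d u s < r s}" for s
    unfolding d_def
    by (intro open_Collect_less continuous_intros continuous_on_product_coordinates)
  have "l1_sphere n \<subseteq> (\<Union>s\<in>l1_sphere n. {u. d u s < r s})"
    using r by (auto simp: d_def)
  then obtain A where A: "A \<subseteq> l1_sphere n" "finite A"
    and cov: "l1_sphere n \<subseteq> (\<Union>s\<in>A. {u. d u s < r s})"
    by (rule compactE_image [OF compact_l1_sphere op])
  have cover: "\<exists>s\<in>A. d u s < r s" if "u \<in> l1_sphere n" for u
    using subsetD [OF cov that] by simp
  define G where "G s = (\<lambda>t. max 0 (2 * l1_fun n t
      - inverse (r s) * (\<Sum>i<n. \<bar>on_tuples n (\<lambda>t. t i) t - s i * l1_fun n t\<bar>)))" for s
  let ?e = "\<Sum>i<n. \<bar>x i\<bar>"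
  \<comment> \<open>The value at \<open>x\<close> of the expression defining \<open>G s\<close>,
    with \<open>?e\<close> in place of \<open>l1_fun n\<close>.\<close>
  define v where "v s = sup 0 (2 *\<^sub>R ?e - inverse (r s) *\<^sub>R (\<Sum>i<n. \<bar>x i - s i *\<^sub>R ?e\<bar>))" for s
  have G: "lat_lin n x (G s) (v s)" for s
    unfolding G_def v_def
    by (intro lat_lin.max lat_lin_zero lat_lin_diff lat_lin_scale lat_lin_sum lat_lin_abs
        lat_lin_l1_fun lat_lin_coordinate) simp
  have G_sphere: "G s u = max 0 (2 - inverse (r s) * d u s)" if "u \<in> l1_sphere n" for s u
    using that by (simp add: G_def d_def l1_sphere_def on_tuples_def)
  have G0: "0 \<le> G s t" for s t by (simp add: G_def)
  from lat_lin_telescope [where G = G and v = v, OF A(2) G G0] obtain g w where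
    gw: "\<forall>s\<in>A. lat_lin n x (g s) (w s) \<and> (\<forall>t. 0 \<le> g s t \<and> g s t \<le> G s t)"
    and sum: "\<forall>t. (\<Sum>s\<in>A. g s t) = min (l1_fun n t) (\<Sum>s\<in>A. G s t)"
    by (elim exE conjE)
  have g: "lat_lin n x (g s) (w s)" "0 \<le> g s t" "g s t \<le> G s t" if "s \<in> A" for s t
    using gw that by simp_all
  \<comment> \<open>At each point of the sphere some tent is at least 1, so the truncated total of
    the tents is all of \<open>l1_fun n\<close>.\<close>
  have le_sphere: "l1_fun n u \<le> (\<Sum>s\<in>A. G s u)" if u: "u \<in> l1_sphere n" for u
  proof -
    obtain s where s: "s \<in> A" "d u s < r s" using cover [OF u] by blast
    then have "inverse (r s) * d u s < 1"
      using r [of s] A(1) by (auto simp: field_simps)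
    then have "1 \<le> G s u" using u by (simp add: G_sphere)
    also have "\<dots> \<le> (\<Sum>s\<in>A. G s u)" using s A(2) G0 by (intro member_le_sum) auto
    finally show ?thesis using u by (simp add: l1_sphere_def)
  qed
  have Gsum: "(\<lambda>t. \<Sum>s\<in>A. G s t) \<in> hom_funs n"
    by (rule hom_funs_lat_lin [OF lat_lin_sum [of A n x G v]]) (rule G)
  have "l1_fun n t \<le> (\<Sum>s\<in>A. G s t)" if "t \<in> tuples n" for t
    by (rule hom_funs_le_by_sphere [OF hom_funs_l1_fun Gsum le_sphere that])
  then have total: "(\<Sum>s\<in>A. g s t) = l1_fun n t" if "t \<in> tuples n" for t
    using sum [rule_format, of t] that by simp
  have approx: "\<bar>f t - (\<Sum>s\<in>A. f s * g s t)\<bar> \<le> \<epsilon> * l1_fun n t" if f: "f \<in> F" and t: "t \<in> tuples n" for f t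
    using l1_sphere_cases [OF t]
  proof cases
    case 1
    have "f \<in> hom_funs n" using f F by blast
    from hom_funs_zero [OF this] have "f t = 0" by (simp add: 1)
    moreover have "g s t = 0" if "s \<in> A" for s
      using hom_funs_zero [OF hom_funs_lat_lin [OF g(1) [OF that]]] by (simp add: 1)
    ultimately show ?thesis using \<epsilon> by simp
  next
    case (2 u c)
    have u: "u \<in> tuples n" using 2(1) by (simp add: l1_sphere_def)
    \<comment> \<open>Where \<open>g s\<close> does not vanish, \<open>u\<close> lies in the tent at
      \<open>s\<close>, and there \<open>f\<close> differs from \<open>f s\<close> by less than
      \<epsilon>.\<close>
    have *: "\<bar>f u * g s u - f s * g s u\<bar> \<le> \<epsilon> * g s u" if s: "s \<in> A" for s
    proof (cases "g s u = 0")
      case False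
      then have "0 < G s u" using g(2,3) [OF s, of u] by linarith
      then have "inverse (r s) * d u s < 2" using 2(1) by (simp add: G_sphere)
      then have "d u s < 2 * r s" using r [of s] s A(1) by (auto simp: field_simps)
      then have "(\<Sum>f\<in>F. \<bar>f u - f s\<bar>) < \<epsilon>" using osc [OF _ 2(1)] s A(1) by blast
      moreover have "\<bar>f u - f s\<bar> \<le> (\<Sum>f\<in>F. \<bar>f u - f s\<bar>)"
        using f \<open>finite F\<close> by (intro member_le_sum) auto
      ultimately have "\<bar>f u - f s\<bar> * g s u \<le> \<epsilon> * g s u"
        using g(2) [OF s] by (intro mult_right_mono) auto
      then show ?thesis
        using g(2) [OF s, of u] by (simp add: abs_mult flip: left_diff_distrib)
    qed simp
    have gu: "(\<Sum>s\<in>A. g s u) = 1" using total [OF u] 2(1) by (simp add: l1_sphere_def)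
    have "f u = (\<Sum>s\<in>A. f u * g s u)" by (simp add: gu flip: sum_distrib_left)
    then have "\<bar>f u - (\<Sum>s\<in>A. f s * g s u)\<bar> = \<bar>\<Sum>s\<in>A. f u * g s u - f s * g s u\<bar>"
      by (simp add: sum_subtractf)
    also have "\<dots> \<le> (\<Sum>s\<in>A. \<epsilon> * g s u)" by (rule order_trans [OF sum_abs sum_mono [OF *]])
    also have "\<dots> = \<epsilon>" by (simp add: gu flip: sum_distrib_left)
    finally have "c * \<bar>f u - (\<Sum>s\<in>A. f s * g s u)\<bar> \<le> c * \<epsilon>" using 2(2) by (intro mult_left_mono) auto
    moreover have "f t = c * f u"
      using hom_funs_scale [OF _ u, of f c] 2(2) f F unfolding 2(3) by auto
    moreover have "(\<Sum>s\<in>A. f s * g s t) = (\<Sum>s\<in>A. f s * (c * g s u))"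
      using hom_funs_scale [OF hom_funs_lat_lin [OF g(1)] u, of _ c] 2(2) unfolding 2(3) by simp
    moreover have "c * \<bar>f u - (\<Sum>s\<in>A. f s * g s u)\<bar> = \<bar>c * f u - (\<Sum>s\<in>A. f s * (c * g s u))\<bar>"
      using 2(2) by (simp add: abs_mult_pos' right_diff_distrib sum_distrib_left mult.left_commute)
    ultimately show ?thesis unfolding 2(4) [symmetric] by (simp add: mult.commute)
  qed
  show ?thesis using that [OF A(2,1) g(1,2) total approx] .
qed

text \<open>The partition for the single function \<open>h\<close>: the values \<open>h s\<close>
  are constants, so the weighted sum of the pieces remains lattice-linear.\<close>

lemma lat_lin_dense:
  assumes h: "h \<in> hom_funs n" and \<epsilon>: "0 < \<epsilon>"
  obtains g z where "lat_lin n x g z" "\<And>t. t \<in> tuples n \<Longrightarrow> \<bar>h t - g t\<bar> \<le> \<epsilon> * l1_fun n t"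
proof -
  have "finite {h}" "{h} \<subseteq> hom_funs n" using h by simp_all
  then obtain A g w where "finite A" "A \<subseteq> l1_sphere n"
    and g: "\<And>s. s \<in> A \<Longrightarrow> lat_lin n x (g s) (w s)" "\<And>s t. s \<in> A \<Longrightarrow> 0 \<le> g s t"
    "\<And>t. t \<in> tuples n \<Longrightarrow> (\<Sum>s\<in>A. g s t) = l1_fun n t"
    "\<And>f t. f \<in> {h} \<Longrightarrow> t \<in> tuples n \<Longrightarrow> \<bar>f t - (\<Sum>s\<in>A. f s * g s t)\<bar> \<le> \<epsilon> * l1_fun n t"
    by (rule partition_of_l1_fun [OF _ _ \<epsilon>, where x = x]) blast
  show ?thesis
  proof (rule that)
    show "lat_lin n x (\<lambda>t. \<Sum>s\<in>A. h s * g s t) (\<Sum>s\<in>A. h s *\<^sub>R w s)"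
      by (intro lat_lin_sum lat_lin_scale g)
    show "\<bar>h t - (\<Sum>s\<in>A. h s * g s t)\<bar> \<le> \<epsilon> * l1_fun n t" if "t \<in> tuples n" for t
      using g(4) [of h] that by simp
  qed
qed

lemma lat_lin_abs_diff_le:
  assumes "lat_lin n x h y" "lat_lin n x k z"
    and "\<And>t. t \<in> tuples n \<Longrightarrow> \<bar>h t - k t\<bar> \<le> c * l1_fun n t"
  shows "\<bar>y - z\<bar> \<le> c *\<^sub>R (\<Sum>i<n. \<bar>x i\<bar>)"
  by (rule lat_lin_mono [OF lat_lin_abs [OF lat_lin_diff [OF assms(1,2)]] lat_lin_scale [OF lat_lin_l1_fun] assms(3)])

lemma lat_lin_norm_diff_le:
  assumes "lat_lin n x h y" "lat_lin n x k z" "0 \<le> c"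
    and "\<And>t. t \<in> tuples n \<Longrightarrow> \<bar>h t - k t\<bar> \<le> c * l1_fun n t"
  shows "norm (y - z) \<le> c * norm (\<Sum>i<n. \<bar>x i\<bar>)"
proof -
  have "norm \<bar>y - z\<bar> \<le> norm (c *\<^sub>R (\<Sum>i<n. \<bar>x i\<bar>))"
    by (rule norm_mono_nonneg [OF abs_ge_zero lat_lin_abs_diff_le [OF assms(1,2,4)]])
  then show ?thesis using assms(3) by simp
qed

section \<open>Construction of the calculus by uniform approximation\<close>

text \<open>The closure of the graph of evaluation. It is kept as a relation because uniqueness of
  \<open>y\<close> comes from positivity, existence from density and completeness.\<close>

definition krivine_rel :: "nat \<Rightarrow> (nat \<Rightarrow> 'a::banach_lattice) \<Rightarrow> ((nat \<Rightarrow> real) \<Rightarrow> real) \<Rightarrow> 'a \<Rightarrow> bool" where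
  "krivine_rel n x h y \<longleftrightarrow> (\<forall>\<epsilon>>0. \<exists>g z. lat_lin n x g z \<and>
     (\<forall>t\<in>tuples n. \<bar>h t - g t\<bar> \<le> \<epsilon> * l1_fun n t) \<and> norm (y - z) \<le> \<epsilon>)"

lemma krivine_relE:
  assumes "krivine_rel n x h y" "0 < \<epsilon>"
  obtains g z where "lat_lin n x g z" "\<And>t. t \<in> tuples n \<Longrightarrow> \<bar>h t - g t\<bar> \<le> \<epsilon> * l1_fun n t" "norm (y - z) \<le> \<epsilon>"
  using assms unfolding krivine_rel_def by metis

text \<open>Expressions close to \<open>h\<close> are close to each other, and positivity transfers
  this to their values at \<open>x\<close>.\<close>

lemma krivine_rel_unique:
  assumes "krivine_rel n x h y" "krivine_rel n x h y'"
  shows "y = y'"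
proof -
  \<comment> \<open>One \<epsilon> for each of \<open>y\<close> and \<open>y'\<close>, and
    \<open>2 * \<epsilon>\<close> times the gauge between the two approximants.\<close>
  let ?M = "2 + 2 * norm (\<Sum>i<n. \<bar>x i\<bar>)"
  have M: "0 < ?M" by (intro add_pos_nonneg) auto
  have *: "norm (y - y') \<le> \<epsilon> * ?M" if \<epsilon>: "0 < \<epsilon>" for \<epsilon>
  proof -
    obtain g z where g: "lat_lin n x g z" "\<And>t. t \<in> tuples n \<Longrightarrow> \<bar>h t - g t\<bar> \<le> \<epsilon> * l1_fun n t" "norm (y - z) \<le> \<epsilon>"
      by (rule krivine_relE [OF assms(1) \<epsilon>]) (rule that)
    obtain g' z' where g': "lat_lin n x g' z'" "\<And>t. t \<in> tuples n \<Longrightarrow> \<bar>h t - g' t\<bar> \<le> \<epsilon> * l1_fun n t" "norm (y' - z') \<le> \<epsilon>"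
      by (rule krivine_relE [OF assms(2) \<epsilon>]) (rule that)
    have "\<bar>g t - g' t\<bar> \<le> (2 * \<epsilon>) * l1_fun n t" if "t \<in> tuples n" for t
      using g(2) [OF that] g'(2) [OF that] by linarith
    then have "norm (z - z') \<le> (2 * \<epsilon>) * norm (\<Sum>i<n. \<bar>x i\<bar>)"
      using \<epsilon> by (intro lat_lin_norm_diff_le [OF g(1) g'(1)]) auto
    moreover have "norm (y - y') \<le> norm (y - z) + norm (z - z') + norm (y' - z')"
      using norm_triangle_ineq [of "y - z + (z - z')" "z' - y'"] norm_triangle_ineq [of "y - z" "z - z'"]
      by (simp add: norm_minus_commute)
    ultimately show ?thesis using g(3) g'(3) by (simp add: algebra_simps)
  qed
  have "norm (y - y') \<le> 0 + d" if "0 < d" for d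
    using * [of "d / ?M"] that M by (simp add: divide_pos_pos)
  then have "norm (y - y') \<le> 0" by (rule field_le_epsilon)
  then show ?thesis by simp
qed

text \<open>Approximants of accuracy \<open>q k\<close> have values that form a Cauchy sequence,
  again by positivity; its limit is the required value.\<close>

lemma krivine_rel_exists:
  assumes h: "h \<in> hom_funs n"
  shows "\<exists>y. krivine_rel n x h y"
proof -
  let ?M = "norm (\<Sum>i<n. \<bar>x i\<bar>)"
  define q where "q k = inverse (real (Suc k))" for k
  have q: "0 < q k" for k by (simp add: q_def)
  have "\<exists>p. lat_lin n x (fst p) (snd p) \<and> (\<forall>t\<in>tuples n. \<bar>h t - fst p t\<bar> \<le> q k * l1_fun n t)" for k
  proof -
    obtain g z where "lat_lin n x g z" "\<And>t. t \<in> tuples n \<Longrightarrow> \<bar>h t - g t\<bar> \<le> q k * l1_fun n t"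
      by (rule lat_lin_dense [OF h q [of k], where x = x]) (rule that)
    then show ?thesis by (intro exI [of _ "(g, z)"]) simp
  qed
  then have "\<exists>p. \<forall>k. lat_lin n x (fst (p k)) (snd (p k)) \<and> (\<forall>t\<in>tuples n. \<bar>h t - fst (p k) t\<bar> \<le> q k * l1_fun n t)"
    by (intro choice allI)
  then obtain p where p: "\<forall>k. lat_lin n x (fst (p k)) (snd (p k)) \<and> (\<forall>t\<in>tuples n. \<bar>h t - fst (p k) t\<bar> \<le> q k * l1_fun n t)"
    by (elim exE)
  define g z where "g k = fst (p k)" and "z k = snd (p k)" for k
  have gz: "lat_lin n x (g k) (z k)" and
    approx: "t \<in> tuples n \<Longrightarrow> \<bar>h t - g k t\<bar> \<le> q k * l1_fun n t" for k t
    using p by (simp_all add: g_def z_def)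
  have dist: "norm (z j - z k) \<le> (q j + q k) * ?M" for j k
  proof (rule lat_lin_norm_diff_le [OF gz gz])
    show "0 \<le> q j + q k" using q [of j] q [of k] by simp
    show "\<bar>g j t - g k t\<bar> \<le> (q j + q k) * l1_fun n t" if "t \<in> tuples n" for t
      using approx [OF that, of j] approx [OF that, of k] by (simp add: algebra_simps)
  qed
  have small: "\<exists>K. \<forall>k\<ge>K. q k < d" if "0 < d" for d
  proof -
    obtain K where "inverse (real (Suc K)) < d" using reals_Archimedean [OF \<open>0 < d\<close>] by blast
    moreover have "q k \<le> inverse (real (Suc K))" if "K \<le> k" for k
      using that by (simp add: q_def)
    ultimately show ?thesis by (meson le_less_trans)
  qed
  have "Cauchy z"
  proof (rule CauchyI)
    fix d :: real assume d: "0 < d"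
    have "0 < ?M + 1" using norm_ge_zero [of "\<Sum>i<n. \<bar>x i\<bar>"] by linarith
    then have M: "0 < 2 * (?M + 1)" by simp
    obtain K where K: "\<And>k. K \<le> k \<Longrightarrow> q k < d / (2 * (?M + 1))" using small [of "d / (2 * (?M + 1))"] d M by auto
    show "\<exists>K. \<forall>j\<ge>K. \<forall>k\<ge>K. norm (z j - z k) < d"
    proof (intro exI [of _ K] allI impI)
      fix j k assume "K \<le> j" "K \<le> k"
      then have "q j * (2 * (?M + 1)) < d" "q k * (2 * (?M + 1)) < d"
        using K M by (simp_all add: pos_less_divide_eq)
      moreover have "q j * ?M \<le> q j * (?M + 1)" "q k * ?M \<le> q k * (?M + 1)"
        using q [of j] q [of k] by (simp_all add: mult_left_mono)
      ultimately show "norm (z j - z k) < d" using dist [of j k] by (simp add: algebra_simps)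
    qed
  qed
  then obtain y where y: "z \<longlonglongrightarrow> y" using Cauchy_convergent convergent_def by blast
  have "krivine_rel n x h y"
    unfolding krivine_rel_def
  proof (intro allI impI)
    fix d :: real assume d: "0 < d"
    obtain K where K: "\<And>k. K \<le> k \<Longrightarrow> q k < d" using small [OF d] by blast
    obtain L where L: "\<And>k. L \<le> k \<Longrightarrow> norm (z k - y) < d" using LIMSEQ_D [OF y d] by blast
    let ?k = "max K L"
    have "\<bar>h t - g ?k t\<bar> \<le> d * l1_fun n t" if "t \<in> tuples n" for t
    proof -
      have "q ?k * l1_fun n t \<le> d * l1_fun n t"
        using K [of ?k] by (intro mult_right_mono) auto
      then show ?thesis using approx [OF that, of ?k] by linarith
    qed
    moreover have "norm (y - z ?k) \<le> d" using L [of ?k] by (simp add: norm_minus_commute)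
    ultimately show "\<exists>g z. lat_lin n x g z \<and> (\<forall>t\<in>tuples n. \<bar>h t - g t\<bar> \<le> d * l1_fun n t) \<and> norm (y - z) \<le> d"
      using gz by blast
  qed
  then show ?thesis by blast
qed

lemma krivine_rel_lat_lin: "lat_lin n x h y \<Longrightarrow> krivine_rel n x h y"
  unfolding krivine_rel_def by (intro allI impI exI [of _ h] exI [of _ y]) simp

lemma krivine_rel_add:
  assumes "krivine_rel n x h y" "krivine_rel n x k z"
  shows "krivine_rel n x (\<lambda>t. h t + k t) (y + z)"
  unfolding krivine_rel_def
proof (intro allI impI)
  fix d :: real assume "0 < d"
  then have d: "0 < d / 2" by simp
  obtain g v where g: "lat_lin n x g v" "\<And>t. t \<in> tuples n \<Longrightarrow> \<bar>h t - g t\<bar> \<le> d / 2 * l1_fun n t" "norm (y - v) \<le> d / 2"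
    by (rule krivine_relE [OF assms(1) d]) (rule that)
  obtain g' v' where g': "lat_lin n x g' v'" "\<And>t. t \<in> tuples n \<Longrightarrow> \<bar>k t - g' t\<bar> \<le> d / 2 * l1_fun n t" "norm (z - v') \<le> d / 2"
    by (rule krivine_relE [OF assms(2) d]) (rule that)
  show "\<exists>g v. lat_lin n x g v \<and> (\<forall>t\<in>tuples n. \<bar>h t + k t - g t\<bar> \<le> d * l1_fun n t) \<and> norm (y + z - v) \<le> d"
  proof (intro exI conjI ballI)
    show "lat_lin n x (\<lambda>t. g t + g' t) (v + v')" by (rule lat_lin_add [OF g(1) g'(1)])
    show "\<bar>h t + k t - (g t + g' t)\<bar> \<le> d * l1_fun n t" if "t \<in> tuples n" for t
    proof -
      have "\<bar>h t + k t - (g t + g' t)\<bar> \<le> \<bar>h t - g t\<bar> + \<bar>k t - g' t\<bar>" by linarith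
      then show ?thesis using g(2) [OF that] g'(2) [OF that] by (simp add: field_simps)
    qed
    show "norm (y + z - (v + v')) \<le> d"
      using norm_triangle_ineq [of "y - v" "z - v'"] g(3) g'(3) by (simp add: algebra_simps)
  qed
qed

lemma krivine_rel_scale:
  assumes "krivine_rel n x h y"
  shows "krivine_rel n x (\<lambda>t. c * h t) (c *\<^sub>R y)"
  unfolding krivine_rel_def
proof (intro allI impI)
  fix d :: real assume d: "0 < d"
  let ?e = "d / (\<bar>c\<bar> + 1)"
  have e: "0 < ?e" using d by (simp add: divide_pos_pos)
  have ce: "\<bar>c\<bar> * ?e \<le> d"
    using d by (simp add: field_simps)
  obtain g v where g: "lat_lin n x g v" "\<And>t. t \<in> tuples n \<Longrightarrow> \<bar>h t - g t\<bar> \<le> ?e * l1_fun n t" "norm (y - v) \<le> ?e"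
    by (rule krivine_relE [OF assms(1) e]) (rule that)
  show "\<exists>g v. lat_lin n x g v \<and> (\<forall>t\<in>tuples n. \<bar>c * h t - g t\<bar> \<le> d * l1_fun n t) \<and> norm (c *\<^sub>R y - v) \<le> d"
  proof (intro exI conjI ballI)
    show "lat_lin n x (\<lambda>t. c * g t) (c *\<^sub>R v)" by (rule lat_lin_scale [OF g(1)])
    show "\<bar>c * h t - c * g t\<bar> \<le> d * l1_fun n t" if "t \<in> tuples n" for t
    proof -
      have "\<bar>c\<bar> * \<bar>h t - g t\<bar> \<le> \<bar>c\<bar> * (?e * l1_fun n t)" by (intro mult_left_mono g(2) that) simp
      also have "\<dots> \<le> d * l1_fun n t"
        using mult_right_mono [OF ce, of "l1_fun n t"] by (simp add: mult.assoc)
      finally show ?thesis by (simp add: abs_mult flip: right_diff_distrib)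
    qed
    have "norm (c *\<^sub>R y - c *\<^sub>R v) = \<bar>c\<bar> * norm (y - v)" by (simp flip: scaleR_right_diff_distrib)
    also have "\<dots> \<le> \<bar>c\<bar> * ?e" by (intro mult_left_mono g(3)) simp
    finally show "norm (c *\<^sub>R y - c *\<^sub>R v) \<le> d" using ce by linarith
  qed
qed

lemma krivine_rel_max:
  assumes "krivine_rel n x h y" "krivine_rel n x k z"
  shows "krivine_rel n x (\<lambda>t. max (h t) (k t)) (sup y z)"
  unfolding krivine_rel_def
proof (intro allI impI)
  fix d :: real assume "0 < d"
  then have d: "0 < d / 2" by simp
  obtain g v where g: "lat_lin n x g v" "\<And>t. t \<in> tuples n \<Longrightarrow> \<bar>h t - g t\<bar> \<le> d / 2 * l1_fun n t" "norm (y - v) \<le> d / 2"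
    by (rule krivine_relE [OF assms(1) d]) (rule that)
  obtain g' v' where g': "lat_lin n x g' v'" "\<And>t. t \<in> tuples n \<Longrightarrow> \<bar>k t - g' t\<bar> \<le> d / 2 * l1_fun n t" "norm (z - v') \<le> d / 2"
    by (rule krivine_relE [OF assms(2) d]) (rule that)
  show "\<exists>g v. lat_lin n x g v \<and> (\<forall>t\<in>tuples n. \<bar>max (h t) (k t) - g t\<bar> \<le> d * l1_fun n t) \<and> norm (sup y z - v) \<le> d"
  proof (intro exI conjI ballI)
    show "lat_lin n x (\<lambda>t. max (g t) (g' t)) (sup v v')" by (rule lat_lin.max [OF g(1) g'(1)])
    show "\<bar>max (h t) (k t) - max (g t) (g' t)\<bar> \<le> d * l1_fun n t" if "t \<in> tuples n" for t
    proof -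
      have "\<bar>max (h t) (k t) - max (g t) (g' t)\<bar> \<le> \<bar>h t - g t\<bar> + \<bar>k t - g' t\<bar>" by linarith
      then show ?thesis using g(2) [OF that] g'(2) [OF that] by (simp add: field_simps)
    qed
    show "norm (sup y z - sup v v') \<le> d"
      using norm_sup_diff_le [of y z v v'] g(3) g'(3) by linarith
  qed
qed

lemma krivine_calculus_exists: "\<exists>\<tau>. is_krivine_calculus n x \<tau>"
proof -
  define \<tau> where "\<tau> h = (if h \<in> hom_funs n then THE y. krivine_rel n x h y else 0)" for h
  have \<tau>: "\<tau> h = y" if "h \<in> hom_funs n" "krivine_rel n x h y" for h y
    using that krivine_rel_unique by (auto simp: \<tau>_def intro!: the_equality)
  have rel: "krivine_rel n x h (\<tau> h)" if "h \<in> hom_funs n" for h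
    using krivine_rel_exists [OF that, of x] \<tau> [OF that] by metis
  show ?thesis
    unfolding is_krivine_calculus_def
  proof (intro exI [of _ \<tau>] conjI ballI allI impI)
    show "\<tau> h = 0" if "h \<notin> hom_funs n" for h using that by (simp add: \<tau>_def)
  next
    fix j assume "j < n"
    then show "\<tau> (on_tuples n (\<lambda>t. t j)) = x j"
      using lat_lin_coordinate [of j n x] by (intro \<tau> krivine_rel_lat_lin hom_funs_lat_lin)
  qed (intro \<tau> hom_funs_add hom_funs_max hom_funs_cmult krivine_rel_add krivine_rel_max krivine_rel_scale rel; assumption)+
qed

section \<open>Consequences of the axioms of the calculus, and its uniqueness\<close>

lemma
  assumes "is_krivine_calculus n x \<tau>"
  shows is_krivine_add: "h \<in> hom_funs n \<Longrightarrow> k \<in> hom_funs n \<Longrightarrow> \<tau> (\<lambda>t. h t + k t) = \<tau> h + \<tau> k"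
    and is_krivine_scale: "h \<in> hom_funs n \<Longrightarrow> \<tau> (\<lambda>t. c * h t) = c *\<^sub>R \<tau> h"
    and is_krivine_coordinate: "j < n \<Longrightarrow> \<tau> (on_tuples n (\<lambda>t. t j)) = x j"
    and is_krivine_max: "h \<in> hom_funs n \<Longrightarrow> k \<in> hom_funs n \<Longrightarrow> \<tau> (\<lambda>t. max (h t) (k t)) = sup (\<tau> h) (\<tau> k)"
    and is_krivine_outside: "h \<notin> hom_funs n \<Longrightarrow> \<tau> h = 0"
  using assms unfolding is_krivine_calculus_def by simp_all

lemma is_krivine_zero:
  assumes "is_krivine_calculus n x \<tau>"
  shows "\<tau> (\<lambda>t. 0) = 0"
  using is_krivine_scale [OF assms hom_funs_const_zero, of 0] by simp

lemma hom_funs_sum: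
  assumes "\<And>i. i \<in> A \<Longrightarrow> h i \<in> hom_funs n"
  shows "(\<lambda>t. \<Sum>i\<in>A. h i t) \<in> hom_funs n"
  using assms
proof (induction A rule: infinite_finite_induct)
  case (insert i A)
  then show ?case using hom_funs_add [of "h i" n] by simp
qed (simp_all add: hom_funs_const_zero)

lemma is_krivine_sum:
  assumes \<tau>: "is_krivine_calculus n x \<tau>" and "\<And>i. i \<in> A \<Longrightarrow> h i \<in> hom_funs n"
  shows "\<tau> (\<lambda>t. \<Sum>i\<in>A. h i t) = (\<Sum>i\<in>A. \<tau> (h i))"
  using assms(2)
proof (induction A rule: infinite_finite_induct)
  case (insert i A)
  then show ?case using is_krivine_add [OF \<tau>, of "h i"] hom_funs_sum [of A h] by simp
qed (simp_all add: is_krivine_zero [OF \<tau>])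

lemma is_krivine_lin_form:
  assumes \<tau>: "is_krivine_calculus n x \<tau>"
  shows "\<tau> (lin_form n a) = (\<Sum>i<n. a i *\<^sub>R x i)"
proof -
  have "lin_form n a = (\<lambda>t. \<Sum>i<n. a i * on_tuples n (\<lambda>t. t i) t)"
    by (auto simp: fun_eq_iff lin_form_def on_tuples_def)
  moreover have "\<tau> (\<lambda>t. \<Sum>i<n. a i * on_tuples n (\<lambda>t. t i) t) = (\<Sum>i<n. \<tau> (\<lambda>t. a i * on_tuples n (\<lambda>t. t i) t))"
    by (rule is_krivine_sum [OF \<tau>]) (simp add: hom_funs_cmult coordinate_conv_lin_form hom_funs_lin_form)
  moreover have "\<tau> (\<lambda>t. a i * on_tuples n (\<lambda>t. t i) t) = a i *\<^sub>R x i" if "i < n" for i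
    using is_krivine_scale [OF \<tau>, of "on_tuples n (\<lambda>t. t i)"] is_krivine_coordinate [OF \<tau> that]
    by (simp add: coordinate_conv_lin_form hom_funs_lin_form that)
  ultimately show ?thesis by simp
qed

lemma is_krivine_min:
  assumes \<tau>: "is_krivine_calculus n x \<tau>" and h: "h \<in> hom_funs n" and k: "k \<in> hom_funs n"
  shows "\<tau> (\<lambda>t. min (h t) (k t)) = inf (\<tau> h) (\<tau> k)"
proof -
  have eq: "(\<lambda>t. min (h t) (k t)) = (\<lambda>t. -1 * max (-1 * h t) (-1 * k t))" by (auto simp: fun_eq_iff min_def max_def)
  have "\<tau> (\<lambda>t. -1 * max (-1 * h t) (-1 * k t)) = - sup (- \<tau> h) (- \<tau> k)"
    using is_krivine_scale [OF \<tau> hom_funs_max [OF hom_funs_cmult [OF h, of "-1"] hom_funs_cmult [OF k, of "-1"]], of "-1"]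
      is_krivine_max [OF \<tau> hom_funs_cmult [OF h, of "-1"] hom_funs_cmult [OF k, of "-1"]]
      is_krivine_scale [OF \<tau> h, of "-1"] is_krivine_scale [OF \<tau> k, of "-1"]
    by (simp del: neg_sup_eq_inf)
  then show ?thesis unfolding eq by simp
qed

text \<open>Linear forms are fixed by linearity and the coordinates, everything else in the normal
  form by the lattice operations.\<close>

lemma is_krivine_lat_lin:
  assumes \<tau>: "is_krivine_calculus n x \<tau>" and "lat_lin n x h y"
  shows "\<tau> h = y"
proof -
  have "\<tau> h = y" if "inf_lin n x h y" for h y
    using that
    by (induction rule: inf_lin.induct)
      (simp_all add: is_krivine_lin_form [OF \<tau>] is_krivine_min [OF \<tau>] hom_funs_inf_lin)
  with assms(2) show ?thesis
    by (induction rule: lat_lin.induct) (simp_all add: is_krivine_max [OF \<tau>] hom_funs_lat_lin)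
qed

text \<open>Order is encoded as \<open>max h k = k\<close>, which \<open>\<tau>\<close> preserves.
  As an equation of functions it has to hold outside the tuples too, where both sides are 0.\<close>

lemma is_krivine_mono:
  assumes \<tau>: "is_krivine_calculus n x \<tau>" and h: "h \<in> hom_funs n" and k: "k \<in> hom_funs n"
    and le: "\<And>t. t \<in> tuples n \<Longrightarrow> h t \<le> k t"
  shows "\<tau> h \<le> \<tau> k"
proof -
  have max: "max (h t) (k t) = k t" for t
    using le [of t] hom_funs_outside [OF h, of t] hom_funs_outside [OF k, of t]
    by (cases "t \<in> tuples n") auto
  have "sup (\<tau> h) (\<tau> k) = \<tau> k"
    unfolding is_krivine_max [OF \<tau> h k, symmetric] max ..
  then show ?thesis unfolding le_iff_sup .
qed

lemma is_krivine_abs_diff_le: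
  assumes \<tau>: "is_krivine_calculus n x \<tau>" and h: "h \<in> hom_funs n" and k: "k \<in> hom_funs n"
    and le: "\<And>t. t \<in> tuples n \<Longrightarrow> \<bar>h t - k t\<bar> \<le> c * l1_fun n t"
  shows "\<bar>\<tau> h - \<tau> k\<bar> \<le> c *\<^sub>R (\<Sum>i<n. \<bar>x i\<bar>)"
proof -
  have *: "\<tau> h \<le> \<tau> k + c *\<^sub>R (\<Sum>i<n. \<bar>x i\<bar>)"
    if h: "h \<in> hom_funs n" and k: "k \<in> hom_funs n"
      and le: "\<And>t. t \<in> tuples n \<Longrightarrow> \<bar>h t - k t\<bar> \<le> c * l1_fun n t" for h k
  proof -
    have s: "(\<lambda>t. c * l1_fun n t) \<in> hom_funs n" by (rule hom_funs_cmult [OF hom_funs_l1_fun])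
    have "\<tau> h \<le> \<tau> (\<lambda>t. k t + c * l1_fun n t)"
      by (rule is_krivine_mono [OF \<tau> h hom_funs_add [OF k s]]) (use le in fastforce)
    then show ?thesis
      by (simp add: is_krivine_add [OF \<tau> k s] is_krivine_lat_lin [OF \<tau> lat_lin_scale [OF lat_lin_l1_fun]])
  qed
  have "\<tau> h \<le> \<tau> k + c *\<^sub>R (\<Sum>i<n. \<bar>x i\<bar>)" by (rule * [OF h k le])
  moreover have "\<tau> k \<le> \<tau> h + c *\<^sub>R (\<Sum>i<n. \<bar>x i\<bar>)"
    by (rule * [OF k h]) (use le in \<open>simp add: abs_minus_commute\<close>)
  ultimately show ?thesis
    by (intro abs_leI) (simp_all only: minus_diff_eq diff_le_eq add.commute)
qed

text \<open>Continuity is automatic: a calculus is monotone, so it respects approximation relative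
  to \<open>l1_fun n\<close>. Hence any two calculi satisfy the same relation, whose values are
  unique.\<close>

lemma is_krivine_imp_rel:
  assumes \<tau>: "is_krivine_calculus n x \<tau>" and h: "h \<in> hom_funs n"
  shows "krivine_rel n x h (\<tau> h)"
  unfolding krivine_rel_def
proof (intro allI impI)
  fix d :: real assume d: "0 < d"
  let ?M = "norm (\<Sum>i<n. \<bar>x i\<bar>)"
  \<comment> \<open>Chosen so that both the pointwise error \<open>?e\<close> and the norm error
    \<open>?e * ?M\<close> are at most \<open>d\<close>.\<close>
  let ?e = "d / (?M + 1)"
  have M: "0 < ?M + 1" using norm_ge_zero [of "\<Sum>i<n. \<bar>x i\<bar>"] by linarith
  have e: "0 < ?e" using d M by (rule divide_pos_pos)
  have "?e * (?M + 1) = d" using M by simp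
  then have "?e * ?M + ?e = d" by (simp only: distrib_left mult_1_right)
  moreover have "0 \<le> ?e * ?M" using mult_nonneg_nonneg [OF less_imp_le [OF e] norm_ge_zero] .
  ultimately have ed: "?e \<le> d" "?e * ?M \<le> d" using e by linarith+
  obtain g z where g: "lat_lin n x g z" "\<And>t. t \<in> tuples n \<Longrightarrow> \<bar>h t - g t\<bar> \<le> ?e * l1_fun n t"
    by (rule lat_lin_dense [OF h e, where x = x]) (rule that)
  have "norm \<bar>\<tau> h - \<tau> g\<bar> \<le> norm (?e *\<^sub>R (\<Sum>i<n. \<bar>x i\<bar>))"
    by (intro norm_mono_nonneg abs_ge_zero is_krivine_abs_diff_le [OF \<tau> h hom_funs_lat_lin [OF g(1)] g(2)])
  then have "norm (\<tau> h - z) \<le> d"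
    using ed(2) unfolding norm_abs_bl norm_scaleR abs_of_pos [OF e] is_krivine_lat_lin [OF \<tau> g(1)]
    by (rule order_trans)
  moreover have "\<bar>h t - g t\<bar> \<le> d * l1_fun n t" if "t \<in> tuples n" for t
    using g(2) [OF that] mult_right_mono [OF ed(1) l1_fun_nonneg [of n t]] by linarith
  ultimately show "\<exists>g z. lat_lin n x g z \<and> (\<forall>t\<in>tuples n. \<bar>h t - g t\<bar> \<le> d * l1_fun n t) \<and> norm (\<tau> h - z) \<le> d"
    using g(1) by blast
qed

theorem is_krivine_calculus_krivine_calculus: "is_krivine_calculus n x (krivine_calculus n x)"
proof -
  obtain \<tau> where \<tau>: "is_krivine_calculus n x \<tau>" using krivine_calculus_exists [of n x] by blast
  have "\<tau>' = \<tau>" if \<tau>': "is_krivine_calculus n x \<tau>'" for \<tau>'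
  proof
    fix h
    show "\<tau>' h = \<tau> h"
    proof (cases "h \<in> hom_funs n")
      case True
      then show ?thesis
        by (intro krivine_rel_unique [OF is_krivine_imp_rel [OF \<tau>'] is_krivine_imp_rel [OF \<tau>]])
    qed (simp add: is_krivine_outside [OF \<tau>] is_krivine_outside [OF \<tau>'])
  qed
  with \<tau> show ?thesis unfolding krivine_calculus_def by (metis theI)
qed

lemmas krivine_add = is_krivine_add [OF is_krivine_calculus_krivine_calculus]
  and krivine_scale = is_krivine_scale [OF is_krivine_calculus_krivine_calculus]
  and krivine_max = is_krivine_max [OF is_krivine_calculus_krivine_calculus]
  and krivine_zero = is_krivine_zero [OF is_krivine_calculus_krivine_calculus]
  and krivine_lin_form = is_krivine_lin_form [OF is_krivine_calculus_krivine_calculus]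
  and krivine_lat_lin = is_krivine_lat_lin [OF is_krivine_calculus_krivine_calculus]
  and krivine_mono = is_krivine_mono [OF is_krivine_calculus_krivine_calculus]
  and krivine_abs_diff_le = is_krivine_abs_diff_le [OF is_krivine_calculus_krivine_calculus]

section \<open>Dual pairs of norms on tuples\<close>

definition krivine_norm :: "((nat \<Rightarrow> real) \<Rightarrow> real) \<Rightarrow> nat \<Rightarrow> (nat \<Rightarrow> 'a::banach_lattice) \<Rightarrow> 'a" where
  "krivine_norm N n x = krivine_calculus n x (on_tuples n N)"

lemma tuple_norm_conv_krivine_norm: "tuple_norm N n x = norm (krivine_norm N n x)"
  by (simp add: tuple_norm_def krivine_norm_def)

definition unit_tuple :: "nat \<Rightarrow> nat \<Rightarrow> real" where
  "unit_tuple j = (\<lambda>i. if i = j then 1 else 0)"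

lemma unit_tuple_in_tuples: "j < n \<Longrightarrow> unit_tuple j \<in> tuples n"
  by (simp add: unit_tuple_def tuples_iff)

lemma sum_unit_tuple: "j < n \<Longrightarrow> (\<Sum>i<n. unit_tuple j i * t i) = t j"
  "j < n \<Longrightarrow> (\<Sum>i<n. t i * unit_tuple j i) = t j"
  by (simp_all add: unit_tuple_def if_distrib [of "\<lambda>x. x * _"] if_distrib [of "\<lambda>x. _ * x"] cong: if_cong)

lemma sum_unit_tuple_scaleR:
  "j < n \<Longrightarrow> (\<Sum>i<n. (c * unit_tuple j i) *\<^sub>R x i) = c *\<^sub>R (x j :: 'b::real_vector)"
  by (subst sum.mono_neutral_right [of "{..<n}" "{j}"]) (auto simp: unit_tuple_def)

definition trunc_seq :: "nat \<Rightarrow> (nat \<Rightarrow> 'b::zero) \<Rightarrow> nat \<Rightarrow> 'b" where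
  "trunc_seq m x = (\<lambda>i. if i < m then x i else 0)"

lemma trunc_seq_in_tuples: "trunc_seq m b \<in> tuples m"
  by (simp add: trunc_seq_def tuples_iff)

lemma sum_eq_if_zero_tail:
  fixes m n :: nat
  assumes "m \<le> n" "\<And>i. m \<le> i \<Longrightarrow> i < n \<Longrightarrow> f i = 0"
  shows "(\<Sum>i<n. f i) = (\<Sum>i<m. f i)"
  by (rule sum.mono_neutral_right) (use assms in auto)

text \<open>\<open>pairing\<close> and the two parts of \<open>attain\<close> make \<open>N\<close>
  and \<open>M\<close> dual norms of each other on tuples of every length. Attainment is asked only
  for each \<open>c\<close> strictly below the norm, since the Koethe norm is a supremum. By
  symmetry every result is available twice, for the lattice with \<open>N\<close> and for its dual
  with \<open>M\<close>.\<close>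

locale tuple_norm_pair =
  fixes N M :: "(nat \<Rightarrow> real) \<Rightarrow> real"
  assumes hom: "on_tuples n N \<in> hom_funs n" "on_tuples n M \<in> hom_funs n"
    and nonneg: "t \<in> tuples n \<Longrightarrow> 0 \<le> N t" "t \<in> tuples n \<Longrightarrow> 0 \<le> M t"
    and uminus: "t \<in> tuples n \<Longrightarrow> N (\<lambda>i. - t i) = N t" "t \<in> tuples n \<Longrightarrow> M (\<lambda>i. - t i) = M t"
    and pairing: "b \<in> tuples n \<Longrightarrow> t \<in> tuples n \<Longrightarrow> (\<Sum>i<n. b i * t i) \<le> M b * N t"
    and attain: "t \<in> tuples n \<Longrightarrow> c < N t \<Longrightarrow> \<exists>b\<in>tuples n. M b \<le> 1 \<and> c < (\<Sum>i<n. b i * t i)"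
      "b \<in> tuples n \<Longrightarrow> c < M b \<Longrightarrow> \<exists>t\<in>tuples n. N t \<le> 1 \<and> c < (\<Sum>i<n. b i * t i)"
begin

lemma dual: "tuple_norm_pair M N"
proof
  fix n t b c
  show "b \<in> tuples n \<Longrightarrow> t \<in> tuples n \<Longrightarrow> (\<Sum>i<n. b i * t i) \<le> N b * M t"
    using pairing [of t n b] by (simp add: mult.commute)
  show "t \<in> tuples n \<Longrightarrow> c < M t \<Longrightarrow> \<exists>b\<in>tuples n. N b \<le> 1 \<and> c < (\<Sum>i<n. b i * t i)"
    using attain(2) [of t n c] by (simp add: mult.commute)
  show "b \<in> tuples n \<Longrightarrow> c < N b \<Longrightarrow> \<exists>t\<in>tuples n. M t \<le> 1 \<and> c < (\<Sum>i<n. b i * t i)"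
    using attain(1) [of b n c] by (simp add: mult.commute)
qed (rule hom nonneg uminus; assumption)+

lemma M_scale: "b \<in> tuples n \<Longrightarrow> 0 \<le> c \<Longrightarrow> M (\<lambda>i. c * b i) = c * M b"
  using hom_funs_scale [OF hom(2), of b n c] by (simp add: on_tuples_def tuples_scale)

lemma M_zero: "M (\<lambda>i. 0) = 0"
  using M_scale [of "\<lambda>i. 0" 0 0] by simp

text \<open>A tuple of length \<open>m\<close> pairs with \<open>b\<close> as it does with the
  truncation, so a tuple that norms the truncation is also a test for \<open>b\<close>.\<close>

lemma M_trunc_seq_le:
  assumes b: "b \<in> tuples n"
  shows "M (trunc_seq m b) \<le> M b"
proof (rule ccontr)
  assume "\<not> ?thesis"
  then have "M b < M (trunc_seq m b)" by simp
  from attain(2) [OF trunc_seq_in_tuples this]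
  obtain t where t: "t \<in> tuples m" "N t \<le> 1" "M b < (\<Sum>i<m. trunc_seq m b i * t i)" by (elim bexE conjE)
  \<comment> \<open>Either length may be the larger one, and the pairing needs a common
    length.\<close>
  let ?k = "max m n"
  have bt: "b \<in> tuples ?k" "t \<in> tuples ?k" using b t(1) by (simp_all add: tuples_iff)
  have "(\<Sum>i<m. trunc_seq m b i * t i) = (\<Sum>i<?k. b i * t i)"
    using t(1) by (subst sum_eq_if_zero_tail [of m ?k]) (simp_all add: tuples_iff trunc_seq_def)
  also have "\<dots> \<le> M b * N t" by (rule pairing [OF bt])
  also have "\<dots> \<le> M b * 1" by (rule mult_left_mono [OF t(2) nonneg(2) [OF b]])
  finally show False using t(3) by simp
qed

lemma abs_entry_le:
  assumes b: "b \<in> tuples n" "M b \<le> 1" and j: "j < n"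
  shows "\<bar>b j\<bar> \<le> N (unit_tuple j)"
proof -
  note u = unit_tuple_in_tuples [OF j]
  have *: "c j \<le> N (unit_tuple j)" if c: "c \<in> tuples n" "M c \<le> 1" for c
  proof -
    have "c j \<le> M c * N (unit_tuple j)" using pairing [OF c(1) u] by (simp add: sum_unit_tuple j)
    also have "\<dots> \<le> 1 * N (unit_tuple j)" by (rule mult_right_mono [OF c(2) nonneg(1) [OF u]])
    finally show ?thesis by simp
  qed
  have "(\<lambda>i. - b i) \<in> tuples n" using b by (simp add: tuples_iff)
  with * [of b] * [of "\<lambda>i. - b i"] b uminus(2) [OF b(1)] show ?thesis by (simp add: abs_le_iff)
qed

lemma M_unit_tuple_pos: "0 < M (unit_tuple j)"
proof -
  note u = unit_tuple_in_tuples [of j "Suc j"]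
  have "1 \<le> M (unit_tuple j) * N (unit_tuple j)"
    using pairing [OF u u, OF lessI lessI] by (simp add: sum_unit_tuple) (simp add: unit_tuple_def)
  then have "M (unit_tuple j) \<noteq> 0" by auto
  then show ?thesis using nonneg(2) [OF u] by simp
qed

section \<open>The norm in the calculus as a least upper bound\<close>

lemma lin_comb_le_krivine_norm:
  assumes b: "b \<in> tuples n"
  shows "(\<Sum>i<n. b i *\<^sub>R x i) \<le> M b *\<^sub>R krivine_norm N n x"
proof -
  have "krivine_calculus n x (lin_form n b) \<le> krivine_calculus n x (\<lambda>t. M b * on_tuples n N t)"
    by (rule krivine_mono [OF hom_funs_lin_form hom_funs_cmult [OF hom(1)]])
      (simp add: lin_form_apply on_tuples_def pairing [OF b])
  then show ?thesis
    by (simp only: krivine_lin_form krivine_scale [OF hom(1)] krivine_norm_def)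
qed

text \<open>A tuple that norms \<open>s\<close> up to \<epsilon> does so on a neighbourhood of
  \<open>s\<close>, and finitely many such neighbourhoods cover the sphere.\<close>

lemma ex_finite_norming_set:
  assumes \<epsilon>: "0 < \<epsilon>"
  shows "\<exists>B. finite B \<and> B \<noteq> {} \<and> (\<forall>b\<in>B. b \<in> tuples n \<and> M b \<le> 1) \<and>
    (\<forall>u\<in>l1_sphere n. \<exists>b\<in>B. N u \<le> (\<Sum>i<n. b i * u i) + \<epsilon>)"
proof -
  have "\<exists>b r. b \<in> tuples n \<and> M b \<le> 1 \<and> 0 < r \<and>
      (\<forall>u\<in>l1_sphere n. (\<Sum>i<n. \<bar>u i - s i\<bar>) < r \<longrightarrow> N u \<le> (\<Sum>i<n. b i * u i) + \<epsilon>)"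
    if s: "s \<in> l1_sphere n" for s
  proof -
    have st: "s \<in> tuples n" using s by (simp add: l1_sphere_def)
    obtain b where b: "b \<in> tuples n" "M b \<le> 1" "N s - \<epsilon> < (\<Sum>i<n. b i * s i)"
      using attain(1) [OF st, of "N s - \<epsilon>"] \<epsilon> by auto
    have "continuous_on (l1_sphere n) (\<lambda>u. lin_form n b u + \<epsilon> - on_tuples n N u)"
      by (intro continuous_intros hom_funs_continuous_l1_sphere hom_funs_lin_form hom)
    moreover have "0 < lin_form n b s + \<epsilon> - on_tuples n N s"
      using b(3) st by (simp add: lin_form_apply on_tuples_def)
    ultimately obtain r where r: "0 < r"
      "\<forall>u\<in>l1_sphere n. (\<Sum>i<n. \<bar>u i - s i\<bar>) < r \<longrightarrow> 0 < lin_form n b u + \<epsilon> - on_tuples n N u"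
      using ex_l1_radius [OF _ s] by blast
    have "N u \<le> (\<Sum>i<n. b i * u i) + \<epsilon>" if "u \<in> l1_sphere n" "(\<Sum>i<n. \<bar>u i - s i\<bar>) < r" for u
      using r(2) [rule_format, OF that] that(1) by (simp add: l1_sphere_def lin_form_apply on_tuples_def)
    then show ?thesis using b(1,2) r(1) by (intro exI [of _ b] exI [of _ r]) simp
  qed
  then have "\<forall>s\<in>l1_sphere n. \<exists>p. fst p \<in> tuples n \<and> M (fst p) \<le> 1 \<and> 0 < (snd p :: real) \<and>
      (\<forall>u\<in>l1_sphere n. (\<Sum>i<n. \<bar>u i - s i\<bar>) < snd p \<longrightarrow> N u \<le> (\<Sum>i<n. fst p i * u i) + \<epsilon>)"
    by (metis fst_conv snd_conv)
  from bchoice [OF this] obtain p where p: "\<forall>s\<in>l1_sphere n. fst (p s) \<in> tuples n \<and> M (fst (p s)) \<le> 1 \<and> 0 < snd (p s) \<and>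
      (\<forall>u\<in>l1_sphere n. (\<Sum>i<n. \<bar>u i - s i\<bar>) < snd (p s) \<longrightarrow> N u \<le> (\<Sum>i<n. fst (p s) i * u i) + \<epsilon>)"
    by (elim exE)
  have op: "open {u. (\<Sum>i<n. \<bar>u i - s i\<bar>) < snd (p s)}" for s
    by (intro open_Collect_less continuous_intros continuous_on_product_coordinates)
  have "l1_sphere n \<subseteq> (\<Union>s\<in>l1_sphere n. {u. (\<Sum>i<n. \<bar>u i - s i\<bar>) < snd (p s)})"
    using p by auto
  then obtain A where A: "A \<subseteq> l1_sphere n" "finite A"
    and cov: "l1_sphere n \<subseteq> (\<Union>s\<in>A. {u. (\<Sum>i<n. \<bar>u i - s i\<bar>) < snd (p s)})"
    by (rule compactE_image [OF compact_l1_sphere op])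
  \<comment> \<open>The zero tuple keeps the set nonempty even when the sphere is empty.\<close>
  let ?B = "insert (\<lambda>i. 0) ((\<lambda>s. fst (p s)) ` A)"
  have "\<exists>b\<in>?B. N u \<le> (\<Sum>i<n. b i * u i) + \<epsilon>" if u: "u \<in> l1_sphere n" for u
  proof -
    obtain s where s: "s \<in> A" "(\<Sum>i<n. \<bar>u i - s i\<bar>) < snd (p s)"
      using subsetD [OF cov u] by auto
    have "N u \<le> (\<Sum>i<n. fst (p s) i * u i) + \<epsilon>"
      using p A(1) s u by blast
    then show ?thesis using s(1) by blast
  qed
  moreover have "b \<in> tuples n \<and> M b \<le> 1" if "b \<in> ?B" for b
    using that p A(1) M_zero by auto
  ultimately show ?thesis using A(2) by (intro exI [of _ ?B]) auto
qed

text \<open>The maximum of the finitely many forms belongs to the calculus and has a value below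
  \<open>w\<close>; up to the gauge it dominates \<open>N\<close>. A finite \<open>B\<close> is
  singled out because in the dual lattice the bound \<open>w\<close> is built from finitely many
  functionals.\<close>

lemma krivine_norm_le_if_norming_set:
  assumes B: "finite B" "B \<noteq> {}"
    and norming: "\<And>u. u \<in> l1_sphere n \<Longrightarrow> \<exists>b\<in>B. N u \<le> (\<Sum>i<n. b i * u i) + \<epsilon>"
    and w: "\<And>b. b \<in> B \<Longrightarrow> (\<Sum>i<n. b i *\<^sub>R x i) \<le> w"
  shows "krivine_norm N n x \<le> w + \<epsilon> *\<^sub>R (\<Sum>i<n. \<bar>x i\<bar>)"
proof -
  have "\<exists>g. g \<in> hom_funs n \<and> krivine_calculus n x g \<le> w \<and> (\<forall>b\<in>B. \<forall>t. lin_form n b t \<le> g t)"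
    using B w
  proof (induction B rule: finite_ne_induct)
    case (singleton b)
    then show ?case
      by (intro exI [of _ "lin_form n b"]) (simp add: hom_funs_lin_form krivine_lin_form)
  next
    case (insert b B)
    have "\<exists>g. g \<in> hom_funs n \<and> krivine_calculus n x g \<le> w \<and> (\<forall>b\<in>B. \<forall>t. lin_form n b t \<le> g t)"
      by (rule insert.IH) (use insert.prems in auto)
    then obtain g where g: "g \<in> hom_funs n" "krivine_calculus n x g \<le> w" "\<forall>b\<in>B. \<forall>t. lin_form n b t \<le> g t"
      by (elim exE conjE)
    have "krivine_calculus n x (\<lambda>t. max (lin_form n b t) (g t)) \<le> w"
      using g(2) insert.prems [of b] by (simp add: krivine_max hom_funs_lin_form g(1) krivine_lin_form)
    then show ?case
      using g(1,3)
      by (intro exI [of _ "\<lambda>t. max (lin_form n b t) (g t)"])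
        (auto simp: hom_funs_max hom_funs_lin_form le_max_iff_disj)
  qed
  then obtain g where g: "g \<in> hom_funs n" "krivine_calculus n x g \<le> w" "\<forall>b\<in>B. \<forall>t. lin_form n b t \<le> g t"
    by (elim exE conjE)
  have s: "(\<lambda>t. \<epsilon> * l1_fun n t) \<in> hom_funs n" by (rule hom_funs_cmult [OF hom_funs_l1_fun])
  have "on_tuples n N u \<le> g u + \<epsilon> * l1_fun n u" if u: "u \<in> l1_sphere n" for u
  proof -
    obtain b where b: "b \<in> B" "N u \<le> (\<Sum>i<n. b i * u i) + \<epsilon>" using norming [OF u] by (rule bexE)
    have "lin_form n b u \<le> g u" using g(3) b(1) by simp
    then show ?thesis using b(2) u by (simp add: l1_sphere_def lin_form_apply on_tuples_def)
  qed
  then have "on_tuples n N t \<le> g t + \<epsilon> * l1_fun n t" if "t \<in> tuples n" for t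
    by (rule hom_funs_le_by_sphere [OF hom(1) hom_funs_add [OF g(1) s] _ that])
  then have "krivine_norm N n x \<le> krivine_calculus n x (\<lambda>t. g t + \<epsilon> * l1_fun n t)"
    unfolding krivine_norm_def by (rule krivine_mono [OF hom(1) hom_funs_add [OF g(1) s]])
  also have "\<dots> = krivine_calculus n x g + \<epsilon> *\<^sub>R (\<Sum>i<n. \<bar>x i\<bar>)"
    by (simp add: krivine_add [OF g(1) s] krivine_lat_lin [OF lat_lin_scale [OF lat_lin_l1_fun]])
  also have "\<dots> \<le> w + \<epsilon> *\<^sub>R (\<Sum>i<n. \<bar>x i\<bar>)" using g(2) by simp
  finally show ?thesis .
qed

text \<open>Together with \<open>krivine_norm_upper\<close> this lets inequalities between norms be
  tested on linear combinations, without further use of the calculus.\<close>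

lemma krivine_norm_least:
  assumes w: "\<And>b. b \<in> tuples n \<Longrightarrow> M b \<le> 1 \<Longrightarrow> (\<Sum>i<n. b i *\<^sub>R x i) \<le> w"
  shows "krivine_norm N n x \<le> w"
proof (rule le_if_le_add_eps)
  fix \<epsilon> :: real assume "0 < \<epsilon>"
  from ex_finite_norming_set [OF this, of n] obtain B where B: "finite B" "B \<noteq> {}"
    "\<forall>b\<in>B. b \<in> tuples n \<and> M b \<le> 1" "\<forall>u\<in>l1_sphere n. \<exists>b\<in>B. N u \<le> (\<Sum>i<n. b i * u i) + \<epsilon>"
    by (elim exE conjE)
  show "krivine_norm N n x \<le> w + \<epsilon> *\<^sub>R (\<Sum>i<n. \<bar>x i\<bar>)"
    by (rule krivine_norm_le_if_norming_set [OF B(1,2)]) (use B(3,4) w in auto)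
qed

lemma krivine_norm_upper:
  assumes "b \<in> tuples n" "M b \<le> 1"
  shows "(\<Sum>i<n. b i *\<^sub>R x i) \<le> krivine_norm N n x"
proof (rule order_trans [OF lin_comb_le_krivine_norm [OF assms(1)]])
  have "0 \<le> krivine_norm N n x"
    using lin_comb_le_krivine_norm [of "\<lambda>i. 0" n x] by (simp add: M_zero)
      (metis (mono_tags) krivine_mono krivine_zero hom(1) hom_funs_const_zero krivine_norm_def nonneg(1) on_tuples_def)
  then have "M b *\<^sub>R krivine_norm N n x \<le> 1 *\<^sub>R krivine_norm N n x"
    using assms(2) by (intro scaleR_right_mono)
  then show "M b *\<^sub>R krivine_norm N n x \<le> krivine_norm N n x" by simp
qed

lemma krivine_norm_nonneg: "0 \<le> krivine_norm N n x"
  using krivine_norm_upper [of "\<lambda>i. 0" n x] by (simp add: M_zero)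

lemma krivine_norm_add: "krivine_norm N n (\<lambda>i. x i + y i) \<le> krivine_norm N n x + krivine_norm N n y"
proof (rule krivine_norm_least)
  fix b assume "b \<in> tuples n" "M b \<le> 1"
  then show "(\<Sum>i<n. b i *\<^sub>R (x i + y i)) \<le> krivine_norm N n x + krivine_norm N n y"
    by (simp add: scaleR_add_right sum.distrib add_mono krivine_norm_upper)
qed

lemma krivine_norm_scale: "krivine_norm N n (\<lambda>i. c *\<^sub>R x i) \<le> \<bar>c\<bar> *\<^sub>R krivine_norm N n x"
proof (rule krivine_norm_least)
  fix b assume b: "b \<in> tuples n" "M b \<le> 1"
  \<comment> \<open>The sign of \<open>c\<close> moves into the tuple; the ball is symmetric and
    contains 0.\<close>
  let ?b = "\<lambda>i. sgn c * b i"
  have "?b = b \<or> ?b = (\<lambda>i. - b i) \<or> ?b = (\<lambda>i. 0)" by (auto simp: sgn_real_def)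
  then have b': "?b \<in> tuples n" "M ?b \<le> 1"
    using b uminus(2) [OF b(1)] M_zero by (auto simp: tuples_iff)
  have "(\<Sum>i<n. b i *\<^sub>R c *\<^sub>R x i) = \<bar>c\<bar> *\<^sub>R (\<Sum>i<n. ?b i *\<^sub>R x i)"
    by (simp add: scaleR_sum_right mult_ac abs_sgn)
  also have "\<dots> \<le> \<bar>c\<bar> *\<^sub>R krivine_norm N n x"
    by (intro scaleR_left_mono krivine_norm_upper b') simp
  finally show "(\<Sum>i<n. b i *\<^sub>R c *\<^sub>R x i) \<le> \<bar>c\<bar> *\<^sub>R krivine_norm N n x" .
qed

lemma krivine_norm_mono_length:
  assumes "m \<le> n"
  shows "krivine_norm N m x \<le> krivine_norm N n x"
proof (rule krivine_norm_least)
  fix b assume b: "b \<in> tuples m" "M b \<le> 1"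
  then have "b \<in> tuples n" using assms by (simp add: tuples_iff)
  moreover have "(\<Sum>i<m. b i *\<^sub>R x i) = (\<Sum>i<n. b i *\<^sub>R x i)"
    using b(1) assms by (intro sum_eq_if_zero_tail [symmetric]) (simp_all add: tuples_iff)
  ultimately show "(\<Sum>i<m. b i *\<^sub>R x i) \<le> krivine_norm N n x"
    using b(2) by (simp add: krivine_norm_upper)
qed

text \<open>Cutting \<open>b\<close> off at the support of \<open>x\<close> leaves the linear
  combination unchanged and keeps \<open>b\<close> in the ball.\<close>

lemma krivine_norm_zero_tail:
  assumes "\<And>i. m \<le> i \<Longrightarrow> x i = 0"
  shows "krivine_norm N n x \<le> krivine_norm N m x"
proof (cases "n \<le> m")
  case False
  show ?thesis
  proof (rule krivine_norm_least)
    fix b assume b: "b \<in> tuples n" "M b \<le> 1"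
    have "(\<Sum>i<n. b i *\<^sub>R x i) = (\<Sum>i<m. b i *\<^sub>R x i)"
      using False assms by (intro sum_eq_if_zero_tail) auto
    also have "\<dots> = (\<Sum>i<m. trunc_seq m b i *\<^sub>R x i)" by (simp add: trunc_seq_def)
    also have "\<dots> \<le> krivine_norm N m x"
      using M_trunc_seq_le [OF b(1), of m] b(2) by (intro krivine_norm_upper trunc_seq_in_tuples) auto
    finally show "(\<Sum>i<n. b i *\<^sub>R x i) \<le> krivine_norm N m x" .
  qed
qed (rule krivine_norm_mono_length, simp)

lemma krivine_norm_trunc_seq: "krivine_norm N n (trunc_seq m x) \<le> krivine_norm N n x"
proof (rule krivine_norm_least)
  fix b assume b: "b \<in> tuples n" "M b \<le> 1"
  have "(\<Sum>i<n. b i *\<^sub>R trunc_seq m x i) = (\<Sum>i<n. trunc_seq m b i *\<^sub>R x i)"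
    by (intro sum.cong) (auto simp: trunc_seq_def)
  also have "\<dots> \<le> krivine_norm N n x"
    using M_trunc_seq_le [OF b(1), of m] b by (intro krivine_norm_upper) (auto simp: tuples_iff trunc_seq_def)
  finally show "(\<Sum>i<n. b i *\<^sub>R trunc_seq m x i) \<le> krivine_norm N n x" .
qed

lemma abs_entry_le_krivine_norm:
  assumes j: "j < n"
  shows "\<bar>x j\<bar> \<le> M (unit_tuple j) *\<^sub>R krivine_norm N n x"
proof (rule abs_leI)
  note u = unit_tuple_in_tuples [OF j]
  show "x j \<le> M (unit_tuple j) *\<^sub>R krivine_norm N n x"
    using lin_comb_le_krivine_norm [OF u, of x] sum_unit_tuple_scaleR [OF j, of 1 x] by simp
  have "(\<lambda>i. - unit_tuple j i) \<in> tuples n" using u by (simp add: tuples_iff)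
  from lin_comb_le_krivine_norm [OF this, of x]
  show "- x j \<le> M (unit_tuple j) *\<^sub>R krivine_norm N n x"
    using sum_unit_tuple_scaleR [OF j, of "-1" x] uminus(2) [OF u] by simp
qed

lemma krivine_norm_single:
  assumes "\<And>i. i \<noteq> j \<Longrightarrow> x i = 0"
  shows "krivine_norm N n x \<le> N (unit_tuple j) *\<^sub>R \<bar>x j\<bar>"
proof (rule krivine_norm_least)
  fix b assume b: "b \<in> tuples n" "M b \<le> 1"
  have N0: "0 \<le> N (unit_tuple j)" by (rule nonneg(1) [OF unit_tuple_in_tuples [OF lessI]])
  show "(\<Sum>i<n. b i *\<^sub>R x i) \<le> N (unit_tuple j) *\<^sub>R \<bar>x j\<bar>"
  proof (cases "j < n")
    case True
    have "(\<Sum>i<n. b i *\<^sub>R x i) = (\<Sum>i\<in>{j}. b i *\<^sub>R x i)"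
      using True assms by (intro sum.mono_neutral_right) auto
    also have "\<dots> \<le> \<bar>b j *\<^sub>R x j\<bar>" by (simp add: abs_ge_self)
    also have "\<dots> = \<bar>b j\<bar> *\<^sub>R \<bar>x j\<bar>" by (rule abs_scaleR_lattice)
    also have "\<dots> \<le> N (unit_tuple j) *\<^sub>R \<bar>x j\<bar>"
      by (rule scaleR_right_mono [OF abs_entry_le [OF b True] abs_ge_zero])
    finally show ?thesis .
  next
    case False
    then have "(\<Sum>i<n. b i *\<^sub>R x i) = 0" using assms by (intro sum.neutral) auto
    then show ?thesis using N0 by (simp add: scaleR_nonneg_nonneg)
  qed
qed

end

section \<open>The pairing with the dual lattice\<close>

lemma abs_blinfun_le:
  fixes \<phi> :: "'a::banach_lattice \<Rightarrow>\<^sub>L real"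
  assumes "\<bar>v\<bar> \<le> c *\<^sub>R e"
  shows "\<bar>blinfun_apply \<phi> v\<bar> \<le> c * blinfun_apply \<bar>\<phi>\<bar> e"
proof -
  have "0 \<le> blinfun_apply \<bar>\<phi>\<bar> (c *\<^sub>R e - \<bar>v\<bar>)"
    using abs_ge_zero [of \<phi>] assms unfolding less_eq_blinfun_def by simp
  then have "blinfun_apply \<bar>\<phi>\<bar> \<bar>v\<bar> \<le> c * blinfun_apply \<bar>\<phi>\<bar> e"
    by (simp add: blinfun.diff_right blinfun.scaleR_right)
  with abs_blinfun_apply_le [of \<phi> v] show ?thesis by linarith
qed

lemma blinfun_apply_mono_left:
  fixes \<phi> \<psi> :: "'a::banach_lattice \<Rightarrow>\<^sub>L real"
  shows "\<phi> \<le> \<psi> \<Longrightarrow> 0 \<le> v \<Longrightarrow> blinfun_apply \<phi> v \<le> blinfun_apply \<psi> v"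
  unfolding less_eq_blinfun_def by simp

lemma blinfun_apply_mono_right:
  fixes \<psi> :: "'a::banach_lattice \<Rightarrow>\<^sub>L real"
  assumes "0 \<le> \<psi>" "v \<le> w"
  shows "blinfun_apply \<psi> v \<le> blinfun_apply \<psi> w"
  using blinfun_apply_mono_left [OF assms(1), of "w - v"] assms(2) by (simp add: blinfun.diff_right)

text \<open>\<open>W\<close> is the supremum of the functionals, and \<open>W u\<close> the supremum
  of the sums over all decompositions of \<open>u\<close> into positive parts indexed by
  \<open>B\<close>. Expressing this through upper bounds \<open>c\<close> avoids forming that
  supremum and suits the induction.\<close>

lemma ex_upper_bound_Riesz_Kantorovich:
  fixes \<psi> :: "'k \<Rightarrow> 'a::banach_lattice \<Rightarrow>\<^sub>L real"
  assumes "finite B" "B \<noteq> {}"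
  shows "\<exists>W. (\<forall>t\<in>B. \<psi> t \<le> W) \<and> (\<forall>u\<ge>0. \<forall>c.
    (\<forall>v. (\<forall>t\<in>B. 0 \<le> v t) \<and> sum v B = u \<longrightarrow> (\<Sum>t\<in>B. blinfun_apply (\<psi> t) (v t)) \<le> c) \<longrightarrow> blinfun_apply W u \<le> c)"
  using assms
proof (induction B rule: finite_ne_induct)
  case (singleton t)
  show ?case
  proof (intro exI [of _ "\<psi> t"] conjI allI impI)
    fix u :: 'a and c :: real
    assume u: "0 \<le> u" and *: "\<forall>v. (\<forall>t\<in>{t}. 0 \<le> v t) \<and> sum v {t} = u \<longrightarrow> (\<Sum>t\<in>{t}. blinfun_apply (\<psi> t) (v t)) \<le> c"
    show "blinfun_apply (\<psi> t) u \<le> c" using * [rule_format, of "\<lambda>_. u"] u by simp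
  qed simp
next
  case (insert a B)
  then obtain W where ub: "\<forall>t\<in>B. \<psi> t \<le> W"
    and W: "\<forall>u\<ge>0. \<forall>c. (\<forall>v. (\<forall>t\<in>B. 0 \<le> v t) \<and> sum v B = u \<longrightarrow>
      (\<Sum>t\<in>B. blinfun_apply (\<psi> t) (v t)) \<le> c) \<longrightarrow> blinfun_apply W u \<le> c"
    by (elim exE conjE)
  show ?case
  proof (intro exI [of _ "sup (\<psi> a) W"] conjI allI impI)
    show "\<forall>t\<in>insert a B. \<psi> t \<le> sup (\<psi> a) W"
      using ub by (auto intro: le_supI2)
    fix u :: 'a and c :: real
    assume u: "0 \<le> u" and *: "\<forall>v. (\<forall>t\<in>insert a B. 0 \<le> v t) \<and> sum v (insert a B) = u \<longrightarrow>
      (\<Sum>t\<in>insert a B. blinfun_apply (\<psi> t) (v t)) \<le> c"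
    \<comment> \<open>The supremum of \<open>\<psi> a\<close> and \<open>W\<close> is
      \<open>W\<close> plus the positive part of \<open>\<psi> a - W\<close>. A part
      \<open>y\<close> of \<open>u\<close> goes to \<open>a\<close>, and the rest
      \<open>u - y\<close> is decomposed over \<open>B\<close>.\<close>
    have "cone_sup (\<psi> a - W) u \<le> c - blinfun_apply W u"
    proof (rule cone_sup_least [OF u])
      fix y assume y: "0 \<le> y" "y \<le> u"
      have "blinfun_apply W (u - y) \<le> c - blinfun_apply (\<psi> a) y"
      proof (rule W [rule_format])
        show "0 \<le> u - y" using y by simp
        fix v assume v: "(\<forall>t\<in>B. 0 \<le> v t) \<and> sum v B = u - y"
        have eq: "sum (v(a := y)) B = sum v B"
          "(\<Sum>t\<in>B. blinfun_apply (\<psi> t) ((v(a := y)) t)) = (\<Sum>t\<in>B. blinfun_apply (\<psi> t) (v t))"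
          using insert.hyps(3) by (auto intro!: sum.cong)
        have "(\<Sum>t\<in>insert a B. blinfun_apply (\<psi> t) ((v(a := y)) t)) \<le> c"
        proof (rule * [rule_format], intro conjI)
          show "\<forall>t\<in>insert a B. 0 \<le> (v(a := y)) t" using v y by simp
          show "sum (v(a := y)) (insert a B) = u"
            using v insert.hyps(1,3) eq(1) by (simp del: fun_upd_apply) simp
        qed
        then show "(\<Sum>t\<in>B. blinfun_apply (\<psi> t) (v t)) \<le> c - blinfun_apply (\<psi> a) y"
          using insert.hyps(1,3) eq(2) by (simp del: fun_upd_apply) simp
      qed
      then show "blinfun_apply (\<psi> a - W) y \<le> c - blinfun_apply W u"
        by (simp add: blinfun.diff_left blinfun.diff_right)
    qed
    then show "blinfun_apply (sup (\<psi> a) W) u \<le> c"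
      by (simp add: sup_blinfun_def blinfun.add_left blinfun_pos_apply u)
  qed
qed

context tuple_norm_pair
begin

interpretation dual: tuple_norm_pair M N by (rule dual)

text \<open>
  With a partition \<open>h\<^sub>k\<close> at points \<open>s\<^sub>k\<close> one has \<open>x i \<approx> (\<Sum>k. s\<^sub>k i \<cdot> h\<^sub>k(x))\<close> and
  \<open>krivine_norm N n x \<approx> (\<Sum>k. N s\<^sub>k \<cdot> h\<^sub>k(x))\<close>, which reduces the estimate to
  the inequalities \<open>(\<Sum>i. s\<^sub>k i \<cdot> \<phi> i) \<le> N s\<^sub>k \<cdot> krivine_norm M n \<phi>\<close> in the dual lattice.
\<close>

lemma sum_apply_le_krivine_norm:
  fixes \<phi> :: "nat \<Rightarrow> 'a::banach_lattice \<Rightarrow>\<^sub>L real"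
  shows "(\<Sum>i<n. blinfun_apply (\<phi> i) (x i)) \<le> blinfun_apply (krivine_norm M n \<phi>) (krivine_norm N n x)"
proof -
  let ?\<Psi> = "krivine_norm M n \<phi>" and ?u = "krivine_norm N n x" and ?e = "\<Sum>i<n. \<bar>x i\<bar>"
  \<comment> \<open>The coefficient of \<epsilon>: the sum is the cost of replacing each
    \<open>x i\<close> by its approximation, the last term that of replacing
    \<open>?u\<close>.\<close>
  define C where "C = (\<Sum>i<n. blinfun_apply \<bar>\<phi> i\<bar> ?e) + blinfun_apply ?\<Psi> ?e"
  have C: "0 \<le> C"
    unfolding C_def
    by (intro add_nonneg_nonneg sum_nonneg)
      (use blinfun_apply_mono_left [OF abs_ge_zero, of ?e] blinfun_apply_mono_left [OF dual.krivine_norm_nonneg, of ?e]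
        in \<open>simp_all add: sum_nonneg\<close>)
  have main: "(\<Sum>i<n. blinfun_apply (\<phi> i) (x i)) \<le> blinfun_apply ?\<Psi> ?u + \<epsilon> * C" if \<epsilon>: "0 < \<epsilon>" for \<epsilon>
  proof -
    \<comment> \<open>The coordinates and the norm have to be approximated with the same partition,
      so that the two resulting sums can be compared term by term.\<close>
    let ?F = "insert (on_tuples n N) ((\<lambda>i. on_tuples n (\<lambda>t. t i)) ` {..<n})"
    have F: "finite ?F" "?F \<subseteq> hom_funs n"
      by (auto simp: hom coordinate_conv_lin_form hom_funs_lin_form)
    obtain A g w where A: "finite A" "A \<subseteq> l1_sphere n"
      and g: "\<And>s. s \<in> A \<Longrightarrow> lat_lin n x (g s) (w s)" "\<And>s t. s \<in> A \<Longrightarrow> 0 \<le> g s t"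
      and "\<And>t. t \<in> tuples n \<Longrightarrow> (\<Sum>s\<in>A. g s t) = l1_fun n t"
      and approx: "\<And>f t. f \<in> ?F \<Longrightarrow> t \<in> tuples n \<Longrightarrow> \<bar>f t - (\<Sum>s\<in>A. f s * g s t)\<bar> \<le> \<epsilon> * l1_fun n t"
      by (rule partition_of_l1_fun [OF F \<epsilon>, where x = x]) blast
    have At: "s \<in> tuples n" if "s \<in> A" for s using that A(2) by (auto simp: l1_sphere_def)
    have w: "0 \<le> w s" if "s \<in> A" for s
      by (rule lat_lin_nonneg [OF g(1) [OF that]]) (rule g(2) [OF that])
    have x: "\<bar>x i - (\<Sum>s\<in>A. s i *\<^sub>R w s)\<bar> \<le> \<epsilon> *\<^sub>R ?e" if i: "i < n" for i
    proof (rule lat_lin_abs_diff_le [OF lat_lin_coordinate [OF i] lat_lin_sum])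
      show "lat_lin n x (\<lambda>t. s i * g s t) (s i *\<^sub>R w s)" if "s \<in> A" for s
        by (rule lat_lin_scale [OF g(1) [OF that]])
      fix t assume t: "t \<in> tuples n"
      have "(\<Sum>s\<in>A. on_tuples n (\<lambda>t. t i) s * g s t) = (\<Sum>s\<in>A. s i * g s t)"
        by (intro sum.cong) (auto simp: on_tuples_def At)
      then show "\<bar>on_tuples n (\<lambda>t. t i) t - (\<Sum>s\<in>A. s i * g s t)\<bar> \<le> \<epsilon> * l1_fun n t"
        using approx [of "on_tuples n (\<lambda>t. t i)" t] i t by simp
    qed
    have lin: "lat_lin n x (\<lambda>t. \<Sum>s\<in>A. N s * g s t) (\<Sum>s\<in>A. N s *\<^sub>R w s)"
      by (intro lat_lin_sum lat_lin_scale g(1))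
    have "\<bar>krivine_calculus n x (on_tuples n N) - krivine_calculus n x (\<lambda>t. \<Sum>s\<in>A. N s * g s t)\<bar> \<le> \<epsilon> *\<^sub>R ?e"
    proof (rule krivine_abs_diff_le [OF hom(1) hom_funs_lat_lin [OF lin]])
      fix t assume t: "t \<in> tuples n"
      have "(\<Sum>s\<in>A. on_tuples n N s * g s t) = (\<Sum>s\<in>A. N s * g s t)"
        by (intro sum.cong) (auto simp: on_tuples_def At)
      then show "\<bar>on_tuples n N t - (\<Sum>s\<in>A. N s * g s t)\<bar> \<le> \<epsilon> * l1_fun n t"
        using approx [of "on_tuples n N" t] t by simp
    qed
    then have "\<bar>?u - (\<Sum>s\<in>A. N s *\<^sub>R w s)\<bar> \<le> \<epsilon> *\<^sub>R ?e"
      by (simp only: krivine_norm_def krivine_lat_lin [OF lin])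
    then have "(\<Sum>s\<in>A. N s *\<^sub>R w s) \<le> ?u + \<epsilon> *\<^sub>R ?e"
      by (simp add: abs_le_iff diff_le_eq add.commute)
    from blinfun_apply_mono_right [OF dual.krivine_norm_nonneg [of n \<phi>] this]
    have 1: "(\<Sum>s\<in>A. N s * blinfun_apply ?\<Psi> (w s)) \<le> blinfun_apply ?\<Psi> ?u + \<epsilon> * blinfun_apply ?\<Psi> ?e"
      by (simp add: blinfun.sum_right blinfun.add_right blinfun.scaleR_right)
    have "(\<Sum>i<n. s i * blinfun_apply (\<phi> i) (w s)) \<le> N s * blinfun_apply ?\<Psi> (w s)" if s: "s \<in> A" for s
      using blinfun_apply_mono_left [OF dual.lin_comb_le_krivine_norm [OF At [OF s], of \<phi>] w [OF s]]
      by (simp add: blinfun.sum_left blinfun.scaleR_left)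
    then have "(\<Sum>s\<in>A. \<Sum>i<n. s i * blinfun_apply (\<phi> i) (w s)) \<le> (\<Sum>s\<in>A. N s * blinfun_apply ?\<Psi> (w s))"
      by (rule sum_mono)
    then have 2: "(\<Sum>i<n. blinfun_apply (\<phi> i) (\<Sum>s\<in>A. s i *\<^sub>R w s)) \<le> (\<Sum>s\<in>A. N s * blinfun_apply ?\<Psi> (w s))"
      unfolding blinfun.sum_right blinfun.scaleR_right real_scaleR_def by (subst sum.swap)
    have "(\<Sum>i<n. blinfun_apply (\<phi> i) (x i)) - (\<Sum>i<n. blinfun_apply (\<phi> i) (\<Sum>s\<in>A. s i *\<^sub>R w s))
        = (\<Sum>i<n. blinfun_apply (\<phi> i) (x i - (\<Sum>s\<in>A. s i *\<^sub>R w s)))"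
      by (simp add: blinfun.diff_right sum_subtractf)
    also have "\<dots> \<le> (\<Sum>i<n. \<epsilon> * blinfun_apply \<bar>\<phi> i\<bar> ?e)"
      by (intro sum_mono) (use abs_blinfun_le [OF x] in \<open>simp add: abs_le_iff\<close>)
    finally show ?thesis using 1 2 by (simp add: C_def distrib_left sum_distrib_left)
  qed
  show ?thesis
  proof (rule field_le_epsilon)
    fix d :: real assume d: "0 < d"
    have "d / (C + 1) * C \<le> d" using d C by (simp add: field_simps)
    then show "(\<Sum>i<n. blinfun_apply (\<phi> i) (x i)) \<le> blinfun_apply ?\<Psi> ?u + d"
      using main [of "d / (C + 1)"] d C by (simp add: divide_pos_pos)
  qed
qed

lemma abs_sum_apply_le:
  fixes \<phi> :: "nat \<Rightarrow> 'a::banach_lattice \<Rightarrow>\<^sub>L real"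
  shows "\<bar>\<Sum>i<n. blinfun_apply (\<phi> i) (x i)\<bar> \<le> tuple_norm M n \<phi> * tuple_norm N n x"
proof -
  have *: "(\<Sum>i<n. blinfun_apply (\<phi> i) (x i)) \<le> tuple_norm M n \<phi> * tuple_norm N n x" for x :: "nat \<Rightarrow> 'a"
    unfolding tuple_norm_conv_krivine_norm
    using sum_apply_le_krivine_norm [of \<phi> x n] norm_blinfun [of "krivine_norm M n \<phi>" "krivine_norm N n x"]
    by simp
  have "norm (krivine_norm N n (\<lambda>i. (-1) *\<^sub>R x i)) \<le> norm (\<bar>-1\<bar> *\<^sub>R krivine_norm N n x)"
    by (rule norm_mono_nonneg [OF krivine_norm_nonneg krivine_norm_scale])
  then have "tuple_norm M n \<phi> * tuple_norm N n (\<lambda>i. - x i) \<le> tuple_norm M n \<phi> * tuple_norm N n x"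
    by (intro mult_left_mono) (simp_all add: tuple_norm_conv_krivine_norm)
  with * [of x] * [of "\<lambda>i. - x i"] show ?thesis
    by (simp add: abs_le_iff blinfun.minus_right sum_negf)
qed

text \<open>The hypothesis concerns tuples with zero tail because these are the finitely supported
  sequences, to which a functional on the sequence space can be applied.\<close>

lemma tuple_norm_dual_le:
  fixes \<phi> :: "nat \<Rightarrow> 'a::banach_lattice \<Rightarrow>\<^sub>L real"
  assumes bound: "\<And>x. (\<And>i. n \<le> i \<Longrightarrow> x i = 0) \<Longrightarrow> (\<Sum>i<n. blinfun_apply (\<phi> i) (x i)) \<le> C * tuple_norm N n x"
    and C: "0 \<le> C"
  shows "tuple_norm M n \<phi> \<le> C"
proof -
  let ?\<Psi> = "krivine_norm M n \<phi>"
  \<comment> \<open>Positive \<open>u\<close> suffice: \<open>?\<Psi>\<close> is a positive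
    functional, so its value at \<open>v\<close> is dominated by that at \<bar>v\<bar>.\<close>
  have le: "blinfun_apply ?\<Psi> u \<le> C * norm u" if u: "0 \<le> u" for u
  proof -
    let ?E = "blinfun_apply (\<Sum>i<n. \<bar>\<phi> i\<bar>) u"
    have E: "0 \<le> ?E"
      using blinfun_apply_mono_left [OF sum_nonneg [of "{..<n}" "\<lambda>i. \<bar>\<phi> i\<bar>"] u] by simp
    have main: "blinfun_apply ?\<Psi> u \<le> C * norm u + \<epsilon> * ?E" if "0 < \<epsilon>" for \<epsilon>
    proof -
      from dual.ex_finite_norming_set [OF that, of n] obtain B where B: "finite B" "B \<noteq> {}"
        "\<forall>b\<in>B. b \<in> tuples n \<and> N b \<le> 1" "\<forall>u\<in>l1_sphere n. \<exists>b\<in>B. M u \<le> (\<Sum>i<n. b i * u i) + \<epsilon>"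
        by (elim exE conjE)
      from ex_upper_bound_Riesz_Kantorovich [OF B(1,2), of "\<lambda>t. \<Sum>i<n. t i *\<^sub>R \<phi> i"]
      obtain W where ub: "\<forall>t\<in>B. (\<Sum>i<n. t i *\<^sub>R \<phi> i) \<le> W"
        and W: "\<forall>u\<ge>0. \<forall>c. (\<forall>v. (\<forall>t\<in>B. 0 \<le> v t) \<and> sum v B = u \<longrightarrow>
          (\<Sum>t\<in>B. blinfun_apply (\<Sum>i<n. t i *\<^sub>R \<phi> i) (v t)) \<le> c) \<longrightarrow> blinfun_apply W u \<le> c"
        by (elim exE conjE)
      have "blinfun_apply W u \<le> C * norm u"
      proof (rule W [rule_format, OF u])
        fix v assume v: "(\<forall>t\<in>B. 0 \<le> v t) \<and> sum v B = u"
        define x where "x i = (\<Sum>t\<in>B. t i *\<^sub>R v t)" for i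
        have "krivine_norm N n x \<le> u"
        proof (rule krivine_norm_least)
          fix b assume b: "b \<in> tuples n" "M b \<le> 1"
          have "(\<Sum>i<n. b i * t i) \<le> 1" if "t \<in> B" for t
          proof -
            have t: "t \<in> tuples n" "N t \<le> 1" using that B(3) by auto
            have "M b * N t \<le> 1" using mult_mono [OF b(2) t(2)] nonneg t(1) by simp
            then show ?thesis using pairing [OF b(1) t(1)] by linarith
          qed
          then have "(\<Sum>t\<in>B. (\<Sum>i<n. b i * t i) *\<^sub>R v t) \<le> (\<Sum>t\<in>B. 1 *\<^sub>R v t)"
            using v by (intro sum_mono scaleR_right_mono) auto
          moreover have "(\<Sum>i<n. b i *\<^sub>R x i) = (\<Sum>t\<in>B. (\<Sum>i<n. b i * t i) *\<^sub>R v t)"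
            unfolding x_def scaleR_sum_right scaleR_sum_left scaleR_scaleR by (rule sum.swap)
          ultimately show "(\<Sum>i<n. b i *\<^sub>R x i) \<le> u" using v by simp
        qed
        then have *: "tuple_norm N n x \<le> norm u"
          unfolding tuple_norm_conv_krivine_norm by (rule norm_mono_nonneg [OF krivine_norm_nonneg])
        have "x i = 0" if "n \<le> i" for i
          using B(3) that by (auto simp: x_def tuples_iff intro!: sum.neutral)
        then have "(\<Sum>i<n. blinfun_apply (\<phi> i) (x i)) \<le> C * tuple_norm N n x" by (rule bound)
        also have "\<dots> \<le> C * norm u" by (rule mult_left_mono [OF * C])
        also have "(\<Sum>i<n. blinfun_apply (\<phi> i) (x i)) = (\<Sum>t\<in>B. blinfun_apply (\<Sum>i<n. t i *\<^sub>R \<phi> i) (v t))"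
          unfolding x_def blinfun.sum_right blinfun.sum_left blinfun.scaleR_left blinfun.scaleR_right by (rule sum.swap)
        finally show "(\<Sum>t\<in>B. blinfun_apply (\<Sum>i<n. t i *\<^sub>R \<phi> i) (v t)) \<le> C * norm u" .
      qed
      moreover have "?\<Psi> \<le> W + \<epsilon> *\<^sub>R (\<Sum>i<n. \<bar>\<phi> i\<bar>)"
        by (rule dual.krivine_norm_le_if_norming_set [OF B(1,2)]) (use B(4) ub in auto)
      from blinfun_apply_mono_left [OF this u]
      have "blinfun_apply ?\<Psi> u \<le> blinfun_apply W u + \<epsilon> * ?E"
        by (simp add: blinfun.add_left blinfun.scaleR_left)
      ultimately show ?thesis by linarith
    qed
    show ?thesis
    proof (rule field_le_epsilon)
      fix d :: real assume d: "0 < d"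
      have "d / (?E + 1) * ?E \<le> d" using d E by (simp add: field_simps)
      then show "blinfun_apply ?\<Psi> u \<le> C * norm u + d"
        using main [of "d / (?E + 1)"] d E by (simp add: divide_pos_pos)
    qed
  qed
  show ?thesis
    unfolding tuple_norm_conv_krivine_norm
  proof (rule norm_blinfun_bound [OF C])
    fix v
    have "\<bar>blinfun_apply ?\<Psi> v\<bar> \<le> blinfun_apply ?\<Psi> \<bar>v\<bar>"
      using abs_blinfun_apply_le [of ?\<Psi> v] by (simp add: abs_of_nonneg dual.krivine_norm_nonneg)
    also have "\<dots> \<le> C * norm v" using le [of "\<bar>v\<bar>"] by simp
    finally show "norm (blinfun_apply ?\<Psi> v) \<le> C * norm v" by simp
  qed
qed

end

section \<open>The norms of a Banach sequence lattice and of its Koethe dual\<close>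

text \<open>The bound is one-sided, but exchanging \<open>s\<close> and \<open>t\<close> makes it a
  Lipschitz estimate in a weighted sum of coordinate differences, which is continuous in the product
  topology.\<close>

lemma continuous_on_tuples_if_l1_bound:
  assumes bound: "\<And>s t. s \<in> tuples n \<Longrightarrow> t \<in> tuples n \<Longrightarrow> f t \<le> f s + (\<Sum>i<n. \<bar>t i - s i\<bar> * c i)"
  shows "continuous_on (tuples n) f"
  unfolding continuous_on_def
proof
  fix s assume s: "s \<in> tuples n"
  let ?g = "\<lambda>t. \<Sum>i<n. \<bar>t i - s i\<bar> * c i"
  have "continuous_on (tuples n) ?g"
    by (intro continuous_intros continuous_on_subset [OF continuous_on_product_coordinates]) auto
  then have "(?g \<longlongrightarrow> ?g s) (at s within tuples n)"
    using s unfolding continuous_on_def by blast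
  then have g0: "(?g \<longlongrightarrow> 0) (at s within tuples n)" by simp
  have ev: "\<forall>\<^sub>F t in at s within tuples n. t \<in> tuples n"
    by (simp add: eventually_at_topological) (use open_UNIV in blast)
  have "((\<lambda>t. f t - f s) \<longlongrightarrow> 0) (at s within tuples n)"
  proof (rule Lim_null_comparison [OF _ g0])
    show "\<forall>\<^sub>F t in at s within tuples n. norm (f t - f s) \<le> ?g t"
      using ev
    proof eventually_elim
      case (elim t)
      show ?case
        using bound [OF s elim] bound [OF elim s] by (simp add: abs_minus_commute abs_le_iff)
    qed
  qed
  then show "(f \<longlongrightarrow> f s) (at s within tuples n)" by (rule LIM_zero_cancel)
qed

lemma on_tuples_in_hom_funs:
  assumes "\<And>s t. s \<in> tuples n \<Longrightarrow> t \<in> tuples n \<Longrightarrow> f t \<le> f s + (\<Sum>i<n. \<bar>t i - s i\<bar> * c i)"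
    and scale: "\<And>t c. t \<in> tuples n \<Longrightarrow> 0 \<le> c \<Longrightarrow> f (\<lambda>i. c * t i) = c * f t"
  shows "on_tuples n f \<in> hom_funs n"
proof -
  have "continuous_on (tuples n) f" by (rule continuous_on_tuples_if_l1_bound) (rule assms(1))
  then have "continuous_on (tuples n) (on_tuples n f)"
    by (rule continuous_on_eq) (simp add: on_tuples_def)
  then show ?thesis
    by (simp add: hom_funs_iff on_tuples_def tuples_scale scale)
qed

context
  fixes Y :: "(nat \<Rightarrow> real) set" and N :: "(nat \<Rightarrow> real) \<Rightarrow> real"
  assumes Y: "banach_sequence_lattice Y N"
begin

lemma sequence_lattice_add: "f \<in> Y \<Longrightarrow> g \<in> Y \<Longrightarrow> (\<lambda>i. f i + g i) \<in> Y"
  and sequence_lattice_scale: "f \<in> Y \<Longrightarrow> (\<lambda>i. c * f i) \<in> Y"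
  and sequence_lattice_zero: "(\<lambda>i. 0) \<in> Y"
  and sequence_lattice_norm_nonneg: "f \<in> Y \<Longrightarrow> 0 \<le> N f"
  and sequence_lattice_norm_eq_0: "f \<in> Y \<Longrightarrow> N f = 0 \<longleftrightarrow> f = (\<lambda>i. 0)"
  and sequence_lattice_norm_add: "f \<in> Y \<Longrightarrow> g \<in> Y \<Longrightarrow> N (\<lambda>i. f i + g i) \<le> N f + N g"
  and sequence_lattice_norm_scale: "f \<in> Y \<Longrightarrow> N (\<lambda>i. c * f i) = \<bar>c\<bar> * N f"
  and sequence_lattice_unit_tuple: "unit_tuple j \<in> Y"
  and sequence_lattice_norm_mono: "g \<in> Y \<Longrightarrow> (\<And>i. \<bar>f i\<bar> \<le> \<bar>g i\<bar>) \<Longrightarrow> N f \<le> N g"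
  using Y unfolding banach_sequence_lattice_def normed_fun_space_def unit_tuple_def real_scaleR_def
  by (simp_all)

lemma norm_unit_tuple_pos: "0 < N (unit_tuple j)"
proof -
  have "unit_tuple j \<noteq> (\<lambda>i. 0)" by (auto simp: unit_tuple_def fun_eq_iff)
  then show ?thesis
    using sequence_lattice_norm_nonneg [OF sequence_lattice_unit_tuple, of j]
      sequence_lattice_norm_eq_0 [OF sequence_lattice_unit_tuple, of j] by linarith
qed

text \<open>Tuples are sums of multiples of the canonical sequences, split off one at a time. The
  bound is what makes the norm continuous on tuples.\<close>

lemma tuples_in_sequence_lattice:
  "t \<in> tuples n \<Longrightarrow> t \<in> Y \<and> N t \<le> (\<Sum>i<n. \<bar>t i\<bar> * N (unit_tuple i))"
proof (induction n arbitrary: t)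
  case 0
  then have "t = (\<lambda>i. 0)" by (simp add: tuples_iff fun_eq_iff)
  then show ?case using sequence_lattice_zero sequence_lattice_norm_eq_0 [OF sequence_lattice_zero] by simp
next
  case (Suc n)
  let ?s = "trunc_seq n t" and ?u = "\<lambda>i. t n * unit_tuple n i"
  have t: "t = (\<lambda>i. ?s i + ?u i)"
    using Suc.prems by (auto simp: fun_eq_iff tuples_iff trunc_seq_def unit_tuple_def not_less le_Suc_eq Suc_le_eq)
  have s: "?s \<in> Y" "N ?s \<le> (\<Sum>i<n. \<bar>?s i\<bar> * N (unit_tuple i))"
    using Suc.IH [OF trunc_seq_in_tuples] by blast+
  have u: "?u \<in> Y" "N ?u = \<bar>t n\<bar> * N (unit_tuple n)"
    by (rule sequence_lattice_scale sequence_lattice_norm_scale; rule sequence_lattice_unit_tuple)+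
  have "(\<lambda>i. ?s i + ?u i) \<in> Y" by (rule sequence_lattice_add [OF s(1) u(1)])
  moreover have "N (\<lambda>i. ?s i + ?u i) \<le> N ?s + N ?u" by (rule sequence_lattice_norm_add [OF s(1) u(1)])
  moreover have "(\<Sum>i<n. \<bar>?s i\<bar> * N (unit_tuple i)) = (\<Sum>i<n. \<bar>t i\<bar> * N (unit_tuple i))"
    by (simp add: trunc_seq_def)
  ultimately show ?case using s(2) u(2) unfolding t [symmetric] by simp
qed

lemma norm_hom_funs: "on_tuples n N \<in> hom_funs n"
proof (rule on_tuples_in_hom_funs)
  show "N (\<lambda>i. c * t i) = c * N t" if "t \<in> tuples n" "0 \<le> c" for t c
    using sequence_lattice_norm_scale [of t c] tuples_in_sequence_lattice that by simp
  fix s t assume st: "s \<in> tuples n" "t \<in> tuples n"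
  then have d: "(\<lambda>i. t i - s i) \<in> tuples n" by (simp add: tuples_iff)
  have "N (\<lambda>i. s i + (t i - s i)) \<le> N s + N (\<lambda>i. t i - s i)"
    using tuples_in_sequence_lattice st(1) d by (intro sequence_lattice_norm_add) blast+
  then show "N t \<le> N s + (\<Sum>i<n. \<bar>t i - s i\<bar> * N (unit_tuple i))"
    using tuples_in_sequence_lattice [OF d] by simp
qed

text \<open>A single entry of \<alpha> is dominated by \<alpha> itself, so the lattice norm controls
  coordinates. This makes the supremum in \<open>kothe_norm\<close> finite on tuples and the norm
  balls of tuples bounded.\<close>

lemma abs_entry_times_norm_le:
  assumes \<alpha>: "\<alpha> \<in> Y"
  shows "\<bar>\<alpha> j\<bar> * N (unit_tuple j) \<le> N \<alpha>"
proof -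
  have "N (\<lambda>i. \<alpha> j * unit_tuple j i) \<le> N \<alpha>"
    by (rule sequence_lattice_norm_mono [OF \<alpha>]) (simp add: unit_tuple_def)
  then show ?thesis by (simp add: sequence_lattice_norm_scale [OF sequence_lattice_unit_tuple])
qed

lemma abs_entry_le_inverse_norm:
  assumes "\<alpha> \<in> Y" "N \<alpha> \<le> 1"
  shows "\<bar>\<alpha> j\<bar> \<le> inverse (N (unit_tuple j))"
  using order_trans [OF abs_entry_times_norm_le [OF assms(1), of j] assms(2)] norm_unit_tuple_pos [of j]
  by (simp add: field_simps)

lemma kothe_norm_tuple:
  assumes "b \<in> tuples n"
  shows "kothe_norm Y N b = (SUP \<alpha>\<in>{\<alpha> \<in> Y. N \<alpha> \<le> 1}. \<Sum>i<n. \<bar>\<alpha> i * b i\<bar>)"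
proof -
  have "(\<Sum>i. \<bar>\<alpha> i * b i\<bar>) = (\<Sum>i<n. \<bar>\<alpha> i * b i\<bar>)" for \<alpha>
    by (rule suminf_finite) (use assms in \<open>auto simp: tuples_iff not_less\<close>)
  then show ?thesis by (simp add: kothe_norm_def)
qed

lemma kothe_norm_upper:
  assumes b: "b \<in> tuples n" and \<alpha>: "\<alpha> \<in> Y" "N \<alpha> \<le> 1"
  shows "(\<Sum>i<n. \<bar>\<alpha> i * b i\<bar>) \<le> kothe_norm Y N b"
  unfolding kothe_norm_tuple [OF b]
proof (rule cSUP_upper)
  show "bdd_above ((\<lambda>\<alpha>. \<Sum>i<n. \<bar>\<alpha> i * b i\<bar>) ` {\<alpha> \<in> Y. N \<alpha> \<le> 1})"
  proof (rule bdd_aboveI2)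
    fix \<alpha> assume "\<alpha> \<in> {\<alpha> \<in> Y. N \<alpha> \<le> 1}"
    then show "(\<Sum>i<n. \<bar>\<alpha> i * b i\<bar>) \<le> (\<Sum>i<n. inverse (N (unit_tuple i)) * \<bar>b i\<bar>)"
      unfolding abs_mult by (intro sum_mono mult_right_mono abs_entry_le_inverse_norm) auto
  qed
qed (use \<alpha> in simp)

lemma kothe_norm_least:
  assumes b: "b \<in> tuples n" and le: "\<And>\<alpha>. \<alpha> \<in> Y \<Longrightarrow> N \<alpha> \<le> 1 \<Longrightarrow> (\<Sum>i<n. \<bar>\<alpha> i * b i\<bar>) \<le> c"
  shows "kothe_norm Y N b \<le> c"
  unfolding kothe_norm_tuple [OF b]
proof (rule cSUP_least)
  show "{\<alpha> \<in> Y. N \<alpha> \<le> 1} \<noteq> {}"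
    using sequence_lattice_zero sequence_lattice_norm_eq_0 [OF sequence_lattice_zero] by (auto intro!: exI [of _ "\<lambda>i. 0"])
qed (use le in auto)

lemma kothe_norm_nonneg: "b \<in> tuples n \<Longrightarrow> 0 \<le> kothe_norm Y N b"
  using kothe_norm_upper [of b n "\<lambda>i. 0"] sequence_lattice_zero sequence_lattice_norm_eq_0 [OF sequence_lattice_zero]
  by simp

lemma kothe_norm_scale:
  assumes b: "b \<in> tuples n" and c: "0 \<le> c"
  shows "kothe_norm Y N (\<lambda>i. c * b i) = c * kothe_norm Y N b"
proof -
  have le: "kothe_norm Y N (\<lambda>i. c * b i) \<le> c * kothe_norm Y N b" if b: "b \<in> tuples n" and c: "0 \<le> c" for b c
  proof (rule kothe_norm_least [OF tuples_scale [OF b]])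
    fix \<alpha> assume \<alpha>: "\<alpha> \<in> Y" "N \<alpha> \<le> 1"
    have "(\<Sum>i<n. \<bar>\<alpha> i * (c * b i)\<bar>) = c * (\<Sum>i<n. \<bar>\<alpha> i * b i\<bar>)"
      using c by (simp add: sum_distrib_left abs_mult mult.left_commute)
    also have "\<dots> \<le> c * kothe_norm Y N b"
      by (intro mult_left_mono kothe_norm_upper b \<alpha> c)
    finally show "(\<Sum>i<n. \<bar>\<alpha> i * (c * b i)\<bar>) \<le> c * kothe_norm Y N b" .
  qed
  show ?thesis
  proof (cases "c = 0")
    case True
    then show ?thesis using le [OF b c] kothe_norm_nonneg [OF tuples_zero] by simp
  next
    case False
    with c have c: "0 < c" by simp
    have "kothe_norm Y N (\<lambda>i. inverse c * (c * b i)) \<le> inverse c * kothe_norm Y N (\<lambda>i. c * b i)"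
      using c by (intro le tuples_scale b) simp
    then have "c * kothe_norm Y N b \<le> c * (inverse c * kothe_norm Y N (\<lambda>i. c * b i))"
      using c by (intro mult_left_mono) (simp_all add: mult.assoc [symmetric])
    then show ?thesis using le [OF b, of c] c by (simp add: mult.assoc [symmetric])
  qed
qed

lemma kothe_norm_hom_funs: "on_tuples n (kothe_norm Y N) \<in> hom_funs n"
proof (rule on_tuples_in_hom_funs)
  fix s t assume st: "s \<in> tuples n" "t \<in> tuples n"
  show "kothe_norm Y N t \<le> kothe_norm Y N s + (\<Sum>i<n. \<bar>t i - s i\<bar> * inverse (N (unit_tuple i)))"
  proof (rule kothe_norm_least [OF st(2)])
    fix \<alpha> assume \<alpha>: "\<alpha> \<in> Y" "N \<alpha> \<le> 1"
    have "\<bar>\<alpha> i * t i\<bar> \<le> \<bar>\<alpha> i * s i\<bar> + \<bar>t i - s i\<bar> * inverse (N (unit_tuple i))" for i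
    proof -
      have "\<bar>\<alpha> i * t i\<bar> \<le> \<bar>\<alpha> i * s i\<bar> + \<bar>\<alpha> i * (t i - s i)\<bar>"
        using abs_triangle_ineq [of "\<alpha> i * s i" "\<alpha> i * (t i - s i)"] by (simp add: algebra_simps)
      moreover have "\<bar>\<alpha> i * (t i - s i)\<bar> \<le> \<bar>t i - s i\<bar> * inverse (N (unit_tuple i))"
        unfolding abs_mult mult.commute [of "\<bar>\<alpha> i\<bar>"]
        by (rule mult_left_mono [OF abs_entry_le_inverse_norm [OF \<alpha>] abs_ge_zero])
      ultimately show ?thesis by linarith
    qed
    then have "(\<Sum>i<n. \<bar>\<alpha> i * t i\<bar>) \<le> (\<Sum>i<n. \<bar>\<alpha> i * s i\<bar> + \<bar>t i - s i\<bar> * inverse (N (unit_tuple i)))"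
      by (rule sum_mono)
    then show "(\<Sum>i<n. \<bar>\<alpha> i * t i\<bar>) \<le> kothe_norm Y N s + (\<Sum>i<n. \<bar>t i - s i\<bar> * inverse (N (unit_tuple i)))"
      using kothe_norm_upper [OF st(1) \<alpha>] by (simp add: sum.distrib)
  qed
qed (rule kothe_norm_scale)

lemma ex_tuple_aligned:
  assumes "\<alpha> \<in> Y"
  obtains t where "t \<in> tuples n" "N t \<le> N \<alpha>" "(\<Sum>i<n. b i * t i) = (\<Sum>i<n. \<bar>\<alpha> i * b i\<bar>)"
proof
  let ?t = "\<lambda>i. if i < n then sgn (b i) * \<bar>\<alpha> i\<bar> else 0"
  show "?t \<in> tuples n" by (simp add: tuples_iff)
  show "N ?t \<le> N \<alpha>" by (rule sequence_lattice_norm_mono [OF assms]) (simp add: abs_mult abs_sgn_eq)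
  show "(\<Sum>i<n. b i * ?t i) = (\<Sum>i<n. \<bar>\<alpha> i * b i\<bar>)"
    by (intro sum.cong) (auto simp: abs_mult mult.assoc [symmetric] mult_sgn_abs abs_sgn [symmetric] mult.commute)
qed

lemma pairing_le_kothe_norm:
  assumes b: "b \<in> tuples n" and t: "t \<in> tuples n"
  shows "(\<Sum>i<n. b i * t i) \<le> kothe_norm Y N b * N t"
proof -
  have tY: "t \<in> Y" using tuples_in_sequence_lattice [OF t] by blast
  show ?thesis
  proof (cases "N t = 0")
    case True
    then have "t = (\<lambda>i. 0)" using sequence_lattice_norm_eq_0 [OF tY] by blast
    then show ?thesis using True by simp
  next
    case False
    then have pos: "0 < N t" using sequence_lattice_norm_nonneg [OF tY] by linarith
    let ?\<alpha> = "\<lambda>i. inverse (N t) * t i"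
    have \<alpha>: "?\<alpha> \<in> Y" by (rule sequence_lattice_scale [OF tY])
    have "N ?\<alpha> \<le> 1" using pos by (simp add: sequence_lattice_norm_scale [OF tY])
    from kothe_norm_upper [OF b \<alpha> this]
    have "N t * (\<Sum>i<n. \<bar>?\<alpha> i * b i\<bar>) \<le> N t * kothe_norm Y N b"
      using pos by (intro mult_left_mono) auto
    moreover have "N t * (\<Sum>i<n. \<bar>?\<alpha> i * b i\<bar>) = (\<Sum>i<n. \<bar>b i * t i\<bar>)"
      unfolding sum_distrib_left using pos by (intro sum.cong) (auto simp: abs_mult)
    moreover have "(\<Sum>i<n. b i * t i) \<le> (\<Sum>i<n. \<bar>b i * t i\<bar>)" by (intro sum_mono abs_ge_self)
    ultimately show ?thesis by (simp add: mult.commute)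
  qed
qed

section \<open>Norming tuples by separation\<close>

lemma compact_norm_ball: "compact {s \<in> tuples n. N s \<le> c}"
proof -
  let ?S = "\<lambda>i. if i < n then {- (c / N (unit_tuple i))..c / N (unit_tuple i)} else {0}"
  let ?B = "{s. \<forall>i. s i \<in> ?S i}"
  have B: "compact ?B" by (rule compact_componentwise) simp
  have sub: "?B \<subseteq> tuples n"
  proof
    fix s assume "s \<in> ?B"
    then have "s i \<in> ?S i" for i by blast
    then show "s \<in> tuples n" by (metis not_less singletonD tuples_iff)
  qed
  have "continuous_on (tuples n) N"
    using hom_funs_continuous [OF norm_hom_funs] by (rule continuous_on_eq) (simp add: on_tuples_def)
  then have "closedin (top_of_set ?B) (?B \<inter> N -` {..c})"
    by (intro continuous_closedin_preimage continuous_on_subset [OF _ sub]) simp_all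
  then have "compact (?B \<inter> N -` {..c})" by (rule closedin_compact [OF B])
  moreover have "{s \<in> tuples n. N s \<le> c} = ?B \<inter> N -` {..c}"
  proof (intro equalityI subsetI)
    fix s assume s: "s \<in> {s \<in> tuples n. N s \<le> c}"
    then have sY: "s \<in> Y" using tuples_in_sequence_lattice by blast
    have "\<bar>s i\<bar> \<le> c / N (unit_tuple i)" for i
      using abs_entry_times_norm_le [OF sY, of i] s norm_unit_tuple_pos [of i] by (simp add: pos_le_divide_eq)
    then have "s i \<in> ?S i" for i using s by (auto simp: tuples_iff abs_le_iff minus_le_iff)
    then show "s \<in> ?B \<inter> N -` {..c}" using s by auto
  next
    fix s assume "s \<in> ?B \<inter> N -` {..c}"
    then show "s \<in> {s \<in> tuples n. N s \<le> c}" using sub by auto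
  qed
  ultimately show ?thesis by simp
qed

text \<open>
  The norming tuple is normal to the separating hyperplane through the point of the ball of radius
  \<open>c'\<close> nearest to \<open>t\<close>.
\<close>

lemma ex_norming_tuple:
  assumes t: "t \<in> tuples n" and c: "c < N t"
  shows "\<exists>b\<in>tuples n. kothe_norm Y N b \<le> 1 \<and> c < (\<Sum>i<n. b i * t i)"
proof (cases "c < 0")
  case True
  have "kothe_norm Y N (\<lambda>i. 0) \<le> 1" using kothe_norm_scale [OF tuples_zero, of 0] by simp
  then show ?thesis using True by (intro bexI [of _ "\<lambda>i. 0"]) simp_all
next
  case False
  \<comment> \<open>The norming tuple will pair with \<open>t\<close> to exactly \<open>c'\<close>,
    which must exceed \<open>c\<close>; the ball of radius \<open>c'\<close> must also miss
    \<open>t\<close>.\<close>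
  obtain c' where c': "c < c'" "c' < N t" using dense [OF c] by blast
  with False have pos: "0 < c'" by linarith
  \<comment> \<open>Translating by \<open>t\<close> turns the nearest point of the ball into the
    point of \<open>C\<close> of least Euclidean norm. It is not the origin, as \<open>t\<close>
    lies outside the ball.\<close>
  define C where "C = (\<lambda>s i. t i - s i) ` {s \<in> tuples n. N s \<le> c'}"
  have C: "d \<in> C \<longleftrightarrow> d \<in> tuples n \<and> N (\<lambda>i. t i - d i) \<le> c'" for d
  proof
    assume "d \<in> C"
    then show "d \<in> tuples n \<and> N (\<lambda>i. t i - d i) \<le> c'" using t by (auto simp: C_def tuples_iff)
  next
    assume d: "d \<in> tuples n \<and> N (\<lambda>i. t i - d i) \<le> c'"
    show "d \<in> C"
      unfolding C_def by (rule image_eqI [of _ _ "\<lambda>i. t i - d i"]) (use d t in \<open>auto simp: tuples_iff\<close>)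
  qed
  have tC: "t \<in> C"
    using t pos sequence_lattice_norm_eq_0 [OF sequence_lattice_zero] by (simp add: C)
  have comp: "compact C"
    unfolding C_def
  proof (rule compact_continuous_image [OF _ compact_norm_ball])
    show "continuous_on {s \<in> tuples n. N s \<le> c'} (\<lambda>s i. t i - s i)"
      by (intro continuous_on_coordinatewise_then_product continuous_intros
          continuous_on_subset [OF continuous_on_product_coordinates]) auto
  qed
  have ne: "C \<noteq> {}" using tC by blast
  have convex: "(\<lambda>i. (1 - r) * a i + r * b i) \<in> C" if a: "a \<in> C" and b: "b \<in> C" and r: "0 \<le> r" "r \<le> 1" for a b r
  proof -
    have ab: "(\<lambda>i. t i - a i) \<in> tuples n" "(\<lambda>i. t i - b i) \<in> tuples n"
      using a b t by (simp_all add: C tuples_iff)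
    then have abY: "(\<lambda>i. t i - a i) \<in> Y" "(\<lambda>i. t i - b i) \<in> Y"
      using tuples_in_sequence_lattice by blast+
    have "(\<lambda>i. t i - ((1 - r) * a i + r * b i)) = (\<lambda>i. (1 - r) * (t i - a i) + r * (t i - b i))"
      by (simp add: fun_eq_iff algebra_simps)
    then have "N (\<lambda>i. t i - ((1 - r) * a i + r * b i))
        \<le> N (\<lambda>i. (1 - r) * (t i - a i)) + N (\<lambda>i. r * (t i - b i))"
      using sequence_lattice_norm_add [OF sequence_lattice_scale [OF abY(1), of "1 - r"] sequence_lattice_scale [OF abY(2), of r]]
      by simp
    also have "\<dots> = (1 - r) * N (\<lambda>i. t i - a i) + r * N (\<lambda>i. t i - b i)"
      using r sequence_lattice_norm_scale [OF abY(1), of "1 - r"] sequence_lattice_norm_scale [OF abY(2), of r] by simp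
    also have "\<dots> \<le> (1 - r) * c' + r * c'"
      using a b r by (intro add_mono mult_left_mono) (simp_all add: C)
    finally have "N (\<lambda>i. t i - ((1 - r) * a i + r * b i)) \<le> c'" by (simp add: algebra_simps)
    then show ?thesis using a b by (simp add: C tuples_iff)
  qed
  have "\<exists>a\<in>C. \<forall>d\<in>C. (\<Sum>i<n. a i * a i) \<le> (\<Sum>i<n. a i * d i)"
    by (rule ex_min_norm_point [OF comp ne convex])
  then obtain a where a: "a \<in> C" and min: "\<forall>d\<in>C. (\<Sum>i<n. a i * a i) \<le> (\<Sum>i<n. a i * d i)"
    by (rule bexE)
  let ?aa = "\<Sum>i<n. a i * a i" and ?at = "\<Sum>i<n. a i * t i"
  have "?aa \<noteq> 0"
  proof
    assume "?aa = 0"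
    then have "\<forall>i\<in>{..<n}. a i * a i = 0" by (subst (asm) sum_nonneg_eq_0_iff) auto
    then have "a i = 0" for i
      using a by (cases "i < n") (auto simp: C tuples_iff)
    then have "N t \<le> c'" using a by (simp add: C)
    then show False using c'(2) by linarith
  qed
  moreover have "0 \<le> ?aa" by (intro sum_nonneg) simp
  ultimately have aa: "0 < ?aa" by linarith
  have at: "0 < ?at" using min tC aa by fastforce
  \<comment> \<open>By minimality \<open>a\<close> pairs with the ball of radius \<open>c'\<close>
    to at most \<open>?at\<close>; this scaling makes the bound on the unit ball equal to 1.\<close>
  let ?b = "\<lambda>i. c' / ?at * a i"
  have "(\<Sum>i<n. \<bar>\<alpha> i * ?b i\<bar>) \<le> 1" if \<alpha>: "\<alpha> \<in> Y" "N \<alpha> \<le> 1" for \<alpha>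
  proof -
    obtain s where s: "s \<in> tuples n" "N s \<le> N \<alpha>" "(\<Sum>i<n. ?b i * s i) = (\<Sum>i<n. \<bar>\<alpha> i * ?b i\<bar>)"
      by (rule ex_tuple_aligned [OF \<alpha>(1), of n ?b]) (rule that)
    have sY: "s \<in> Y" using tuples_in_sequence_lattice [OF s(1)] by blast
    let ?d = "\<lambda>i. t i - c' * s i"
    have "N (\<lambda>i. c' * s i) \<le> c'"
      using s(2) \<alpha>(2) pos by (simp add: sequence_lattice_norm_scale [OF sY])
    then have "?d \<in> C" using t s(1) by (simp add: C tuples_iff)
    then have "?aa \<le> (\<Sum>i<n. a i * ?d i)" by (rule bspec [OF min])
    also have "\<dots> = ?at - c' * (\<Sum>i<n. a i * s i)"
      by (simp add: right_diff_distrib sum_subtractf sum_distrib_left mult.left_commute)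
    finally have "c' * (\<Sum>i<n. a i * s i) \<le> ?at" using aa by linarith
    then have "c' * (\<Sum>i<n. a i * s i) / ?at \<le> 1" using at by simp
    moreover have "(\<Sum>i<n. ?b i * s i) = c' * (\<Sum>i<n. a i * s i) / ?at"
      by (simp add: sum_distrib_left sum_divide_distrib mult.assoc)
    ultimately show ?thesis using s(3) by simp
  qed
  moreover have b: "?b \<in> tuples n" using a by (intro tuples_scale) (simp add: C)
  ultimately have "kothe_norm Y N ?b \<le> 1" by (intro kothe_norm_least [OF b])
  moreover have "(\<Sum>i<n. ?b i * t i) = c'"
  proof -
    have "(\<Sum>i<n. ?b i * t i) = c' / ?at * ?at" unfolding sum_distrib_left mult.assoc ..
    then show ?thesis using at by simp
  qed
  ultimately show ?thesis using b c'(1) by (intro bexI [of _ ?b]) simp_all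
qed

theorem tuple_norm_pair_kothe_norm: "tuple_norm_pair N (kothe_norm Y N)"
proof
  fix n :: nat and t b :: "nat \<Rightarrow> real" and c :: real
  show "on_tuples n N \<in> hom_funs n" by (rule norm_hom_funs)
  show "on_tuples n (kothe_norm Y N) \<in> hom_funs n" by (rule kothe_norm_hom_funs)
  show "t \<in> tuples n \<Longrightarrow> 0 \<le> N t" using tuples_in_sequence_lattice sequence_lattice_norm_nonneg by blast
  show "t \<in> tuples n \<Longrightarrow> 0 \<le> kothe_norm Y N t" by (rule kothe_norm_nonneg)
  show "t \<in> tuples n \<Longrightarrow> N (\<lambda>i. - t i) = N t"
    using sequence_lattice_norm_scale [of t "-1"] tuples_in_sequence_lattice by simp
  show "t \<in> tuples n \<Longrightarrow> kothe_norm Y N (\<lambda>i. - t i) = kothe_norm Y N t" by (simp add: kothe_norm_def)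
  show "b \<in> tuples n \<Longrightarrow> t \<in> tuples n \<Longrightarrow> (\<Sum>i<n. b i * t i) \<le> kothe_norm Y N b * N t"
    by (rule pairing_le_kothe_norm)
  show "t \<in> tuples n \<Longrightarrow> c < N t \<Longrightarrow> \<exists>b\<in>tuples n. kothe_norm Y N b \<le> 1 \<and> c < (\<Sum>i<n. b i * t i)"
    by (rule ex_norming_tuple)
  assume b: "b \<in> tuples n" and c: "c < kothe_norm Y N b"
  show "\<exists>t\<in>tuples n. N t \<le> 1 \<and> c < (\<Sum>i<n. b i * t i)"
  proof (rule ccontr)
    assume neg: "\<not> ?thesis"
    have "kothe_norm Y N b \<le> c"
    proof (rule kothe_norm_least [OF b])
      fix \<alpha> assume \<alpha>: "\<alpha> \<in> Y" "N \<alpha> \<le> 1"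
      obtain s where s: "s \<in> tuples n" "N s \<le> N \<alpha>" "(\<Sum>i<n. b i * s i) = (\<Sum>i<n. \<bar>\<alpha> i * b i\<bar>)"
        by (rule ex_tuple_aligned [OF \<alpha>(1), of n b]) (rule that)
      then show "(\<Sum>i<n. \<bar>\<alpha> i * b i\<bar>) \<le> c" using neg \<alpha>(2) by (metis not_less order_trans)
    qed
    with c show False by simp
  qed
qed

end

section \<open>Normed function spaces and their duals\<close>

lemma
  assumes "normed_fun_space V N"
  shows normed_fun_space_zero: "(\<lambda>i. 0) \<in> V"
    and normed_fun_space_add: "f \<in> V \<Longrightarrow> g \<in> V \<Longrightarrow> (\<lambda>i. f i + g i) \<in> V"
    and normed_fun_space_scale: "f \<in> V \<Longrightarrow> (\<lambda>i. c *\<^sub>R f i) \<in> V"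
    and normed_fun_space_norm_nonneg: "f \<in> V \<Longrightarrow> 0 \<le> N f"
    and normed_fun_space_norm_eq_0: "f \<in> V \<Longrightarrow> N f = 0 \<longleftrightarrow> f = (\<lambda>i. 0)"
    and normed_fun_space_norm_add: "f \<in> V \<Longrightarrow> g \<in> V \<Longrightarrow> N (\<lambda>i. f i + g i) \<le> N f + N g"
    and normed_fun_space_norm_scale: "f \<in> V \<Longrightarrow> N (\<lambda>i. c *\<^sub>R f i) = \<bar>c\<bar> * N f"
  using assms unfolding normed_fun_space_def by simp_all

lemma
  assumes V: "normed_fun_space V N" and f: "f \<in> V" and g: "g \<in> V"
  shows normed_fun_space_diff: "(\<lambda>i. f i - g i) \<in> V"
    and normed_fun_space_norm_commute: "N (\<lambda>i. f i - g i) = N (\<lambda>i. g i - f i)"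
proof -
  have *: "(\<lambda>i. f i - g i) \<in> V" if "f \<in> V" "g \<in> V" for f g
    using normed_fun_space_add [OF V that(1) normed_fun_space_scale [OF V that(2), of "-1"]] by simp
  show "(\<lambda>i. f i - g i) \<in> V" using * f g by blast
  show "N (\<lambda>i. f i - g i) = N (\<lambda>i. g i - f i)"
    using normed_fun_space_norm_scale [OF V * [OF g f], of "-1"] by simp
qed

lemma normed_fun_space_subspace:
  assumes "normed_fun_space V N" "U \<subseteq> V" "(\<lambda>i. 0) \<in> U"
    and "\<And>f g. f \<in> U \<Longrightarrow> g \<in> U \<Longrightarrow> (\<lambda>i. f i + g i) \<in> U" "\<And>c f. f \<in> U \<Longrightarrow> (\<lambda>i. c *\<^sub>R f i) \<in> U"
  shows "normed_fun_space U N"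
  using assms unfolding normed_fun_space_def by (simp add: subset_iff)

lemma continuous_map_norm_topology:
  assumes V: "normed_fun_space V N"
  shows "continuous_map (norm_topology V N) euclideanreal F \<longleftrightarrow>
    (\<forall>f\<in>V. \<forall>\<epsilon>>0. \<exists>\<delta>>0. \<forall>g\<in>V. N (\<lambda>i. f i - g i) < \<delta> \<longrightarrow> \<bar>F f - F g\<bar> < \<epsilon>)"
proof -
  have "continuous_map (norm_topology V N) Met_TC.mtopology F \<longleftrightarrow>
      F ` V \<subseteq> UNIV \<and> (\<forall>f\<in>V. \<forall>\<epsilon>>0. \<exists>\<delta>>0. \<forall>g. g \<in> V \<and> norm_dist V N f g < \<delta> \<longrightarrow> dist (F f) (F g) < \<epsilon>)"
    unfolding norm_topology_def
    by (rule Metric_space.metric_continuous_map [OF Metric_space_norm_dist [OF V] Met_TC.Metric_space_axioms])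
  then show ?thesis
    by (simp add: norm_dist_def dist_real_def cong: conj_cong) (simp only: Ball_def imp_conjL)
qed

lemma norm_topology_closure_of:
  assumes V: "normed_fun_space V N" and S: "S \<subseteq> V"
  shows "norm_topology V N closure_of S = {f \<in> V. \<forall>r>0. \<exists>g\<in>S. N (\<lambda>i. f i - g i) < r}"
proof -
  interpret Metric_space V "norm_dist V N" by (rule Metric_space_norm_dist [OF V])
  show ?thesis
    unfolding norm_topology_def metric_closure_of using S by (auto simp: norm_dist_def subset_iff)
qed

lemma bounded_imp_continuous_map_norm_topology:
  assumes V: "normed_fun_space V N"
    and diff: "\<And>f g. f \<in> V \<Longrightarrow> g \<in> V \<Longrightarrow> F f - F g = F (\<lambda>i. f i - g i)"
    and bound: "\<And>f. f \<in> V \<Longrightarrow> \<bar>F f\<bar> \<le> C * N f"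
  shows "continuous_map (norm_topology V N) euclideanreal F"
  unfolding continuous_map_norm_topology [OF V]
proof (intro ballI allI impI)
  fix f and \<epsilon> :: real assume f: "f \<in> V" and \<epsilon>: "0 < \<epsilon>"
  show "\<exists>\<delta>>0. \<forall>g\<in>V. N (\<lambda>i. f i - g i) < \<delta> \<longrightarrow> \<bar>F f - F g\<bar> < \<epsilon>"
  proof (intro exI [of _ "\<epsilon> / (\<bar>C\<bar> + 1)"] conjI ballI impI)
    show "0 < \<epsilon> / (\<bar>C\<bar> + 1)" using \<epsilon> by (simp add: divide_pos_pos)
    fix g assume g: "g \<in> V" and lt: "N (\<lambda>i. f i - g i) < \<epsilon> / (\<bar>C\<bar> + 1)"
    note fg = normed_fun_space_diff [OF V f g]
    have "\<bar>F f - F g\<bar> \<le> C * N (\<lambda>i. f i - g i)" using bound [OF fg] diff [OF f g] by simp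
    also have "\<dots> \<le> (\<bar>C\<bar> + 1) * N (\<lambda>i. f i - g i)"
      using normed_fun_space_norm_nonneg [OF V fg] by (intro mult_right_mono) auto
    also have "\<dots> < \<epsilon>" using lt by (simp add: pos_less_divide_eq mult.commute)
    finally show "\<bar>F f - F g\<bar> < \<epsilon>" .
  qed
qed

lemma
  assumes "F \<in> dual_space V N"
  shows dual_space_add: "f \<in> V \<Longrightarrow> g \<in> V \<Longrightarrow> F (\<lambda>i. f i + g i) = F f + F g"
    and dual_space_scale: "f \<in> V \<Longrightarrow> F (\<lambda>i. c *\<^sub>R f i) = c * F f"
    and dual_space_continuous: "continuous_map (norm_topology V N) euclideanreal F"
    and dual_space_outside: "f \<notin> V \<Longrightarrow> F f = 0"
  using assms unfolding dual_space_def by simp_all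

lemma dual_space_bounded:
  assumes V: "normed_fun_space V N" and F: "F \<in> dual_space V N"
  obtains C where "0 \<le> C" "\<And>f. f \<in> V \<Longrightarrow> \<bar>F f\<bar> \<le> C * N f"
proof -
  have F0: "F (\<lambda>i. 0) = 0"
    using dual_space_scale [OF F normed_fun_space_zero [OF V], of 0] by simp
  obtain \<delta> where \<delta>: "0 < \<delta>" and cont: "\<And>g. g \<in> V \<Longrightarrow> N (\<lambda>i. 0 - g i) < \<delta> \<Longrightarrow> \<bar>F (\<lambda>i. 0) - F g\<bar> < 1"
    using dual_space_continuous [OF F, unfolded continuous_map_norm_topology [OF V], rule_format,
        OF normed_fun_space_zero [OF V], of 1] by auto
  have small: "\<bar>F g\<bar> < 1" if g: "g \<in> V" "N g < \<delta>" for g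
    using cont [OF g(1)] g(2) normed_fun_space_norm_scale [OF V g(1), of "-1"] F0 by simp
  have "\<bar>F f\<bar> \<le> 2 / \<delta> * N f" if f: "f \<in> V" for f
  proof (cases "N f = 0")
    case True
    then show ?thesis using normed_fun_space_norm_eq_0 [OF V f] F0 by simp
  next
    case False
    then have pos: "0 < N f" using normed_fun_space_norm_nonneg [OF V f] by linarith
    \<comment> \<open>Scaling to norm \<open>\<delta> / 2\<close> stays strictly inside the ball
      where \<open>F\<close> is below 1, whence the constant \<open>2 / \<delta>\<close>.\<close>
    let ?c = "\<delta> / (2 * N f)"
    have c: "0 < ?c" using pos \<delta> by simp
    have "N (\<lambda>i. ?c *\<^sub>R f i) = \<delta> / 2"
      using pos c \<delta> by (simp add: normed_fun_space_norm_scale [OF V f])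
    then have "\<bar>F (\<lambda>i. ?c *\<^sub>R f i)\<bar> < 1"
      using \<delta> by (intro small normed_fun_space_scale [OF V f]) simp
    then have "?c * \<bar>F f\<bar> < 1" by (simp only: dual_space_scale [OF F f] abs_mult abs_of_pos [OF c])
    then show ?thesis using pos \<delta> by (simp add: field_simps)
  qed
  then show ?thesis using \<delta> by (intro that [of "2 / \<delta>"]) simp_all
qed

lemma dual_norm_least:
  assumes V: "normed_fun_space V N" and bound: "\<And>f. f \<in> V \<Longrightarrow> \<bar>F f\<bar> \<le> C * N f" and C: "0 \<le> C"
  shows "dual_norm V N F \<le> C"
  unfolding dual_norm_def
proof (rule cSUP_least)
  show "{f \<in> V. N f \<le> 1} \<noteq> {}"
    using normed_fun_space_zero [OF V] normed_fun_space_norm_eq_0 [OF V normed_fun_space_zero [OF V]]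
    by (auto intro!: exI [of _ "\<lambda>i. 0"])
  fix f assume f: "f \<in> {f \<in> V. N f \<le> 1}"
  then have "C * N f \<le> C * 1" using C by (intro mult_left_mono) auto
  then show "\<bar>F f\<bar> \<le> C" using bound [of f] f by simp
qed

lemma
  assumes V: "normed_fun_space V N" and F: "F \<in> dual_space V N"
  shows dual_norm_nonneg: "0 \<le> dual_norm V N F"
    and abs_le_dual_norm: "f \<in> V \<Longrightarrow> \<bar>F f\<bar> \<le> dual_norm V N F * N f"
proof -
  obtain C where C: "0 \<le> C" "\<And>f. f \<in> V \<Longrightarrow> \<bar>F f\<bar> \<le> C * N f"
    by (rule dual_space_bounded [OF V F]) (rule that)
  have upper: "\<bar>F f\<bar> \<le> dual_norm V N F" if f: "f \<in> V" "N f \<le> 1" for f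
    unfolding dual_norm_def
  proof (rule cSUP_upper)
    show "bdd_above ((\<lambda>f. \<bar>F f\<bar>) ` {f \<in> V. N f \<le> 1})"
    proof (rule bdd_aboveI2)
      fix f assume f: "f \<in> {f \<in> V. N f \<le> 1}"
      then have "C * N f \<le> C * 1" using C by (intro mult_left_mono) auto
      then show "\<bar>F f\<bar> \<le> C" using C(2) [of f] f by simp
    qed
  qed (use f in simp)
  have "N (\<lambda>i. 0) = 0"
    using normed_fun_space_norm_eq_0 [OF V normed_fun_space_zero [OF V]] by simp
  then have "\<bar>F (\<lambda>i. 0)\<bar> \<le> dual_norm V N F" by (intro upper normed_fun_space_zero [OF V]) simp
  then show "0 \<le> dual_norm V N F" by linarith
  assume f: "f \<in> V"
  show "\<bar>F f\<bar> \<le> dual_norm V N F * N f"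
  proof (cases "N f = 0")
    case True
    then show ?thesis using C(2) [OF f] by simp
  next
    case False
    then have pos: "0 < N f" using normed_fun_space_norm_nonneg [OF V f] by linarith
    have "\<bar>F (\<lambda>i. inverse (N f) *\<^sub>R f i)\<bar> \<le> dual_norm V N F"
      using pos by (intro upper normed_fun_space_scale [OF V f]) (simp add: normed_fun_space_norm_scale [OF V f])
    then have "inverse (N f) * \<bar>F f\<bar> \<le> dual_norm V N F"
      using pos by (simp add: dual_space_scale [OF F f] abs_mult)
    then show ?thesis using pos by (simp add: field_simps)
  qed
qed


section \<open>The spaces \<open>\<ell>\<^sup>\<tau>\<close>\<close>

definition single_seq :: "nat \<Rightarrow> 'b::zero \<Rightarrow> nat \<Rightarrow> 'b" where
  "single_seq j v = (\<lambda>i. if i = j then v else 0)"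

context tuple_norm_pair
begin

lemma tuple_norm_mono_length: "m \<le> n \<Longrightarrow> tuple_norm N m x \<le> tuple_norm N n x"
  unfolding tuple_norm_conv_krivine_norm
  by (intro norm_mono_nonneg krivine_norm_nonneg krivine_norm_mono_length)

lemma tuple_norm_zero_tail: "(\<And>i. m \<le> i \<Longrightarrow> x i = 0) \<Longrightarrow> tuple_norm N n x \<le> tuple_norm N m x"
  unfolding tuple_norm_conv_krivine_norm
  by (intro norm_mono_nonneg krivine_norm_nonneg krivine_norm_zero_tail)

lemma tuple_norm_trunc_seq: "tuple_norm N n (trunc_seq m x) \<le> tuple_norm N n x"
  unfolding tuple_norm_conv_krivine_norm
  by (intro norm_mono_nonneg krivine_norm_nonneg krivine_norm_trunc_seq)

lemma tuple_norm_add: "tuple_norm N n (\<lambda>i. x i + y i) \<le> tuple_norm N n x + tuple_norm N n y"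
proof -
  have "norm (krivine_norm N n (\<lambda>i. x i + y i)) \<le> norm (krivine_norm N n x + krivine_norm N n y)"
    by (intro norm_mono_nonneg krivine_norm_nonneg krivine_norm_add)
  then show ?thesis
    unfolding tuple_norm_conv_krivine_norm by (rule order_trans [OF _ norm_triangle_ineq])
qed

lemma tuple_norm_scale: "tuple_norm N n (\<lambda>i. c *\<^sub>R x i) \<le> \<bar>c\<bar> * tuple_norm N n x"
  using norm_mono_nonneg [OF krivine_norm_nonneg krivine_norm_scale, of n c x]
  by (simp add: tuple_norm_conv_krivine_norm)

text \<open>Coordinates are controlled by the norm; this yields definiteness of
  \<open>ell_tau_norm\<close>.\<close>

lemma norm_entry_le: "j < n \<Longrightarrow> norm (x j) \<le> M (unit_tuple j) * tuple_norm N n x"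
  using norm_mono_nonneg [OF abs_ge_zero abs_entry_le_krivine_norm, of j n x] M_unit_tuple_pos [of j]
  by (simp add: tuple_norm_conv_krivine_norm)

lemma tuple_norm_single: "tuple_norm N n (single_seq j v) \<le> N (unit_tuple j) * norm v"
proof -
  have "norm (krivine_norm N n (single_seq j v)) \<le> norm (N (unit_tuple j) *\<^sub>R \<bar>single_seq j v j\<bar>)"
    by (intro norm_mono_nonneg krivine_norm_nonneg krivine_norm_single) (simp add: single_seq_def)
  then show ?thesis
    using nonneg(1) [OF unit_tuple_in_tuples [OF lessI], of j]
    by (simp add: tuple_norm_conv_krivine_norm single_seq_def)
qed

lemma ell_tau_boundI:
  fixes x :: "nat \<Rightarrow> 'a::banach_lattice"
  assumes "\<And>n. tuple_norm N n x \<le> C"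
  shows "x \<in> ell_tau N" "ell_tau_norm N x \<le> C"
proof -
  show "x \<in> ell_tau N"
    unfolding ell_tau_def using assms by (auto intro!: bdd_aboveI2)
  show "ell_tau_norm N x \<le> C"
    unfolding ell_tau_norm_def by (rule cSUP_least) (use assms in auto)
qed

lemma tuple_norm_le_ell_tau_norm:
  assumes "x \<in> ell_tau N"
  shows "tuple_norm N n x \<le> ell_tau_norm N x"
proof -
  \<comment> \<open>The supremum starts at length 1, so length 0 is compared with length 1.\<close>
  have "tuple_norm N n x \<le> tuple_norm N (max 1 n) x" by (rule tuple_norm_mono_length) simp
  also have "\<dots> \<le> ell_tau_norm N x"
    unfolding ell_tau_norm_def
    by (rule cSUP_upper) (use assms in \<open>simp_all add: ell_tau_def\<close>)
  finally show ?thesis .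
qed

lemma normed_fun_space_ell_tau:
  "normed_fun_space (ell_tau N :: (nat \<Rightarrow> 'a::banach_lattice) set) (ell_tau_norm N)"
proof -
  have zero: "tuple_norm N n (\<lambda>i. 0 :: 'a) \<le> 0" for n
    using tuple_norm_scale [of n 0 "\<lambda>i. 0 :: 'a"] by simp
  have nn: "0 \<le> ell_tau_norm N x" if "x \<in> ell_tau N" for x :: "nat \<Rightarrow> 'a"
    using tuple_norm_le_ell_tau_norm [OF that, of 0] by (simp add: tuple_norm_def) (meson norm_ge_zero order_trans)
  have add: "(\<lambda>i. x i + y i) \<in> ell_tau N \<and> ell_tau_norm N (\<lambda>i. x i + y i) \<le> ell_tau_norm N x + ell_tau_norm N y"
    if "x \<in> ell_tau N" "y \<in> ell_tau N" for x y :: "nat \<Rightarrow> 'a"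
  proof -
    have "tuple_norm N n (\<lambda>i. x i + y i) \<le> ell_tau_norm N x + ell_tau_norm N y" for n
      using tuple_norm_add [of n x y] tuple_norm_le_ell_tau_norm [OF that(1), of n]
        tuple_norm_le_ell_tau_norm [OF that(2), of n] by linarith
    then show ?thesis using ell_tau_boundI by blast
  qed
  have scale_le: "(\<lambda>i. c *\<^sub>R x i) \<in> ell_tau N \<and> ell_tau_norm N (\<lambda>i. c *\<^sub>R x i) \<le> \<bar>c\<bar> * ell_tau_norm N x"
    if "x \<in> ell_tau N" for c and x :: "nat \<Rightarrow> 'a"
  proof -
    have "tuple_norm N n (\<lambda>i. c *\<^sub>R x i) \<le> \<bar>c\<bar> * ell_tau_norm N x" for n
      by (rule order_trans [OF tuple_norm_scale]) (intro mult_left_mono tuple_norm_le_ell_tau_norm that abs_ge_zero)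
    then show ?thesis using ell_tau_boundI by blast
  qed
  have scale: "ell_tau_norm N (\<lambda>i. c *\<^sub>R x i) = \<bar>c\<bar> * ell_tau_norm N x" if x: "x \<in> ell_tau N" for c and x :: "nat \<Rightarrow> 'a"
  proof (cases "c = 0")
    case True
    then show ?thesis using scale_le [OF x, of c] nn [of "\<lambda>i. c *\<^sub>R x i"] by simp
  next
    case False
    have "ell_tau_norm N (\<lambda>i. inverse c *\<^sub>R c *\<^sub>R x i) \<le> \<bar>inverse c\<bar> * ell_tau_norm N (\<lambda>i. c *\<^sub>R x i)"
      using scale_le scale_le [OF x, of c] by blast
    then have "\<bar>c\<bar> * ell_tau_norm N x \<le> \<bar>c\<bar> * (\<bar>inverse c\<bar> * ell_tau_norm N (\<lambda>i. c *\<^sub>R x i))"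
      using False by (intro mult_left_mono) simp_all
    then have "\<bar>c\<bar> * ell_tau_norm N x \<le> ell_tau_norm N (\<lambda>i. c *\<^sub>R x i)" using False by (simp add: field_simps)
    then show ?thesis using scale_le [OF x, of c] by linarith
  qed
  have eq_0: "ell_tau_norm N x = 0 \<longleftrightarrow> x = (\<lambda>i. 0)" if x: "x \<in> ell_tau N" for x :: "nat \<Rightarrow> 'a"
  proof
    assume 0: "ell_tau_norm N x = 0"
    have "x j = 0" for j
    proof -
      have "norm (x j) \<le> M (unit_tuple j) * tuple_norm N (Suc j) x" by (rule norm_entry_le) simp
      also have "\<dots> \<le> M (unit_tuple j) * 0"
        using tuple_norm_le_ell_tau_norm [OF x, of "Suc j"] 0 M_unit_tuple_pos [of j]
        by (intro mult_left_mono) auto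
      finally show ?thesis by simp
    qed
    then show "x = (\<lambda>i. 0)" by (simp add: fun_eq_iff)
  next
    assume "x = (\<lambda>i. 0)"
    then show "ell_tau_norm N x = 0"
      using ell_tau_boundI(2) [OF zero] nn [OF x] by simp
  qed
  show ?thesis
    unfolding normed_fun_space_def
  proof (intro conjI ballI allI)
    show "(\<lambda>i. 0) \<in> (ell_tau N :: (nat \<Rightarrow> 'a) set)" by (rule ell_tau_boundI(1) [OF zero])
  qed (use add scale_le scale eq_0 nn in blast)+
qed

lemma finite_support_in_ell_tau:
  assumes "\<And>i. m \<le> i \<Longrightarrow> x i = 0"
  shows "x \<in> ell_tau N" "ell_tau_norm N x \<le> tuple_norm N m x" "x \<in> ell_tau_00 N"
proof -
  have le: "tuple_norm N n x \<le> tuple_norm N m x" for n by (rule tuple_norm_zero_tail [OF assms])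
  show *: "x \<in> ell_tau N" "ell_tau_norm N x \<le> tuple_norm N m x"
    by (rule ell_tau_boundI [OF le])+
  show "x \<in> ell_tau_00 N" using *(1) assms by (auto simp: ell_tau_00_def)
qed

lemma ell_tau_norm_trunc_seq:
  assumes "x \<in> ell_tau N"
  shows "ell_tau_norm N (trunc_seq m x) \<le> ell_tau_norm N x"
  by (rule ell_tau_boundI(2)) (rule order_trans [OF tuple_norm_trunc_seq tuple_norm_le_ell_tau_norm [OF assms]])

lemma trunc_seq_in_ell_tau_00: "trunc_seq m x \<in> ell_tau_00 N"
  by (rule finite_support_in_ell_tau(3) [of m]) (simp add: trunc_seq_def)

lemma single_seq_in_ell_tau_00: "single_seq j v \<in> ell_tau_00 N"
  by (rule finite_support_in_ell_tau(3) [of "Suc j"]) (simp add: single_seq_def)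

lemma normed_fun_space_ell_tau_00:
  "normed_fun_space (ell_tau_00 N :: (nat \<Rightarrow> 'a::banach_lattice) set) (ell_tau_norm N)"
proof (rule normed_fun_space_subspace [OF normed_fun_space_ell_tau])
  show "ell_tau_00 N \<subseteq> (ell_tau N :: (nat \<Rightarrow> 'a) set)" by (auto simp: ell_tau_00_def)
  show "(\<lambda>i. 0) \<in> (ell_tau_00 N :: (nat \<Rightarrow> 'a) set)" by (rule finite_support_in_ell_tau(3) [of 0]) simp
  fix f g :: "nat \<Rightarrow> 'a" and c :: real
  assume f: "f \<in> ell_tau_00 N"
  then obtain m where m: "\<And>i. m \<le> i \<Longrightarrow> f i = 0" by (auto simp: ell_tau_00_def)
  show "(\<lambda>i. c *\<^sub>R f i) \<in> ell_tau_00 N" by (rule finite_support_in_ell_tau(3) [of m]) (simp add: m)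
  assume "g \<in> ell_tau_00 N"
  then obtain n where n: "\<And>i. n \<le> i \<Longrightarrow> g i = 0" by (auto simp: ell_tau_00_def)
  show "(\<lambda>i. f i + g i) \<in> ell_tau_00 N" by (rule finite_support_in_ell_tau(3) [of "max m n"]) (simp add: m n)
qed

lemma ell_tau_0_iff:
  fixes x :: "nat \<Rightarrow> 'a::banach_lattice"
  shows "x \<in> ell_tau_0 N \<longleftrightarrow> x \<in> ell_tau N \<and> (\<forall>r>0. \<exists>y\<in>ell_tau_00 N. ell_tau_norm N (\<lambda>i. x i - y i) < r)"
  unfolding ell_tau_0_def
  by (subst norm_topology_closure_of [OF normed_fun_space_ell_tau]) (auto simp: ell_tau_00_def)

lemma ell_tau_0_subset: "ell_tau_0 N \<subseteq> ell_tau N"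
  by (auto simp: ell_tau_0_iff)

lemma ell_tau_00_subset: "ell_tau_00 N \<subseteq> (ell_tau_0 N :: (nat \<Rightarrow> 'a::banach_lattice) set)"
proof
  fix x :: "nat \<Rightarrow> 'a" assume x: "x \<in> ell_tau_00 N"
  have "ell_tau_norm N (\<lambda>i. x i - x i) = 0"
    using normed_fun_space_norm_eq_0 [OF normed_fun_space_ell_tau normed_fun_space_zero [OF normed_fun_space_ell_tau]]
    by simp
  then have "\<exists>y\<in>ell_tau_00 N. ell_tau_norm N (\<lambda>i. x i - y i) < r" if "0 < r" for r
    using x that by (intro bexI [of _ x]) simp_all
  then show "x \<in> ell_tau_0 N" using x unfolding ell_tau_0_iff by (simp add: ell_tau_00_def)
qed

text \<open>For a finitely supported \<open>y\<close> close to \<open>x\<close> and \<open>m\<close>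
  beyond its support, the remainder of \<open>x\<close> is \<open>x - y\<close> plus the truncation
  of \<open>y - x\<close>, and truncation does not increase the norm.\<close>

lemma trunc_seq_tendsto:
  fixes x :: "nat \<Rightarrow> 'a::banach_lattice"
  assumes x: "x \<in> ell_tau_0 N" and r: "0 < r"
  shows "\<exists>K. \<forall>m\<ge>K. ell_tau_norm N (\<lambda>i. x i - trunc_seq m x i) < r"
proof -
  note V = normed_fun_space_ell_tau [where 'a = 'a]
  have xV: "x \<in> ell_tau N" using x ell_tau_0_subset by blast
  obtain y where y: "y \<in> ell_tau_00 N" "ell_tau_norm N (\<lambda>i. x i - y i) < r / 2"
    using x r unfolding ell_tau_0_iff by (metis half_gt_zero)
  then have yV: "y \<in> ell_tau N" by (simp add: ell_tau_00_def)
  obtain K where K: "\<And>i. K \<le> i \<Longrightarrow> y i = 0" using y(1) by (auto simp: ell_tau_00_def)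
  note xy = normed_fun_space_diff [OF V xV yV] and yx = normed_fun_space_diff [OF V yV xV]
  have "ell_tau_norm N (\<lambda>i. x i - trunc_seq m x i) < r" if m: "K \<le> m" for m
  proof -
    have "trunc_seq m (\<lambda>i. y i - x i) \<in> ell_tau N"
      using trunc_seq_in_ell_tau_00 by (auto simp: ell_tau_00_def)
    from normed_fun_space_norm_add [OF V xy this]
    have "ell_tau_norm N (\<lambda>i. (x i - y i) + trunc_seq m (\<lambda>i. y i - x i) i)
        \<le> ell_tau_norm N (\<lambda>i. x i - y i) + ell_tau_norm N (\<lambda>i. y i - x i)"
      using ell_tau_norm_trunc_seq [OF yx, of m] by linarith
    moreover have "(\<lambda>i. (x i - y i) + trunc_seq m (\<lambda>i. y i - x i) i) = (\<lambda>i. x i - trunc_seq m x i)"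
      using K m by (auto simp: fun_eq_iff trunc_seq_def)
    ultimately show ?thesis
      using y(2) normed_fun_space_norm_commute [OF V xV yV] by simp
  qed
  then show ?thesis by blast
qed

lemma normed_fun_space_ell_tau_0:
  "normed_fun_space (ell_tau_0 N :: (nat \<Rightarrow> 'a::banach_lattice) set) (ell_tau_norm N)"
proof (rule normed_fun_space_subspace [OF normed_fun_space_ell_tau ell_tau_0_subset])
  note V = normed_fun_space_ell_tau [where 'a = 'a] and V0 = normed_fun_space_ell_tau_00 [where 'a = 'a]
  show "(\<lambda>i. 0) \<in> (ell_tau_0 N :: (nat \<Rightarrow> 'a) set)"
    using normed_fun_space_zero [OF V0] ell_tau_00_subset by blast
  fix f g :: "nat \<Rightarrow> 'a" and c :: real
  assume f: "f \<in> ell_tau_0 N"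
  then have fV: "f \<in> ell_tau N" using ell_tau_0_subset by blast
  show "(\<lambda>i. c *\<^sub>R f i) \<in> ell_tau_0 N"
    unfolding ell_tau_0_iff
  proof (intro conjI allI impI)
    show "(\<lambda>i. c *\<^sub>R f i) \<in> ell_tau N" by (rule normed_fun_space_scale [OF V fV])
    fix r :: real assume r: "0 < r"
    then have "0 < r / (\<bar>c\<bar> + 1)" by (simp add: divide_pos_pos)
    then obtain y where y: "y \<in> ell_tau_00 N" "ell_tau_norm N (\<lambda>i. f i - y i) < r / (\<bar>c\<bar> + 1)"
      using f unfolding ell_tau_0_iff by blast
    then have yV: "y \<in> ell_tau N" by (simp add: ell_tau_00_def)
    note fy = normed_fun_space_diff [OF V fV yV]
    have "ell_tau_norm N (\<lambda>i. c *\<^sub>R f i - c *\<^sub>R y i) = \<bar>c\<bar> * ell_tau_norm N (\<lambda>i. f i - y i)"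
      using normed_fun_space_norm_scale [OF V fy, of c] by (simp add: scaleR_right_diff_distrib)
    also have "\<dots> \<le> (\<bar>c\<bar> + 1) * ell_tau_norm N (\<lambda>i. f i - y i)"
      using normed_fun_space_norm_nonneg [OF V fy] by (intro mult_right_mono) auto
    also have "\<dots> < r" using y(2) by (simp add: pos_less_divide_eq mult.commute)
    finally show "\<exists>y\<in>ell_tau_00 N. ell_tau_norm N (\<lambda>i. c *\<^sub>R f i - y i) < r"
      using normed_fun_space_scale [OF V0 y(1), of c] by (intro bexI [of _ "\<lambda>i. c *\<^sub>R y i"])
  qed
  assume g: "g \<in> ell_tau_0 N"
  then have gV: "g \<in> ell_tau N" using ell_tau_0_subset by blast
  show "(\<lambda>i. f i + g i) \<in> ell_tau_0 N"
    unfolding ell_tau_0_iff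
  proof (intro conjI allI impI)
    show "(\<lambda>i. f i + g i) \<in> ell_tau N" by (rule normed_fun_space_add [OF V fV gV])
    fix r :: real assume r: "0 < r"
    then obtain y z where y: "y \<in> ell_tau_00 N" "ell_tau_norm N (\<lambda>i. f i - y i) < r / 2"
      and z: "z \<in> ell_tau_00 N" "ell_tau_norm N (\<lambda>i. g i - z i) < r / 2"
      using f g unfolding ell_tau_0_iff by (metis half_gt_zero)
    then have "y \<in> ell_tau N" "z \<in> ell_tau N" by (simp_all add: ell_tau_00_def)
    then have "ell_tau_norm N (\<lambda>i. (f i - y i) + (g i - z i)) < r"
      using normed_fun_space_norm_add [OF V normed_fun_space_diff [OF V fV] normed_fun_space_diff [OF V gV], of y z]
        y(2) z(2) by linarith
    then have "ell_tau_norm N (\<lambda>i. f i + g i - (y i + z i)) < r" by (simp add: algebra_simps)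
    then show "\<exists>y\<in>ell_tau_00 N. ell_tau_norm N (\<lambda>i. f i + g i - y i) < r"
      using normed_fun_space_add [OF V0 y(1) z(1)] by (intro bexI [of _ "\<lambda>i. y i + z i"])
  qed
qed

end

section \<open>The duality map\<close>

context tuple_norm_pair
begin

interpretation dual: tuple_norm_pair M N by (rule dual)

section \<open>The pairing on the closure of the finitely supported sequences\<close>

lemma seq_pairing_finite_support:
  assumes "\<And>i. m \<le> i \<Longrightarrow> x i = 0"
  shows "seq_pairing s x = (\<Sum>i<m. blinfun_apply (s i) (x i))"
  unfolding seq_pairing_def by (rule suminf_finite) (use assms in \<open>auto simp: not_less\<close>)

lemma abs_partial_pairing_le:
  assumes "s \<in> ell_tau M" "x \<in> ell_tau N"
  shows "\<bar>\<Sum>i<n. blinfun_apply (s i) (x i)\<bar> \<le> ell_tau_norm M s * ell_tau_norm N x"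
proof -
  have "tuple_norm M n s * tuple_norm N n x \<le> ell_tau_norm M s * ell_tau_norm N x"
  proof (rule mult_mono)
    show "0 \<le> ell_tau_norm M s"
      using normed_fun_space_norm_nonneg [OF dual.normed_fun_space_ell_tau assms(1)] .
  qed (use assms dual.tuple_norm_le_ell_tau_norm tuple_norm_le_ell_tau_norm in \<open>auto simp: tuple_norm_def\<close>)
  then show ?thesis using abs_sum_apply_le [of s x n] by linarith
qed

text \<open>Convergence on the whole closure means that the continuous extension is given by the
  same series as on finitely supported sequences.\<close>

lemma summable_pairing:
  fixes s :: "nat \<Rightarrow> 'a::banach_lattice \<Rightarrow>\<^sub>L real"
  assumes s: "s \<in> ell_tau M" and x: "x \<in> ell_tau_0 N"
  shows "summable (\<lambda>i. blinfun_apply (s i) (x i))"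
  unfolding summable_Cauchy
proof (intro allI impI)
  fix e :: real assume e: "0 < e"
  let ?S = "ell_tau_norm M s"
  have S: "0 \<le> ?S" using normed_fun_space_norm_nonneg [OF dual.normed_fun_space_ell_tau s] .
  have xV: "x \<in> ell_tau N" using x ell_tau_0_subset by blast
  have "0 < e / (?S + 1)" using e S by (simp add: divide_pos_pos)
  from trunc_seq_tendsto [OF x this] obtain K
    where K: "\<forall>m\<ge>K. ell_tau_norm N (\<lambda>i. x i - trunc_seq m x i) < e / (?S + 1)" ..
  have "norm (\<Sum>i=m..<n. blinfun_apply (s i) (x i)) < e" if m: "K \<le> m" for m n
  proof (cases "m \<le> n")
    case True
    \<comment> \<open>A block of the series from \<open>m\<close> on is a partial pairing with this
      remainder, whose norm is small.\<close>
    let ?d = "\<lambda>i. x i - trunc_seq m x i"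
    have "trunc_seq m x \<in> ell_tau N" using trunc_seq_in_ell_tau_00 by (auto simp: ell_tau_00_def)
    then have d: "?d \<in> ell_tau N" by (rule normed_fun_space_diff [OF normed_fun_space_ell_tau xV])
    have "(\<Sum>i=m..<n. blinfun_apply (s i) (x i)) = (\<Sum>i=m..<n. blinfun_apply (s i) (?d i))"
      by (intro sum.cong) (auto simp: trunc_seq_def)
    also have "\<dots> = (\<Sum>i<n. blinfun_apply (s i) (?d i))"
      by (rule sum.mono_neutral_left) (auto simp: trunc_seq_def not_le blinfun.zero_right)
    finally have "\<bar>\<Sum>i=m..<n. blinfun_apply (s i) (x i)\<bar> \<le> ?S * ell_tau_norm N ?d"
      using abs_partial_pairing_le [OF s d, of n] by simp
    also have "\<dots> \<le> (?S + 1) * ell_tau_norm N ?d"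
      using normed_fun_space_norm_nonneg [OF normed_fun_space_ell_tau d] by (intro mult_right_mono) auto
    also have "\<dots> < e" using K m S by (simp add: pos_less_divide_eq mult.commute)
    finally show ?thesis by simp
  qed (use e in simp)
  then show "\<exists>K. \<forall>m\<ge>K. \<forall>n. norm (\<Sum>i=m..<n. blinfun_apply (s i) (x i)) < e" by blast
qed

lemma abs_seq_pairing_le:
  assumes s: "s \<in> ell_tau M" and x: "x \<in> ell_tau_0 N"
  shows "\<bar>seq_pairing s x\<bar> \<le> ell_tau_norm M s * ell_tau_norm N x"
proof (rule LIMSEQ_le_const2)
  show "(\<lambda>n. \<bar>\<Sum>i<n. blinfun_apply (s i) (x i)\<bar>) \<longlonglongrightarrow> \<bar>seq_pairing s x\<bar>"
    unfolding seq_pairing_def by (intro tendsto_rabs summable_LIMSEQ summable_pairing s x)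
  show "\<exists>K. \<forall>n\<ge>K. \<bar>\<Sum>i<n. blinfun_apply (s i) (x i)\<bar> \<le> ell_tau_norm M s * ell_tau_norm N x"
    using abs_partial_pairing_le [OF s] x ell_tau_0_subset by blast
qed

lemma seq_pairing_add_right:
  assumes "s \<in> ell_tau M" "x \<in> ell_tau_0 N" "y \<in> ell_tau_0 N"
  shows "seq_pairing s (\<lambda>i. x i + y i) = seq_pairing s x + seq_pairing s y"
  unfolding seq_pairing_def blinfun.add_right
  by (rule suminf_add [symmetric]) (intro summable_pairing assms)+

lemma seq_pairing_scale_right:
  assumes "s \<in> ell_tau M" "x \<in> ell_tau_0 N"
  shows "seq_pairing s (\<lambda>i. c *\<^sub>R x i) = c * seq_pairing s x"
  unfolding seq_pairing_def blinfun.scaleR_right real_scaleR_def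
  by (rule suminf_mult) (intro summable_pairing assms)

lemma seq_pairing_diff_right:
  assumes "s \<in> ell_tau M" "x \<in> ell_tau_0 N" "y \<in> ell_tau_0 N"
  shows "seq_pairing s x - seq_pairing s y = seq_pairing s (\<lambda>i. x i - y i)"
  unfolding seq_pairing_def blinfun.diff_right
  by (rule suminf_diff) (intro summable_pairing assms)+

lemma seq_pairing_add_left:
  assumes "s \<in> ell_tau M" "s' \<in> ell_tau M" "x \<in> ell_tau_0 N"
  shows "seq_pairing (\<lambda>i. s i + s' i) x = seq_pairing s x + seq_pairing s' x"
  unfolding seq_pairing_def blinfun.add_left
  by (rule suminf_add [symmetric]) (intro summable_pairing assms)+

lemma seq_pairing_scale_left:
  assumes "s \<in> ell_tau M" "x \<in> ell_tau_0 N"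
  shows "seq_pairing (\<lambda>i. c *\<^sub>R s i) x = c * seq_pairing s x"
  unfolding seq_pairing_def blinfun.scaleR_left real_scaleR_def
  by (rule suminf_mult) (intro summable_pairing assms)

text \<open>Formulated for a subspace \<open>U\<close> and any \<open>F\<close> that agrees with the
  pairing there, so as to cover both the pairing on \<open>ell_tau_00 N\<close> and its extension by
  0 outside \<open>ell_tau_0 N\<close>.\<close>

lemma continuous_seq_pairing:
  fixes s :: "nat \<Rightarrow> 'a::banach_lattice \<Rightarrow>\<^sub>L real"
  assumes s: "s \<in> ell_tau M" and U: "normed_fun_space U (ell_tau_norm N)" "U \<subseteq> ell_tau_0 N"
    and F: "\<And>x. x \<in> U \<Longrightarrow> F x = seq_pairing s x"
  shows "continuous_map (norm_topology U (ell_tau_norm N)) euclideanreal F"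
proof (rule bounded_imp_continuous_map_norm_topology [OF U(1)])
  show "\<bar>F x\<bar> \<le> ell_tau_norm M s * ell_tau_norm N x" if "x \<in> U" for x
    using abs_seq_pairing_le [OF s] F U(2) that by (simp add: subset_iff)
  show "F x - F y = F (\<lambda>i. x i - y i)" if "x \<in> U" "y \<in> U" for x y
    using seq_pairing_diff_right [OF s] F U(2) that normed_fun_space_diff [OF U(1) that] by (simp add: subset_iff)
qed

text \<open>Both functions agree on the dense subspace \<open>ell_tau_00 N\<close> and are
  continuous on its closure; outside it both are normalized to 0.\<close>

lemma continuous_extension_unique:
  fixes s :: "nat \<Rightarrow> 'a::banach_lattice \<Rightarrow>\<^sub>L real"
  assumes F: "is_continuous_extension N s F" and G: "is_continuous_extension N s G"
  shows "F = G"
proof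
  fix x :: "nat \<Rightarrow> 'a"
  note V0 = normed_fun_space_ell_tau_0 [where 'a = 'a]
  show "F x = G x"
  proof (cases "x \<in> ell_tau_0 N")
    case False
    then show ?thesis using F G by (simp add: is_continuous_extension_def)
  next
    case x: True
    have "\<bar>F x - G x\<bar> \<le> 0 + \<epsilon>" if "0 < \<epsilon>" for \<epsilon>
    proof -
      have e: "0 < \<epsilon> / 2" using that by simp
      obtain d where d: "0 < d" "\<forall>y\<in>ell_tau_0 N. ell_tau_norm N (\<lambda>i. x i - y i) < d \<longrightarrow> \<bar>F x - F y\<bar> < \<epsilon> / 2"
        using F x e unfolding is_continuous_extension_def continuous_map_norm_topology [OF V0] by meson
      obtain d' where d': "0 < d'" "\<forall>y\<in>ell_tau_0 N. ell_tau_norm N (\<lambda>i. x i - y i) < d' \<longrightarrow> \<bar>G x - G y\<bar> < \<epsilon> / 2"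
        using G x e unfolding is_continuous_extension_def continuous_map_norm_topology [OF V0] by meson
      obtain y where y: "y \<in> ell_tau_00 N" "ell_tau_norm N (\<lambda>i. x i - y i) < min d d'"
        using x d(1) d'(1) unfolding ell_tau_0_iff by (metis min_less_iff_conj)
      then have "y \<in> ell_tau_0 N" using ell_tau_00_subset by blast
      then have "\<bar>F x - F y\<bar> < \<epsilon> / 2" "\<bar>G x - G y\<bar> < \<epsilon> / 2" using d(2) d'(2) y(2) by simp_all
      moreover have "F y = G y" using F G y(1) by (simp add: is_continuous_extension_def)
      ultimately show ?thesis by linarith
    qed
    then have "\<bar>F x - G x\<bar> \<le> 0" by (rule field_le_epsilon)
    then show ?thesis by simp
  qed
qed

lemma is_continuous_extension_seq_pairing:
  fixes s :: "nat \<Rightarrow> 'a::banach_lattice \<Rightarrow>\<^sub>L real"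
  assumes s: "s \<in> ell_tau M"
  shows "is_continuous_extension N s (\<lambda>x. if x \<in> ell_tau_0 N then seq_pairing s x else 0)"
  unfolding is_continuous_extension_def
  using continuous_seq_pairing [OF s normed_fun_space_ell_tau_0 subset_refl] ell_tau_00_subset
  by (auto simp: subset_iff)

lemma duality_map_eqI: "is_continuous_extension N s F \<Longrightarrow> duality_map N s = F"
  unfolding duality_map_def by (rule the_equality) (auto intro: continuous_extension_unique)

lemma duality_map_eq:
  "s \<in> ell_tau M \<Longrightarrow> duality_map N s = (\<lambda>x. if x \<in> ell_tau_0 N then seq_pairing s x else 0)"
  by (rule duality_map_eqI [OF is_continuous_extension_seq_pairing])

lemma duality_map_in_dual_space:
  fixes s :: "nat \<Rightarrow> 'a::banach_lattice \<Rightarrow>\<^sub>L real"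
  assumes s: "s \<in> ell_tau M"
  shows "duality_map N s \<in> dual_space (ell_tau_0 N) (ell_tau_norm N)"
  unfolding dual_space_def duality_map_eq [OF s]
  using continuous_seq_pairing [OF s normed_fun_space_ell_tau_0 subset_refl]
  by (simp add: seq_pairing_add_right [OF s] seq_pairing_scale_right [OF s]
      normed_fun_space_add [OF normed_fun_space_ell_tau_0] normed_fun_space_scale [OF normed_fun_space_ell_tau_0])

section \<open>The lower norm estimate and surjectivity\<close>

text \<open>\<open>F\<close> and its components \<open>s\<close> are kept general because the
  estimate serves twice: for the image of a given \<open>s\<close> it bounds the dual norm from
  below, and for a given \<open>F\<close> it shows that the components lie in
  \<open>ell_tau M\<close>.\<close>

lemma tuple_norm_le_dual_norm:
  fixes s :: "nat \<Rightarrow> 'a::banach_lattice \<Rightarrow>\<^sub>L real"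
  assumes F: "F \<in> dual_space (ell_tau_0 N) (ell_tau_norm N)"
    and s: "\<And>n x. (\<And>i. n \<le> i \<Longrightarrow> x i = 0) \<Longrightarrow> F x = (\<Sum>i<n. blinfun_apply (s i) (x i))"
  shows "tuple_norm M n s \<le> dual_norm (ell_tau_0 N) (ell_tau_norm N) F"
proof (rule tuple_norm_dual_le)
  let ?D = "dual_norm (ell_tau_0 N) (ell_tau_norm N) F"
  show D: "0 \<le> ?D" by (rule dual_norm_nonneg [OF normed_fun_space_ell_tau_0 F])
  fix x :: "nat \<Rightarrow> 'a" assume x: "\<And>i. n \<le> i \<Longrightarrow> x i = 0"
  have "x \<in> ell_tau_0 N" using finite_support_in_ell_tau(3) [of n x] x ell_tau_00_subset by blast
  then have "F x \<le> ?D * ell_tau_norm N x"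
    using abs_le_dual_norm [OF normed_fun_space_ell_tau_0 F, of x] by simp
  also have "\<dots> \<le> ?D * tuple_norm N n x"
    by (intro mult_left_mono D finite_support_in_ell_tau(2) x)
  finally show "(\<Sum>i<n. blinfun_apply (s i) (x i)) \<le> ?D * tuple_norm N n x" using s [OF x] by simp
qed

lemma dual_norm_duality_map:
  fixes s :: "nat \<Rightarrow> 'a::banach_lattice \<Rightarrow>\<^sub>L real"
  assumes s: "s \<in> ell_tau M"
  shows "dual_norm (ell_tau_0 N) (ell_tau_norm N) (duality_map N s) = ell_tau_norm M s"
proof (rule antisym)
  show "dual_norm (ell_tau_0 N) (ell_tau_norm N) (duality_map N s) \<le> ell_tau_norm M s"
  proof (rule dual_norm_least [OF normed_fun_space_ell_tau_0])
    show "\<bar>duality_map N s x\<bar> \<le> ell_tau_norm M s * ell_tau_norm N x" if "x \<in> ell_tau_0 N" for x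
      using abs_seq_pairing_le [OF s that] that by (simp add: duality_map_eq [OF s])
    show "0 \<le> ell_tau_norm M s" by (rule normed_fun_space_norm_nonneg [OF dual.normed_fun_space_ell_tau s])
  qed
  have fin: "duality_map N s x = (\<Sum>i<n. blinfun_apply (s i) (x i))" if "\<And>i. n \<le> i \<Longrightarrow> x i = 0" for n and x :: "nat \<Rightarrow> 'a"
  proof -
    have "x \<in> ell_tau_0 N" using finite_support_in_ell_tau(3) [of n x] that ell_tau_00_subset by blast
    then show ?thesis using that by (simp add: duality_map_eq [OF s] seq_pairing_finite_support [of n x])
  qed
  show "ell_tau_norm M s \<le> dual_norm (ell_tau_0 N) (ell_tau_norm N) (duality_map N s)"
    by (rule dual.ell_tau_boundI(2)) (rule tuple_norm_le_dual_norm [OF duality_map_in_dual_space [OF s] fin])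
qed

lemma inj_on_duality_map: "inj_on (duality_map N) (ell_tau M :: (nat \<Rightarrow> 'a::banach_lattice \<Rightarrow>\<^sub>L real) set)"
proof (rule inj_onI)
  fix s s' :: "nat \<Rightarrow> 'a \<Rightarrow>\<^sub>L real"
  assume s: "s \<in> ell_tau M" "s' \<in> ell_tau M" and eq: "duality_map N s = duality_map N s'"
  have "blinfun_apply (s j) v = blinfun_apply (s' j) v" for j v
  proof -
    have x: "single_seq j v \<in> ell_tau_0 N" using single_seq_in_ell_tau_00 ell_tau_00_subset by blast
    have "seq_pairing t (single_seq j v) = blinfun_apply (t j) v" for t :: "nat \<Rightarrow> 'a \<Rightarrow>\<^sub>L real"
    proof -
      have "seq_pairing t (single_seq j v) = (\<Sum>i\<in>{j}. blinfun_apply (t i) (single_seq j v i))"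
        unfolding seq_pairing_def by (rule suminf_finite) (auto simp: single_seq_def blinfun.zero_right)
      then show ?thesis by (simp add: single_seq_def)
    qed
    then show ?thesis using fun_cong [OF eq, of "single_seq j v"] x
      by (simp add: duality_map_eq [OF s(1)] duality_map_eq [OF s(2)])
  qed
  then show "s = s'" by (intro ext blinfun_eqI)
qed

text \<open>The components are the restrictions of \<open>F\<close> to sequences with a single
  nonzero entry, and linearity recovers \<open>F\<close> on finitely supported sequences. Uniqueness
  of the continuous extension then identifies \<open>F\<close> with the image of
  \<open>s\<close>.\<close>

lemma surj_duality_map:
  fixes F :: "(nat \<Rightarrow> 'a::banach_lattice) \<Rightarrow> real"
  assumes F: "F \<in> dual_space (ell_tau_0 N) (ell_tau_norm N)"
  shows "F \<in> duality_map N ` ell_tau M"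
proof -
  note V0 = normed_fun_space_ell_tau_0 [where 'a = 'a]
  have single: "single_seq j v \<in> ell_tau_0 N" for j and v :: 'a
    using single_seq_in_ell_tau_00 ell_tau_00_subset by blast
  have bl: "bounded_linear (\<lambda>v. F (single_seq j v))" for j
  proof
    fix v w :: 'a and c :: real
    have "single_seq j (v + w) = (\<lambda>i. single_seq j v i + single_seq j w i)"
      "single_seq j (c *\<^sub>R v) = (\<lambda>i. c *\<^sub>R single_seq j v i)"
      by (auto simp: single_seq_def fun_eq_iff)
    then show "F (single_seq j (v + w)) = F (single_seq j v) + F (single_seq j w)"
      "F (single_seq j (c *\<^sub>R v)) = c *\<^sub>R F (single_seq j v)"
      using dual_space_add [OF F single single] dual_space_scale [OF F single] by simp_all
  next
    obtain C where C: "0 \<le> C" "\<And>x. x \<in> ell_tau_0 N \<Longrightarrow> \<bar>F x\<bar> \<le> C * ell_tau_norm N x"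
      by (rule dual_space_bounded [OF V0 F]) (rule that)
    have "norm (F (single_seq j v)) \<le> norm v * (C * N (unit_tuple j))" for v
    proof -
      have "ell_tau_norm N (single_seq j v) \<le> N (unit_tuple j) * norm v"
        by (rule ell_tau_boundI(2) [OF tuple_norm_single])
      then have "C * ell_tau_norm N (single_seq j v) \<le> C * (N (unit_tuple j) * norm v)"
        by (rule mult_left_mono [OF _ C(1)])
      then show ?thesis using C(2) [OF single, of j v] by (simp add: mult_ac)
    qed
    then show "\<exists>K. \<forall>v. norm (F (single_seq j v)) \<le> norm v * K" by blast
  qed
  define s where "s j = Blinfun (\<lambda>v. F (single_seq j v))" for j
  have s: "blinfun_apply (s j) v = F (single_seq j v)" for j v
    unfolding s_def by (simp add: bounded_linear_Blinfun_apply [OF bl])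
  have trunc: "F (trunc_seq n x) = (\<Sum>i<n. blinfun_apply (s i) (x i))" for n x
  proof (induction n)
    case 0
    have "trunc_seq 0 x = (\<lambda>i. 0 *\<^sub>R trunc_seq 0 x i)" by (simp add: trunc_seq_def)
    moreover have "trunc_seq 0 x \<in> ell_tau_0 N" using trunc_seq_in_ell_tau_00 ell_tau_00_subset by blast
    ultimately show ?case using dual_space_scale [OF F, of "trunc_seq 0 x" 0] by simp
  next
    case (Suc n)
    have "trunc_seq (Suc n) x = (\<lambda>i. trunc_seq n x i + single_seq n (x n) i)"
      by (auto simp: trunc_seq_def single_seq_def fun_eq_iff less_Suc_eq)
    moreover have "trunc_seq n x \<in> ell_tau_0 N" using trunc_seq_in_ell_tau_00 ell_tau_00_subset by blast
    ultimately show ?case using dual_space_add [OF F _ single] Suc.IH by (simp add: s)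
  qed
  have fin: "F x = (\<Sum>i<n. blinfun_apply (s i) (x i))" if "\<And>i. n \<le> i \<Longrightarrow> x i = 0" for n x
  proof -
    have "trunc_seq n x = x" using that by (auto simp: trunc_seq_def fun_eq_iff)
    then show ?thesis using trunc [of n x] by simp
  qed
  have sM: "s \<in> ell_tau M"
    by (rule dual.ell_tau_boundI(1)) (rule tuple_norm_le_dual_norm [OF F fin])
  have "is_continuous_extension N s F"
    unfolding is_continuous_extension_def
  proof (intro conjI ballI allI impI)
    show "continuous_map (norm_topology (ell_tau_0 N) (ell_tau_norm N)) euclideanreal F"
      by (rule dual_space_continuous [OF F])
    show "F x = 0" if "x \<notin> ell_tau_0 N" for x by (rule dual_space_outside [OF F that])
    fix x :: "nat \<Rightarrow> 'a" assume "x \<in> ell_tau_00 N"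
    then obtain m where "\<And>i. m \<le> i \<Longrightarrow> x i = 0" by (auto simp: ell_tau_00_def)
    then show "F x = seq_pairing s x" using fin [of m x] seq_pairing_finite_support [of m x s] by simp
  qed
  then have "duality_map N s = F" by (rule duality_map_eqI)
  then show ?thesis using sM by blast
qed

theorem isometric_isomorphism_duality_map:
  "isometric_isomorphism
     (ell_tau M :: (nat \<Rightarrow> 'a::banach_lattice \<Rightarrow>\<^sub>L real) set) (ell_tau_norm M)
     (dual_space (ell_tau_0 N) (ell_tau_norm N)) (dual_norm (ell_tau_0 N) (ell_tau_norm N))
     (duality_map N)"
  unfolding isometric_isomorphism_def
proof (intro conjI ballI allI)
  show "bij_betw (duality_map N) (ell_tau M :: (nat \<Rightarrow> 'a \<Rightarrow>\<^sub>L real) set)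
      (dual_space (ell_tau_0 N) (ell_tau_norm N))"
    unfolding bij_betw_def using inj_on_duality_map surj_duality_map duality_map_in_dual_space by blast
  fix s t :: "nat \<Rightarrow> 'a \<Rightarrow>\<^sub>L real" and c :: real
  assume s: "s \<in> ell_tau M"
  note V = dual.normed_fun_space_ell_tau
  show "duality_map N (\<lambda>i. c *\<^sub>R s i) = (\<lambda>x. c *\<^sub>R duality_map N s x)"
    unfolding duality_map_eq [OF s] duality_map_eq [OF normed_fun_space_scale [OF V s]]
    by (simp add: fun_eq_iff seq_pairing_scale_left [OF s])
  show "dual_norm (ell_tau_0 N) (ell_tau_norm N) (duality_map N s) = ell_tau_norm M s"
    by (rule dual_norm_duality_map [OF s])
  assume t: "t \<in> ell_tau M"
  show "duality_map N (\<lambda>i. s i + t i) = (\<lambda>x. duality_map N s x + duality_map N t x)"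
    unfolding duality_map_eq [OF s] duality_map_eq [OF t] duality_map_eq [OF normed_fun_space_add [OF V s t]]
    by (simp add: fun_eq_iff seq_pairing_add_left [OF s t])
qed

end

theorem theorem32:
  fixes Y :: "(nat \<Rightarrow> real) set" and N :: "(nat \<Rightarrow> real) \<Rightarrow> real"
  assumes "banach_sequence_lattice Y N"
  shows "(\<forall>s \<in> (ell_tau (kothe_norm Y N) :: (nat \<Rightarrow> 'a::banach_lattice \<Rightarrow>\<^sub>L real) set).
            continuous_map (norm_topology (ell_tau_00 N) (ell_tau_norm N)) euclideanreal (seq_pairing s) \<and>
            (\<exists>!F. is_continuous_extension N s F)) \<and>
         isometric_isomorphism
           (ell_tau (kothe_norm Y N) :: (nat \<Rightarrow> 'a \<Rightarrow>\<^sub>L real) set)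
           (ell_tau_norm (kothe_norm Y N))
           (dual_space (ell_tau_0 N) (ell_tau_norm N))
           (dual_norm (ell_tau_0 N) (ell_tau_norm N))
           (duality_map N)"
proof -
  interpret tuple_norm_pair N "kothe_norm Y N" by (rule tuple_norm_pair_kothe_norm [OF assms])
  show ?thesis
  proof (intro conjI ballI isometric_isomorphism_duality_map)
    fix s :: "nat \<Rightarrow> 'a \<Rightarrow>\<^sub>L real" assume s: "s \<in> ell_tau (kothe_norm Y N)"
    show "continuous_map (norm_topology (ell_tau_00 N) (ell_tau_norm N)) euclideanreal (seq_pairing s)"
      by (rule continuous_seq_pairing [OF s normed_fun_space_ell_tau_00 ell_tau_00_subset]) (rule refl)
    show "\<exists>!F. is_continuous_extension N s F"
      by (rule ex1I [where P = "is_continuous_extension N s", OF is_continuous_extension_seq_pairing [OF s]])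
        (rule continuous_extension_unique [OF _ is_continuous_extension_seq_pairing [OF s]])
  qed
qed

end
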